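(* Let $\{P_t\}_{t\geq 0}$ be a Markov--Feller semigroup on a Polish space $\mathcal{X}$. The following are equivalent: (i) $\{P_t\}_{t\geq 0}$ is weakly-* mean ergodic (with unique invariant measure $\mu$); (ii) $\{P_t\}_{t\geq 0}$ is Ces\`aro eventually continuous at every point of $\mathcal{X}$ and there exists $z\in\mathcal{X}$ such that for every $\epsilon>0$, $\inf_{x\in\mathcal{X}}\limsup_{t\to\infty}Q_t(x,B(z,\epsilon))>0$.
   Context: $(\mathcal{X},\rho)$ is a Polish space, $\mathcal{P}(\mathcal{X})$ the Borel probability measures, $B(z,\epsilon)$ the open ball. A Markov--Feller semigroup $\{P_t\}_{t\ge0}$ is a semigroup of mass-preserving positively linear operators on finite Borel measures, each with a dual linear operator on bounded Borel functions ($\langle f,P_t\mu\rangle=\langle P_tf,\mu\rangle$) preserving bounded continuous functions. For $t>0$: $Q_tf(x)=\frac1t\int_0^tP_sf(x)\,ds$, $Q_t\nu=\frac1t\int_0^tP_s\nu\,ds$, $Q_t(x,\cdot)=Q_t\delta_x$. Weakly-* mean ergodic: there is a unique invariant probability measure $\mu_*$ and $Q_t\nu\to\mu_*$ weakly as $t\to\infty$ for every $\nu\in\mathcal{P}(\mathcal{X})$. Ces\`aro eventually continuous at $z$: for every bounded Lipschitz $f$, $\limsup_{x\to z}\limsup_{t\to\infty}|Q_tf(x)-Q_tf(z)|=0$. *)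

theory Defs
  imports "HOL-Probability.Probability"
begin

text \<open>A Markov--Feller semigroup on a Polish space, represented by its transition
  kernels: K t x = P_t delta_x, so that P_t nu = nu bind K t and
  P_t f x = integral of f w.r.t. K t x (the dual operator).\<close>

definition markov_feller :: "(real \<Rightarrow> 'a::polish_space \<Rightarrow> 'a measure) \<Rightarrow> bool" where
  "markov_feller K \<longleftrightarrow>
     (\<forall>t\<ge>0. K t \<in> measurable borel (subprob_algebra borel)) \<and>
     (\<forall>t\<ge>0. \<forall>x. prob_space (K t x) \<and> sets (K t x) = sets borel) \<and>
     (\<forall>x. K 0 x = return borel x) \<and>
     (\<forall>s\<ge>0. \<forall>t\<ge>0. \<forall>x. K (s + t) x = K s x \<bind> K t) \<and>
     (\<forall>t\<ge>0. \<forall>f::'a \<Rightarrow> real. continuous_on UNIV f \<and> bounded (range f) \<longrightarrow>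
        continuous_on UNIV (\<lambda>x. \<integral>y. f y \<partial>K t x)) \<and>
     (\<forall>A\<in>sets borel. (\<lambda>(s,x). measure (K s x) A)
        \<in> borel_measurable (restrict_space borel ({0..} \<times> UNIV)))"

definition bcontinuous :: "('a::topological_space \<Rightarrow> real) \<Rightarrow> bool" where
  "bcontinuous f \<longleftrightarrow> continuous_on UNIV f \<and> bounded (range f)"

definition blipschitz :: "('a::metric_space \<Rightarrow> real) \<Rightarrow> bool" where
  "blipschitz f \<longleftrightarrow> bounded (range f) \<and> (\<exists>L. L-lipschitz_on UNIV f)"

definition Qf :: "(real \<Rightarrow> 'a \<Rightarrow> 'a measure) \<Rightarrow> real \<Rightarrow> ('a \<Rightarrow> real) \<Rightarrow> 'a \<Rightarrow> real" where
  "Qf K t f x = (1 / t) * (LINT s:{0..t}|lborel. (\<integral>y. f y \<partial>K s x))"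

definition Qx :: "(real \<Rightarrow> 'a \<Rightarrow> 'a measure) \<Rightarrow> real \<Rightarrow> 'a \<Rightarrow> 'a set \<Rightarrow> real" where
  "Qx K t x A = (1 / t) * (LINT s:{0..t}|lborel. measure (K s x) A)"

text \<open>the pairing < f, Q_t nu > = (1/t) int_0^t < f, P_s nu > ds\<close>
definition Qnu :: "(real \<Rightarrow> 'a \<Rightarrow> 'a measure) \<Rightarrow> real \<Rightarrow> 'a measure \<Rightarrow> ('a \<Rightarrow> real) \<Rightarrow> real" where
  "Qnu K t \<nu> f = (1 / t) * (LINT s:{0..t}|lborel. (\<integral>y. f y \<partial>(\<nu> \<bind> K s)))"

definition borel_prob :: "'a::topological_space measure \<Rightarrow> bool" where
  "borel_prob \<mu> \<longleftrightarrow> prob_space \<mu> \<and> sets \<mu> = sets borel"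

definition invariant :: "(real \<Rightarrow> 'a \<Rightarrow> 'a measure) \<Rightarrow> 'a::topological_space measure \<Rightarrow> bool" where
  "invariant K \<mu> \<longleftrightarrow> borel_prob \<mu> \<and> (\<forall>t\<ge>0. \<mu> \<bind> K t = \<mu>)"

definition weak_star_mean_ergodic :: "(real \<Rightarrow> 'a::topological_space \<Rightarrow> 'a measure) \<Rightarrow> bool" where
  "weak_star_mean_ergodic K \<longleftrightarrow>
     (\<exists>!\<mu>. invariant K \<mu>) \<and>
     (\<forall>\<mu>. invariant K \<mu> \<longrightarrow>
        (\<forall>\<nu>. borel_prob \<nu> \<longrightarrow> (\<forall>f. bcontinuous f \<longrightarrow>
            ((\<lambda>t. Qnu K t \<nu> f) \<longlongrightarrow> (\<integral>y. f y \<partial>\<mu>)) at_top)))"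

definition cesaro_ev_cont :: "(real \<Rightarrow> 'a::metric_space \<Rightarrow> 'a measure) \<Rightarrow> 'a \<Rightarrow> bool" where
  "cesaro_ev_cont K z \<longleftrightarrow>
     (\<forall>f. blipschitz f \<longrightarrow>
        Limsup (nhds z) (\<lambda>x. Limsup at_top (\<lambda>t. ereal \<bar>Qf K t f x - Qf K t f z\<bar>)) = 0)"

end

theory Submission
  imports Defs
begin

text \<open>Weak mean ergodicity gives the two conditions by testing convergence on Dirac measures and on a ball around a
  point of the support of the invariant measure. Conversely, near \<open>z\<close> the averages \<open>Q t f\<close> nearly agree in the long run, and every
  point returns near \<open>z\<close> with mass bounded below; hence \<open>Q t f x - Q t f z\<close> tends to \<open>0\<close> for all \<open>x\<close>, and it remains
  to find an invariant measure, for which tightness of the averages started at \<open>z\<close> is enough.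

  By Baire category, the convergence \<open>Q n f y - Q n f z \<rightarrow> 0\<close> is uniform up to \<open>\<eta>\<close> over a neighbourhood \<open>A\<close> of some Lipschitz function
  and a nonempty open piece \<open>W\<close> of the set reachable from \<open>z\<close>. A limit of averages is a finitely additive invariant
  mean \<open>\<Lambda>\<close>, which can be chosen to charge \<open>W\<close>. Weighting \<open>\<Lambda>\<close> by the probability of hitting \<open>W\<close> within a long fixed time gives an almost
  invariant functional concentrated where \<open>Q n f \<approx> Q n f z\<close>, so \<open>Q n f z\<close> is nearly constant for \<open>n\<close> beyond a threshold that is the same
  for all \<open>f\<close> in \<open>A\<close>. Perturbing the centre of \<open>A\<close> outside large finite unions of balls then yields tightness.\<close>

section \<open>Bounded Borel functions and finitely additive means\<close>

text \<open>The obstacle is that merging is pointwise: the time after which \<open>Q n f y\<close>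
  and \<open>Q n f z\<close> agree depends on \<open>f\<close> and on \<open>y\<close>, whereas
  tightness needs one time that serves many test functions. Baire category restores uniformity only
  on some open set, and the topology decides whether that helps. Test functions carry the product
  topology of their values on a dense sequence, so a neighbourhood constrains finitely many values
  and still contains functions altered by up to \<open>1\<close> far from those points; a small
  sup-norm ball would not. Points range over the closed reachable set because every average started
  at \<open>z\<close> has full mass there, so a mean that charges an open set charges its reachable
  part equally. Before tightness is known, limits come only from Tychonoff compactness, hence
  finitely additive means. Restricting \<open>\<Lambda>\<close> to \<open>W\<close> would destroy
  invariance; a hitting probability is nearly harmonic in \<open>\<Lambda>\<close>-mean and nearly
  \<open>0\<close>-\<open>1\<close> valued, which makes it a usable weight. In the end one fixed
  time controls all later ones, and at a fixed time dominated convergence suffices.\<close>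

definition bdd_borel :: "('a::topological_space \<Rightarrow> real) set" where
  "bdd_borel = {f. f \<in> borel_measurable borel \<and> bounded (range f)}"

lemma bdd_borelI:
  assumes "f \<in> borel_measurable borel" "\<And>x. \<bar>f x\<bar> \<le> B"
  shows "f \<in> bdd_borel"
  using assms by (auto simp: bdd_borel_def bounded_iff)

lemma bdd_borelE:
  assumes "f \<in> bdd_borel"
  obtains B where "B \<ge> 0" "\<And>x. \<bar>f x\<bar> \<le> B"
proof -
  from assms obtain B where "\<And>x. \<bar>f x\<bar> \<le> B"
    by (auto simp: bdd_borel_def bounded_iff)
  then show ?thesis using that[of "max B 0"] by (metis max.coboundedI1 max.cobounded2)
qed

lemma bdd_borel_measurable: "f \<in> bdd_borel \<Longrightarrow> f \<in> borel_measurable borel"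
  by (simp add: bdd_borel_def)

lemma bdd_borel_const [intro, simp]: "(\<lambda>_. c) \<in> bdd_borel"
  by (rule bdd_borelI[of _ "\<bar>c\<bar>"]) auto

lemma bdd_borel_indicator [intro, simp]: "A \<in> sets borel \<Longrightarrow> indicator A \<in> bdd_borel"
  by (rule bdd_borelI[of _ 1]) (auto simp: indicator_def)

lemma bdd_borel_add [intro]:
  assumes "f \<in> bdd_borel" "g \<in> bdd_borel" shows "(\<lambda>x. f x + g x) \<in> bdd_borel"
proof -
  obtain B C where "\<And>x. \<bar>f x\<bar> \<le> B" "\<And>x. \<bar>g x\<bar> \<le> C" using assms by (meson bdd_borelE)
  then have "\<bar>f x + g x\<bar> \<le> B + C" for x by (meson abs_triangle_ineq add_mono order_trans)
  then show ?thesis using bdd_borel_measurable[OF assms(1)] bdd_borel_measurable[OF assms(2)]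
    by (intro bdd_borelI) (simp_all, measurable)
qed

lemma bdd_borel_mult [intro]:
  assumes "f \<in> bdd_borel" "g \<in> bdd_borel" shows "(\<lambda>x. f x * g x) \<in> bdd_borel"
proof -
  obtain B C where "B \<ge> 0" "\<And>x. \<bar>f x\<bar> \<le> B" "\<And>x. \<bar>g x\<bar> \<le> C" using assms by (meson bdd_borelE)
  then have "\<bar>f x * g x\<bar> \<le> B * C" for x by (simp add: abs_mult mult_mono)
  then show ?thesis using bdd_borel_measurable[OF assms(1)] bdd_borel_measurable[OF assms(2)]
    by (intro bdd_borelI) (simp_all, measurable)
qed

lemma bdd_borel_cmult [intro]: "f \<in> bdd_borel \<Longrightarrow> (\<lambda>x. c * f x) \<in> bdd_borel"
  by (rule bdd_borel_mult) auto

lemma bdd_borel_uminus [intro]: "f \<in> bdd_borel \<Longrightarrow> (\<lambda>x. - f x) \<in> bdd_borel"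
  using bdd_borel_cmult[of f "-1"] by simp

lemma bdd_borel_diff [intro]:
  assumes "f \<in> bdd_borel" "g \<in> bdd_borel" shows "(\<lambda>x. f x - g x) \<in> bdd_borel"
  using bdd_borel_add[OF assms(1) bdd_borel_cmult[OF assms(2), of "-1"]] by simp

lemma bdd_borel_abs [intro]:
  assumes "f \<in> bdd_borel" shows "(\<lambda>x. \<bar>f x\<bar>) \<in> bdd_borel"
proof -
  obtain B where "\<And>x. \<bar>f x\<bar> \<le> B" using assms by (meson bdd_borelE)
  with bdd_borel_measurable[OF assms] show ?thesis by (intro bdd_borelI[of _ B]) (simp_all, measurable)
qed

lemma bdd_borel_max [intro]:
  assumes "f \<in> bdd_borel" "g \<in> bdd_borel" shows "(\<lambda>x. max (f x) (g x)) \<in> bdd_borel"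
proof -
  have "max a b = (1/2) * ((a + b) + \<bar>a - b\<bar>)" for a b :: real by auto
  then show ?thesis using assms by (simp only:) (intro bdd_borel_cmult bdd_borel_add bdd_borel_abs bdd_borel_diff)
qed

lemma bdd_borel_sum [intro]: "(\<And>i. i \<in> I \<Longrightarrow> f i \<in> bdd_borel) \<Longrightarrow> (\<lambda>x. \<Sum>i\<in>I. f i x) \<in> bdd_borel"
  by (induction I rule: infinite_finite_induct) auto

section \<open>Integrals of bounded Borel functions against Borel probability measures\<close>

lemma borel_prob_integrable:
  assumes "borel_prob \<mu>" "f \<in> bdd_borel"
  shows "integrable \<mu> f"
proof -
  interpret prob_space \<mu> using assms by (simp add: borel_prob_def)
  have [measurable_cong]: "sets \<mu> = sets borel" using assms by (simp add: borel_prob_def)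
  obtain B where "\<And>x. \<bar>f x\<bar> \<le> B" using assms by (meson bdd_borelE)
  with assms show ?thesis by (intro integrable_const_bound[of _ B]) (auto simp: bdd_borel_def)
qed

lemma borel_prob_integral_le:
  assumes "borel_prob \<mu>" "f \<in> bdd_borel" "\<And>x. f x \<le> C"
  shows "(\<integral>x. f x \<partial>\<mu>) \<le> C"
proof -
  interpret prob_space \<mu> using assms by (simp add: borel_prob_def)
  show ?thesis using assms borel_prob_integrable[OF assms(1,2)] by (intro integral_le_const) auto
qed

lemma borel_prob_integral_ge:
  assumes "borel_prob \<mu>" "f \<in> bdd_borel" "\<And>x. C \<le> f x"
  shows "C \<le> (\<integral>x. f x \<partial>\<mu>)"
proof -
  interpret prob_space \<mu> using assms by (simp add: borel_prob_def)
  show ?thesis using assms borel_prob_integrable[OF assms(1,2)] by (intro integral_ge_const) auto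
qed

lemma borel_prob_integral_abs_le:
  assumes "borel_prob \<mu>" "f \<in> bdd_borel" "\<And>x. \<bar>f x\<bar> \<le> C"
  shows "\<bar>\<integral>x. f x \<partial>\<mu>\<bar> \<le> C"
proof -
  have "f x \<le> C" "- C \<le> f x" for x using assms(3)[of x] by auto
  then show ?thesis using borel_prob_integral_le[OF assms(1,2), of C] borel_prob_integral_ge[OF assms(1,2), of "-C"] by (simp add: abs_le_iff)
qed

lemma borel_prob_space [simp]: "borel_prob \<mu> \<Longrightarrow> space \<mu> = UNIV"
  by (metis borel_prob_def sets_eq_imp_space_eq space_borel)

text \<open>The axioms constrain \<open>\<Lambda>\<close> on \<open>bdd_borel\<close> only, and
  there is no continuity axiom: such functionals arise as limits of probability measures without any
  tightness. \<open>M\<close> is the associated finitely additive probability on Borel sets.\<close>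

locale fa_mean =
  fixes \<Lambda> :: "('a::metric_space \<Rightarrow> real) \<Rightarrow> real"
  assumes add: "f \<in> bdd_borel \<Longrightarrow> g \<in> bdd_borel \<Longrightarrow> \<Lambda> (\<lambda>x. f x + g x) = \<Lambda> f + \<Lambda> g"
    and scale: "f \<in> bdd_borel \<Longrightarrow> \<Lambda> (\<lambda>x. c * f x) = c * \<Lambda> f"
    and nonneg: "f \<in> bdd_borel \<Longrightarrow> (\<And>x. 0 \<le> f x) \<Longrightarrow> 0 \<le> \<Lambda> f"
    and one: "\<Lambda> (\<lambda>_. 1) = 1"
begin

lemma const: "\<Lambda> (\<lambda>_. c) = c"
  using scale[of "\<lambda>_. 1" c] one by simp

lemma diff: "f \<in> bdd_borel \<Longrightarrow> g \<in> bdd_borel \<Longrightarrow> \<Lambda> (\<lambda>x. f x - g x) = \<Lambda> f - \<Lambda> g"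
  using add[of f "\<lambda>x. (-1) * g x"] scale[of g "-1"] by (simp add: bdd_borel_uminus)

lemma mono: "f \<in> bdd_borel \<Longrightarrow> g \<in> bdd_borel \<Longrightarrow> (\<And>x. f x \<le> g x) \<Longrightarrow> \<Lambda> f \<le> \<Lambda> g"
  using nonneg[of "\<lambda>x. g x - f x"] diff[of g f] by (simp add: bdd_borel_diff)

lemma le_const: "f \<in> bdd_borel \<Longrightarrow> (\<And>x. f x \<le> c) \<Longrightarrow> \<Lambda> f \<le> c"
  using mono[of f "\<lambda>_. c"] const by simp

lemma abs_le: "f \<in> bdd_borel \<Longrightarrow> \<bar>\<Lambda> f\<bar> \<le> \<Lambda> (\<lambda>x. \<bar>f x\<bar>)"
  using mono[of f "\<lambda>x. \<bar>f x\<bar>"] mono[of "\<lambda>x. (-1) * f x" "\<lambda>x. \<bar>f x\<bar>"] scale[of f "-1"]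
  by (auto simp: abs_le_iff bdd_borel_abs bdd_borel_uminus)

lemma sum:
  assumes "\<And>i. i \<in> I \<Longrightarrow> f i \<in> bdd_borel"
  shows "\<Lambda> (\<lambda>x. \<Sum>i\<in>I. f i x) = (\<Sum>i\<in>I. \<Lambda> (f i))"
  using assms
proof (induction I rule: infinite_finite_induct)
  case (insert i I)
  then show ?case using add[of "f i" "\<lambda>x. \<Sum>i\<in>I. f i x"] by (simp add: bdd_borel_sum)
qed (simp_all add: const)

abbreviation M :: "'a set \<Rightarrow> real" where "M A \<equiv> \<Lambda> (indicator A)"

lemma M_mono: "A \<in> sets borel \<Longrightarrow> B \<in> sets borel \<Longrightarrow> A \<subseteq> B \<Longrightarrow> M A \<le> M B"
  by (rule mono) (auto simp: indicator_def)

lemma M_disjoint_Un: "A \<in> sets borel \<Longrightarrow> B \<in> sets borel \<Longrightarrow> A \<inter> B = {} \<Longrightarrow> M (A \<union> B) = M A + M B"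
  using add[of "indicator A" "indicator B"] by (simp add: indicator_add)

lemma M_Un_le: "A \<in> sets borel \<Longrightarrow> B \<in> sets borel \<Longrightarrow> M (A \<union> B) \<le> M A + M B"
  using M_disjoint_Un[of A "B - A"] M_mono[of "B - A" B] by (simp add: sets.Diff)

lemma M_Union_le: "finite I \<Longrightarrow> (\<And>i. i \<in> I \<Longrightarrow> A i \<in> sets borel) \<Longrightarrow> M (\<Union>i\<in>I. A i) \<le> (\<Sum>i\<in>I. M (A i))"
proof (induction I rule: finite_induct)
  case empty then show ?case using const[of 0] by (simp add: indicator_def[abs_def])
next
  case (insert i I)
  then show ?case using M_Un_le[of "A i" "\<Union>i\<in>I. A i"] sets.finite_UN[of I A borel] by fastforce
qed

lemma M_nonneg: "A \<in> sets borel \<Longrightarrow> 0 \<le> M A"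
  by (rule nonneg) auto

lemma M_UNIV: "M UNIV = 1"
  using one by (simp add: indicator_def[abs_def])

lemma M_empty: "M {} = 0"
  using const[of 0] by (simp add: indicator_def[abs_def])

lemma M_Diff: "A \<in> sets borel \<Longrightarrow> B \<in> sets borel \<Longrightarrow> B \<subseteq> A \<Longrightarrow> M (A - B) = M A - M B"
  using M_disjoint_Un[of "A - B" B] by (simp add: sets.Diff Un_absorb2 Int_commute)

lemma M_Compl: "A \<in> sets borel \<Longrightarrow> M (- A) = 1 - M A"
  using M_Diff[of UNIV A] M_UNIV by (simp add: Compl_eq_Diff_UNIV)

end

text \<open>Tychonoff: for each \<open>f\<close> the integrals stay in a compact interval, so the
  family of all integrals clusters in a product of intervals. The finer filter \<open>G\<close> is
  returned as well, because a property that holds eventually along \<open>F\<close> still holds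
  along \<open>G\<close>.\<close>

lemma fa_mean_cluster:
  fixes m :: "'i \<Rightarrow> 'a::metric_space measure"
  assumes m: "\<And>i. borel_prob (m i)" and F: "F \<noteq> bot"
  obtains \<Lambda> G where "fa_mean \<Lambda>" "G \<le> F" "G \<noteq> bot"
    "\<And>f. f \<in> bdd_borel \<Longrightarrow> ((\<lambda>i. \<integral>x. f x \<partial>m i) \<longlongrightarrow> \<Lambda> f) G"
proof -
  \<comment> \<open>The value \<open>0\<close> off \<open>bdd_borel\<close> keeps those coordinates
    bounded too; the absolute value in \<open>C\<close> guarantees that their intervals contain
    \<open>0\<close>.\<close>
  define v where "v i f = (if f \<in> bdd_borel then \<integral>x. f x \<partial>m i else 0)" for i and f :: "'a \<Rightarrow> real"
  define b where "b f = (SOME B. f \<in> bdd_borel \<longrightarrow> (\<forall>x. \<bar>f x\<bar> \<le> B) \<and> 0 \<le> B)" for f :: "'a \<Rightarrow> real"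
  have b: "\<bar>f x\<bar> \<le> b f" "0 \<le> b f" if "f \<in> bdd_borel" for f x
  proof -
    have "\<exists>B. f \<in> bdd_borel \<longrightarrow> (\<forall>x. \<bar>f x\<bar> \<le> B) \<and> 0 \<le> B" by (metis bdd_borelE)
    from someI_ex[OF this] that show "\<bar>f x\<bar> \<le> b f" "0 \<le> b f" unfolding b_def by auto
  qed
  define C where "C = PiE UNIV (\<lambda>f. cbox (- \<bar>b f\<bar>) \<bar>b f\<bar>)"
  have C: "compact C"
  proof -
    have "compactin (product_topology (\<lambda>_. euclidean) UNIV) C"
      unfolding C_def compactin_PiE by auto
    then show ?thesis by (simp add: euclidean_product_topology)
  qed
  have "v i \<in> C" for i
    using borel_prob_integral_abs_le[OF m _ b(1)] b(2) by (auto simp: C_def v_def abs_le_iff minus_le_iff) fastforce+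
  then have "eventually (\<lambda>x. x \<in> C) (filtermap v F)" by (simp add: eventually_filtermap)
  moreover have "filtermap v F \<noteq> bot" using F by (simp add: filtermap_bot_iff)
  ultimately obtain \<Lambda> where \<Lambda>: "inf (nhds \<Lambda>) (filtermap v F) \<noteq> bot"
    using C[unfolded compact_filter] by blast
  \<comment> \<open>Intersecting \<open>F\<close> with the pulled-back neighbourhoods of \<Lambda>
    forces convergence; properness of this filter is the cluster point property.\<close>
  define G where "G = inf F (filtercomap v (nhds \<Lambda>))"
  have "G \<noteq> bot"
  proof
    assume "G = bot"
    then have "eventually (\<lambda>_. False) G" by simp
    then obtain Q R where Q: "eventually Q F" "eventually R (filtercomap v (nhds \<Lambda>))" "\<And>x. Q x \<Longrightarrow> \<not> R x"
      unfolding G_def eventually_inf by metis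
    then obtain R' where R': "eventually R' (nhds \<Lambda>)" "\<And>x. R' (v x) \<Longrightarrow> R x"
      by (auto simp: eventually_filtercomap)
    have "eventually (\<lambda>y. \<not> R' y) (filtermap v F)"
      unfolding eventually_filtermap using Q(1) by eventually_elim (use Q(3) R'(2) in blast)
    with R'(1) have "eventually (\<lambda>_. False) (inf (nhds \<Lambda>) (filtermap v F))"
      unfolding eventually_inf by blast
    with \<Lambda> show False by (simp add: trivial_limit_def)
  qed
  have "filterlim v (nhds \<Lambda>) G"
    unfolding filterlim_iff_le_filtercomap G_def by simp
  then have lim: "((\<lambda>i. v i f) \<longlongrightarrow> \<Lambda> f) G" for f
    by (rule continuous_on_tendsto_compose[OF continuous_on_product_coordinates[of f]]) auto
  then have lim': "((\<lambda>i. \<integral>x. f x \<partial>m i) \<longlongrightarrow> \<Lambda> f) G" if "f \<in> bdd_borel" for f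
    using that lim[of f] by (simp add: v_def)
  have "fa_mean \<Lambda>"
  proof
    show "\<Lambda> (\<lambda>x. f x + g x) = \<Lambda> f + \<Lambda> g" if "f \<in> bdd_borel" "g \<in> bdd_borel" for f g
    proof (rule tendsto_unique[OF \<open>G \<noteq> bot\<close>])
      show "((\<lambda>i. \<integral>x. f x + g x \<partial>m i) \<longlongrightarrow> \<Lambda> (\<lambda>x. f x + g x)) G" using that by (intro lim') auto
      show "((\<lambda>i. \<integral>x. f x + g x \<partial>m i) \<longlongrightarrow> \<Lambda> f + \<Lambda> g) G"
        using tendsto_add[OF lim'[OF that(1)] lim'[OF that(2)]] borel_prob_integrable[OF m] that by simp
    qed
    show "\<Lambda> (\<lambda>x. c * f x) = c * \<Lambda> f" if "f \<in> bdd_borel" for f c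
    proof (rule tendsto_unique[OF \<open>G \<noteq> bot\<close>])
      show "((\<lambda>i. \<integral>x. c * f x \<partial>m i) \<longlongrightarrow> \<Lambda> (\<lambda>x. c * f x)) G" using that by (intro lim') auto
      show "((\<lambda>i. \<integral>x. c * f x \<partial>m i) \<longlongrightarrow> c * \<Lambda> f) G"
        using tendsto_mult_left[OF lim'[OF that]] borel_prob_integrable[OF m] that by simp
    qed
    show "0 \<le> \<Lambda> f" if "f \<in> bdd_borel" "\<And>x. 0 \<le> f x" for f
      using lim'[OF that(1)] by (rule tendsto_lowerbound) (auto simp: that \<open>G \<noteq> bot\<close>)
    show "\<Lambda> (\<lambda>_. 1) = 1"
    proof (rule tendsto_unique[OF \<open>G \<noteq> bot\<close>])
      show "((\<lambda>i. \<integral>x. (1::real) \<partial>m i) \<longlongrightarrow> \<Lambda> (\<lambda>_. 1)) G" by (intro lim') auto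
      have "(\<integral>x. (1::real) \<partial>m i) = 1" for i
        using m[of i] prob_space.prob_space[of "m i"] borel_prob_space[OF m[of i]] by (simp add: borel_prob_def)
      then show "((\<lambda>i. \<integral>x. 1 \<partial>m i) \<longlongrightarrow> (1::real)) G" by simp
    qed
  qed
  moreover have "G \<le> F" unfolding G_def by simp
  ultimately show thesis using that \<open>G \<noteq> bot\<close> lim' by blast
qed

section \<open>Lipschitz bumps and comparison of means with measures\<close>

lemma bcontinuous_bdd_borel: "bcontinuous f \<Longrightarrow> f \<in> bdd_borel"
  by (auto simp: bcontinuous_def bdd_borel_def intro: borel_measurable_continuous_onI)

lemma blipschitz_bcontinuous: "blipschitz f \<Longrightarrow> bcontinuous f"
  by (auto simp: blipschitz_def bcontinuous_def intro: lipschitz_on_continuous_on)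

text \<open>Lipschitz functions that increase with \<open>k\<close> to the indicator of an open
  \<open>U\<close>. The case \<open>U = UNIV\<close> is separate because \<open>infdist\<close> to
  the empty set is \<open>0\<close>.\<close>

definition bump :: "'a::metric_space set \<Rightarrow> nat \<Rightarrow> 'a \<Rightarrow> real" where
  "bump U k x = (if U = UNIV then 1 else min 1 (real k * infdist x (- U)))"

lemma bump_nonneg: "0 \<le> bump U k x"
  by (simp add: bump_def infdist_nonneg)

lemma bump_le_indicator: "bump U k x \<le> indicator U x"
  by (auto simp: bump_def indicator_def)

lemma bump_le_1: "bump U k x \<le> 1"
  by (simp add: bump_def)

lemma min_lipschitz_real:
  fixes f g :: "'a::metric_space \<Rightarrow> real"
  assumes "L-lipschitz_on X f" "L-lipschitz_on X g"
  shows "L-lipschitz_on X (\<lambda>x. min (f x) (g x))"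
proof (rule lipschitz_onI)
  fix x y assume "x \<in> X" "y \<in> X"
  then have "\<bar>f x - f y\<bar> \<le> L * dist x y" "\<bar>g x - g y\<bar> \<le> L * dist x y"
    using assms by (auto dest: lipschitz_onD simp: dist_real_def)
  then show "dist (min (f x) (g x)) (min (f y) (g y)) \<le> L * dist x y"
    unfolding dist_real_def by linarith
qed (use assms lipschitz_on_nonneg in blast)

lemma max_lipschitz_real:
  fixes f g :: "'a::metric_space \<Rightarrow> real"
  assumes "L-lipschitz_on X f" "L-lipschitz_on X g"
  shows "L-lipschitz_on X (\<lambda>x. max (f x) (g x))"
proof (rule lipschitz_onI)
  fix x y assume "x \<in> X" "y \<in> X"
  then have "\<bar>f x - f y\<bar> \<le> L * dist x y" "\<bar>g x - g y\<bar> \<le> L * dist x y"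
    using assms by (auto dest: lipschitz_onD simp: dist_real_def)
  then show "dist (max (f x) (g x)) (max (f y) (g y)) \<le> L * dist x y"
    unfolding dist_real_def by linarith
qed (use assms lipschitz_on_nonneg in blast)

lemma scaled_infdist_lipschitz: "L \<ge> 0 \<Longrightarrow> L-lipschitz_on UNIV (\<lambda>x. L * infdist x A)"
proof (rule lipschitz_onI)
  fix x y assume "L \<ge> 0"
  then show "dist (L * infdist x A) (L * infdist y A) \<le> L * dist x y"
    using mult_left_mono[OF infdist_triangle_abs[of x A y], of L]
    by (simp add: dist_real_def abs_mult right_diff_distrib[symmetric])
qed

lemma const_lipschitz: "L \<ge> 0 \<Longrightarrow> L-lipschitz_on UNIV (\<lambda>_. c)"
  by (rule lipschitz_onI) auto

lemma bump_lipschitz: "(real k)-lipschitz_on UNIV (bump U k)"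
proof (cases "U = UNIV")
  case True
  then show ?thesis using const_lipschitz[of "real k" 1] by (simp add: bump_def[abs_def])
next
  case False
  then show ?thesis
    using min_lipschitz_real[OF const_lipschitz[of "real k" 1] scaled_infdist_lipschitz[of "real k" "- U"]]
    by (simp add: bump_def[abs_def])
qed

lemma bump_blipschitz: "blipschitz (bump U k)"
  unfolding blipschitz_def
proof
  show "bounded (range (bump U k))"
    using bump_nonneg[of U k] bump_le_1[of U k] by (auto simp: bounded_iff intro!: exI[of _ 1])
qed (use bump_lipschitz in blast)

lemma bump_bdd_borel: "bump U k \<in> bdd_borel"
  by (intro bcontinuous_bdd_borel blipschitz_bcontinuous bump_blipschitz)

lemma bump_tendsto:
  assumes "open U"
  shows "(\<lambda>k. bump U k x) \<longlonglongrightarrow> indicator U x"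
proof (cases "x \<in> U \<and> U \<noteq> UNIV")
  case True
  then have "infdist x (- U) > 0"
    using assms by (intro infdist_pos_not_in_closed) auto
  then obtain N where N: "real N * infdist x (- U) > 1"
    using reals_Archimedean3 by blast
  have "bump U k x = indicator U x" if "k \<ge> N" for k
  proof -
    have "real N * infdist x (- U) \<le> real k * infdist x (- U)"
      using that by (intro mult_right_mono) (auto simp: infdist_nonneg)
    then show ?thesis using N True by (simp add: bump_def)
  qed
  then show ?thesis
    by (intro tendsto_eventually) (auto simp: eventually_at_top_linorder)
next
  case False
  then have "bump U k x = indicator U x" for k by (auto simp: bump_def indicator_def)
  then show ?thesis by simp
qed

lemma integral_bump_tendsto:
  assumes "borel_prob \<mu>" "open U"
  shows "(\<lambda>k. \<integral>x. bump U k x \<partial>\<mu>) \<longlonglongrightarrow> measure \<mu> U"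
proof -
  interpret prob_space \<mu> using assms by (simp add: borel_prob_def)
  have sets: "sets \<mu> = sets borel" using assms by (simp add: borel_prob_def)
  have "(\<lambda>k. \<integral>x. bump U k x \<partial>\<mu>) \<longlonglongrightarrow> (\<integral>x. indicator U x \<partial>\<mu>)"
  proof (rule integral_dominated_convergence[where w="\<lambda>_. 1"])
    show "indicator U \<in> borel_measurable \<mu>" using assms sets by (simp add: borel_measurable_indicator)
    show "bump U k \<in> borel_measurable \<mu>" for k
      using bdd_borel_measurable[OF bump_bdd_borel] sets by (simp cong: measurable_cong_sets)
    show "AE x in \<mu>. norm (bump U k x) \<le> 1" for k using bump_nonneg[of U k] bump_le_1[of U k] by auto
  qed (auto simp: bump_tendsto assms)
  then show ?thesis using sets assms by simp
qed

text \<open>Bumps recover the measure of every open set, and the open sets are a generator closed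
  under intersection.\<close>

lemma borel_prob_eqI:
  fixes \<mu> \<nu> :: "'a::metric_space measure"
  assumes "borel_prob \<mu>" "borel_prob \<nu>"
    and eq: "\<And>f. blipschitz f \<Longrightarrow> (\<integral>x. f x \<partial>\<mu>) = (\<integral>x. f x \<partial>\<nu>)"
  shows "\<mu> = \<nu>"
proof -
  interpret \<mu>: prob_space \<mu> using assms by (simp add: borel_prob_def)
  interpret \<nu>: prob_space \<nu> using assms by (simp add: borel_prob_def)
  show ?thesis
  proof (rule measure_eqI_generator_eq[where E="{U. open U}" and \<Omega>=UNIV and A="\<lambda>_. UNIV"])
    fix U :: "'a set" assume "U \<in> {U. open U}"
    then have "measure \<mu> U = measure \<nu> U"
      using integral_bump_tendsto[OF assms(1), of U] integral_bump_tendsto[OF assms(2), of U]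
        eq[OF bump_blipschitz] LIMSEQ_unique by simp
    then show "emeasure \<mu> U = emeasure \<nu> U"
      by (simp add: \<mu>.emeasure_eq_measure \<nu>.emeasure_eq_measure)
  qed (use assms in \<open>auto simp: borel_prob_def Int_stable_def borel_def\<close>)
qed

text \<open>The count is the ceiling of \<open>y\<close> minus one. It is the rounding error in the
  discretised layer-cake formula below.\<close>

lemma card_nat_less_bounds:
  fixes y :: real
  assumes "0 \<le> y" "y \<le> real n"
  shows "y - 1 \<le> card {i \<in> {1..n}. real i < y}" "card {i \<in> {1..n}. real i < y} \<le> y"
proof -
  have "{i \<in> {1..n}. real i < y} = {1..<nat \<lceil>y\<rceil>}"
    using assms by (auto simp: less_ceiling_iff zless_nat_eq_int_zless) (linarith+)?
  then have "card {i \<in> {1..n}. real i < y} = nat \<lceil>y\<rceil> - 1" by simp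
  moreover have "y - 1 \<le> real (nat \<lceil>y\<rceil> - 1)" "real (nat \<lceil>y\<rceil> - 1) \<le> y"
    using assms by linarith+
  ultimately show "y - 1 \<le> card {i \<in> {1..n}. real i < y}" "card {i \<in> {1..n}. real i < y} \<le> y" by simp_all
qed

text \<open>A layer-cake argument with finitely many layers, since \<open>\<Lambda>\<close> lacks
  monotone convergence: counting the open sets \<open>V i\<close> that contain \<open>x\<close>
  gives \<open>n * f x\<close> up to an error of \<open>1\<close>, and on each layer the hypothesis
  on open sets applies.\<close>

lemma (in fa_mean) integral_le_mean:
  assumes \<mu>: "borel_prob \<mu>" and le: "\<And>U. open U \<Longrightarrow> measure \<mu> U \<le> M U"
    and f: "continuous_on UNIV f" "\<And>x. 0 \<le> f x" "\<And>x. f x \<le> 1"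
  shows "(\<integral>x. f x \<partial>\<mu>) \<le> \<Lambda> f"
proof (rule field_le_epsilon)
  fix e :: real assume "e > 0"
  then obtain n where n: "n > 0" "1 / real n < e" using real_arch_inverse[of e] by (auto simp: inverse_eq_divide)
  define V where "V i = {x. real i < real n * f x}" for i
  define h where "h x = (\<Sum>i\<in>{1..n}. indicator (V i) x :: real)" for x :: 'a
  have V: "open (V i)" for i
    unfolding V_def by (intro open_Collect_less continuous_intros f)
  have Vb: "V i \<in> sets borel" for i using V by simp
  have f_b: "f \<in> bdd_borel" by (rule bdd_borelI[of _ 1]) (use f in \<open>auto intro: borel_measurable_continuous_onI\<close>)
  have hcard: "h x = card {i \<in> {1..n}. real i < real n * f x}" for x
    unfolding h_def V_def by (simp add: indicator_def sum.If_cases Int_def)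
  have h: "real n * f x - 1 \<le> h x" "h x \<le> real n * f x" for x
    using card_nat_less_bounds[of "real n * f x" n] f(2,3)[of x] n(1)
    unfolding hcard by (auto simp: mult_left_le)
  have h_b: "h \<in> bdd_borel" unfolding h_def[abs_def] using Vb by (intro bdd_borel_sum) auto
  interpret prob_space \<mu> using \<mu> by (simp add: borel_prob_def)
  have "real n * (\<integral>x. f x \<partial>\<mu>) - 1 = (\<integral>x. real n * f x - 1 \<partial>\<mu>)"
    using borel_prob_integrable[OF \<mu> f_b] prob_space by simp
  also have "\<dots> \<le> (\<integral>x. h x \<partial>\<mu>)"
    by (intro integral_mono borel_prob_integrable[OF \<mu>] h bdd_borel_diff bdd_borel_cmult f_b h_b) auto
  also have "\<dots> = (\<Sum>i\<in>{1..n}. measure \<mu> (V i))"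
  proof -
    have "(\<integral>x. h x \<partial>\<mu>) = (\<Sum>i\<in>{1..n}. \<integral>x. indicator (V i) x \<partial>\<mu>)"
      unfolding h_def using Vb by (intro Bochner_Integration.integral_sum borel_prob_integrable[OF \<mu>]) auto
    then show ?thesis using \<mu> Vb by (simp add: borel_prob_def)
  qed
  also have "\<dots> \<le> (\<Sum>i\<in>{1..n}. M (V i))" by (intro sum_mono le V)
  also have "\<dots> = \<Lambda> h" unfolding h_def[abs_def] using Vb by (intro sum[symmetric]) auto
  also have "\<dots> \<le> \<Lambda> (\<lambda>x. real n * f x)" by (intro mono h_b bdd_borel_cmult f_b h)
  also have "\<dots> = real n * \<Lambda> f" by (rule scale[OF f_b])
  finally have "(\<integral>x. f x \<partial>\<mu>) \<le> \<Lambda> f + 1 / real n" using n(1) by (simp add: field_simps)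
  then show "(\<integral>x. f x \<partial>\<mu>) \<le> \<Lambda> f + e" using n(2) by simp
qed

lemma (in fa_mean) mean_eq_integral:
  assumes \<mu>: "borel_prob \<mu>" and le: "\<And>U. open U \<Longrightarrow> measure \<mu> U \<le> M U"
    and f: "bcontinuous f"
  shows "\<Lambda> f = (\<integral>x. f x \<partial>\<mu>)"
proof -
  interpret prob_space \<mu> using \<mu> by (simp add: borel_prob_def)
  have f_b: "f \<in> bdd_borel" using f by (rule bcontinuous_bdd_borel)
  obtain B0 where "B0 \<ge> 0" "\<And>x. \<bar>f x\<bar> \<le> B0" using f_b by (meson bdd_borelE)
  then obtain B where B: "B > 0" "\<And>x. \<bar>f x\<bar> \<le> B" by (metis add_increasing2 less_add_one less_eq_real_def order_le_less_trans zero_le_one)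
  have cont: "continuous_on UNIV f" using f by (simp add: bcontinuous_def)
  have b: "- B \<le> f x" "f x \<le> B" for x using B(2)[of x] by auto
  \<comment> \<open>The functions \<open>1/2 + f/(2B)\<close> and \<open>1/2 - f/(2B)\<close> both
    take values in \<open>[0,1]\<close>; the one-sided comparison for each yields the two
    inequalities for \<open>f\<close>.\<close>
  have 1: "(\<integral>x. 1/2 + (1 / (2 * B)) * f x \<partial>\<mu>) \<le> \<Lambda> (\<lambda>x. 1/2 + (1 / (2 * B)) * f x)"
  proof (rule integral_le_mean[OF \<mu> le])
    fix x show "0 \<le> 1/2 + (1 / (2 * B)) * f x" "1/2 + (1 / (2 * B)) * f x \<le> 1"
      using b[of x] B(1) by (auto simp: field_simps)
  qed (use B(1) in \<open>auto intro!: continuous_on_add continuous_on_diff continuous_on_divide continuous_on_const cont\<close>)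
  have 2: "(\<integral>x. 1/2 - (1 / (2 * B)) * f x \<partial>\<mu>) \<le> \<Lambda> (\<lambda>x. 1/2 - (1 / (2 * B)) * f x)"
  proof (rule integral_le_mean[OF \<mu> le])
    fix x show "0 \<le> 1/2 - (1 / (2 * B)) * f x" "1/2 - (1 / (2 * B)) * f x \<le> 1"
      using b[of x] B(1) by (auto simp: field_simps)
  qed (use B(1) in \<open>auto intro!: continuous_on_add continuous_on_diff continuous_on_divide continuous_on_const cont\<close>)
  have "(\<integral>x. 1/2 + (1 / (2 * B)) * f x \<partial>\<mu>) = 1/2 + (1 / (2 * B)) * (\<integral>x. f x \<partial>\<mu>)"
    "(\<integral>x. 1/2 - (1 / (2 * B)) * f x \<partial>\<mu>) = 1/2 - (1 / (2 * B)) * (\<integral>x. f x \<partial>\<mu>)"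
    using borel_prob_integrable[OF \<mu> f_b] prob_space by simp_all
  moreover have "\<Lambda> (\<lambda>x. 1/2 + (1 / (2 * B)) * f x) = 1/2 + (1 / (2 * B)) * \<Lambda> f"
    "\<Lambda> (\<lambda>x. 1/2 - (1 / (2 * B)) * f x) = 1/2 - (1 / (2 * B)) * \<Lambda> f"
    using f_b by (simp_all only: add diff scale const bdd_borel_const bdd_borel_cmult)
  ultimately have "(1 / (2 * B)) * (\<integral>x. f x \<partial>\<mu>) = (1 / (2 * B)) * \<Lambda> f" using 1 2 by linarith
  then show ?thesis using B(1) by simp
qed

section \<open>From tight means to measures\<close>

text \<open>Tightness in the form of total boundedness: up to mass \<eta>, finitely many balls of
  radius \<open>r\<close> suffice. Completeness of the space does the work of compact sets.\<close>

locale tight_mean = fa_mean \<Lambda> for \<Lambda> :: "('a::polish_space \<Rightarrow> real) \<Rightarrow> real" +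
  assumes tight: "r > 0 \<Longrightarrow> \<eta> > 0 \<Longrightarrow> \<exists>D. finite D \<and> M {x. \<forall>d\<in>D. r \<le> dist x d} \<le> \<eta>"
begin

text \<open>If the limit mass were positive, tightness would find a small ball that retains positive
  limit mass; iterating with shrinking radii gives nested nonempty closed sets, and by completeness
  a point common to all \<open>F n\<close>.\<close>

lemma closed_decseq_M_tendsto_0:
  assumes F: "\<And>n. closed (F n)" "decseq F" "(\<Inter>n. F n) = {}"
  shows "(\<lambda>n. M (F n)) \<longlonglongrightarrow> 0"
proof -
  define N where "N A = (INF n. M (F n \<inter> A))" for A
  have Fb: "F n \<in> sets borel" for n using F(1) by simp
  have lim: "(\<lambda>n. M (F n \<inter> A)) \<longlonglongrightarrow> N A" if "A \<in> sets borel" for A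
    unfolding N_def
  proof (rule LIMSEQ_decseq_INF)
    show "decseq (\<lambda>n. M (F n \<inter> A))"
      using F(2) Fb that by (intro decseq_SucI M_mono) (auto simp: decseq_Suc_iff)
    show "bdd_below (range (\<lambda>n. M (F n \<inter> A)))"
      using Fb that by (intro bdd_belowI2[of _ 0] M_nonneg) auto
  qed
  have N_le: "N A \<le> M (F n \<inter> A)" if "A \<in> sets borel" for A n
    unfolding N_def by (intro cINF_lower bdd_belowI2[of _ 0] M_nonneg) (use Fb that in auto)
  have N_nonneg: "0 \<le> N A" if "A \<in> sets borel" for A
    unfolding N_def by (intro cINF_greatest M_nonneg) (use Fb that in auto)
  \<comment> \<open>Finitely many balls miss at most half of \<open>N A\<close>, so the limit mass
    cannot vanish on all of them.\<close>
  have step: "\<exists>d. N (A \<inter> cball d r) > 0" if A: "A \<in> sets borel" "N A > 0" and r: "r > 0" for A r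
  proof (rule ccontr)
    assume "\<nexists>d. N (A \<inter> cball d r) > 0"
    then have 0: "N (A \<inter> cball d r) = 0" for d
      using N_nonneg[of "A \<inter> cball d r"] A by (metis less_eq_real_def sets.Int closed_cball borel_closed)
    obtain D where D: "finite D" "M {x. \<forall>d\<in>D. r \<le> dist x d} \<le> N A / 2"
      using tight[OF r, of "N A / 2"] A(2) by auto
    let ?R = "{x. \<forall>d\<in>D. r \<le> dist x d}"
    have "closed ?R"
      unfolding Collect_ball_eq by (intro closed_INT ballI closed_Collect_le continuous_intros)
    then have R: "?R \<in> sets borel" by simp
    have "M (F n \<inter> A) \<le> (\<Sum>d\<in>D. M (F n \<inter> (A \<inter> cball d r))) + N A / 2" for n
    proof -
      have "M (F n \<inter> A) \<le> M ((\<Union>d\<in>D. F n \<inter> (A \<inter> cball d r)) \<union> ?R)"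
      proof (rule M_mono)
        show "F n \<inter> A \<subseteq> (\<Union>d\<in>D. F n \<inter> (A \<inter> cball d r)) \<union> ?R"
          by (auto simp: dist_commute not_le)
        show "(\<Union>d\<in>D. F n \<inter> (A \<inter> cball d r)) \<union> ?R \<in> sets borel"
          using Fb A(1) R D(1) by (intro sets.Un sets.finite_UN) auto
      qed (use Fb A in auto)
      also have "\<dots> \<le> M (\<Union>d\<in>D. F n \<inter> (A \<inter> cball d r)) + M ?R"
        using Fb A(1) R D(1) by (intro M_Un_le sets.finite_UN) auto
      also have "\<dots> \<le> (\<Sum>d\<in>D. M (F n \<inter> (A \<inter> cball d r))) + N A / 2"
        using Fb A D by (intro add_mono M_Union_le) auto
      finally show ?thesis .
    qed
    moreover have "(\<lambda>n. (\<Sum>d\<in>D. M (F n \<inter> (A \<inter> cball d r))) + N A / 2) \<longlonglongrightarrow> (\<Sum>d\<in>D. N (A \<inter> cball d r)) + N A / 2"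
      using A(1) by (intro tendsto_intros lim) auto
    ultimately have "N A \<le> (\<Sum>d\<in>D. N (A \<inter> cball d r)) + N A / 2"
      using LIMSEQ_le[OF lim[OF A(1)]] by blast
    with 0 A(2) show False by simp
  qed
  have "N UNIV = 0"
  proof (rule ccontr)
    assume "N UNIV \<noteq> 0"
    then have pos: "N UNIV > 0" using N_nonneg[of UNIV] by simp
    have "\<exists>A. \<forall>n. (closed (A n) \<and> N (A n) > 0) \<and> (\<exists>d. A (Suc n) = A n \<inter> cball d (1 / real (Suc n)))"
    proof (rule dependent_nat_choice)
      show "\<exists>A. closed A \<and> N A > 0" using pos by (intro exI[of _ UNIV]) simp
      show "\<exists>B. (closed B \<and> N B > 0) \<and> (\<exists>d. B = A \<inter> cball d (1 / real (Suc n)))"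
        if "closed A \<and> N A > 0" for A n
        using step[of A "1 / real (Suc n)"] that by (auto intro!: closed_Int)
    qed
    then obtain A where A: "\<And>n. closed (A n)" "\<And>n. N (A n) > 0"
      "\<And>n. \<exists>d. A (Suc n) = A n \<inter> cball d (1 / real (Suc n))" by blast
    have decA: "decseq A" using A(3) by (intro decseq_SucI) blast
    obtain a where "\<And>n. a \<in> F n \<inter> A n"
    proof (rule decreasing_closed_nest[of "\<lambda>n. F n \<inter> A n"])
      show "closed (F n \<inter> A n)" for n using F(1) A(1) by auto
      show "F n \<inter> A n \<noteq> {}" for n
        using N_le[of "A n" n] A(1,2)[of n] M_empty by auto
      show "m \<le> n \<Longrightarrow> F n \<inter> A n \<subseteq> F m \<inter> A m" for m n
        by (intro Int_mono decseqD[OF decA] decseqD[OF F(2)])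
      fix e :: real assume "e > 0"
      then obtain n where n: "1 / real (Suc n) < e / 2" using nat_approx_posE[of "e/2"] by auto
      obtain d where "A (Suc n) = A n \<inter> cball d (1 / real (Suc n))" using A(3) by blast
      then have "dist d x < e / 2" if "x \<in> A (Suc n)" for x using that n by auto
      then have "dist x y < e" if "x \<in> A (Suc n)" "y \<in> A (Suc n)" for x y
        using that dist_triangle_half_r by blast
      then show "\<exists>n. \<forall>x\<in>F n \<inter> A n. \<forall>y\<in>F n \<inter> A n. dist x y < e" by blast
    qed blast
    with F(3) show False by blast
  qed
  then show ?thesis using lim[of UNIV] by simp
qed

text \<open>Even a tight mean need not be countably additive on all Borel sets: a limit of Dirac
  masses at \<open>1/n\<close> gives mass \<open>1\<close> to the interval \<open>(0,1)\<close> and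
  \<open>0\<close> to each of its closed subsets. Regular sets exclude this escape to the
  boundary.\<close>

definition regular_sets :: "'a set set" where
  "regular_sets = {A \<in> sets borel. \<forall>e>0. \<exists>C U. closed C \<and> open U \<and> C \<subseteq> A \<and> A \<subseteq> U \<and> M (U - C) \<le> e}"

lemma regular_sets_borel: "A \<in> regular_sets \<Longrightarrow> A \<in> sets borel"
  by (simp add: regular_sets_def)

lemma algebra_regular_sets: "algebra UNIV regular_sets"
  unfolding algebra_iff_Un
proof (intro conjI ballI)
  show "{} \<in> regular_sets"
    by (auto simp: regular_sets_def M_empty less_imp_le intro!: exI[of _ "{}"])
  fix A assume A: "A \<in> regular_sets"
  show "UNIV - A \<in> regular_sets"
    unfolding regular_sets_def
  proof safe
    show "UNIV - A \<in> sets borel" using A by (simp add: regular_sets_def sets.Diff)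
    fix e :: real assume "e > 0"
    then obtain C U where CU: "closed C" "open U" "C \<subseteq> A" "A \<subseteq> U" "M (U - C) \<le> e"
      using A by (auto simp: regular_sets_def)
    moreover have "- C - - U = U - C" by auto
    ultimately show "\<exists>C U. closed C \<and> open U \<and> C \<subseteq> UNIV - A \<and> UNIV - A \<subseteq> U \<and> M (U - C) \<le> e"
      by (intro exI[of _ "- U"] exI[of _ "- C"]) (auto simp: open_Compl closed_Compl)
  qed
  fix B assume B: "B \<in> regular_sets"
  show "A \<union> B \<in> regular_sets"
    unfolding regular_sets_def
  proof safe
    show "A \<union> B \<in> sets borel" using A B by (simp add: regular_sets_def sets.Un)
    fix e :: real assume "e > 0"
    then obtain C U where CU: "closed C" "open U" "C \<subseteq> A" "A \<subseteq> U" "M (U - C) \<le> e / 2"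
      using A by (auto simp: regular_sets_def dest!: spec[of _ "e/2"])
    obtain C' U' where CU': "closed C'" "open U'" "C' \<subseteq> B" "B \<subseteq> U'" "M (U' - C') \<le> e / 2"
      using B \<open>e > 0\<close> by (auto simp: regular_sets_def dest!: spec[of _ "e/2"])
    have "M ((U \<union> U') - (C \<union> C')) \<le> M ((U - C) \<union> (U' - C'))"
      using CU CU' by (intro M_mono) auto
    also have "\<dots> \<le> M (U - C) + M (U' - C')" using CU CU' by (intro M_Un_le) auto
    finally have "M ((U \<union> U') - (C \<union> C')) \<le> e" using CU CU' by simp
    with CU CU' show "\<exists>C U. closed C \<and> open U \<and> C \<subseteq> A \<union> B \<and> A \<union> B \<subseteq> U \<and> M (U - C) \<le> e"
      by (intro exI[of _ "C \<union> C'"] exI[of _ "U \<union> U'"]) auto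
  qed
qed auto

text \<open>Replace each \<open>A i\<close> by a closed subset \<open>C i\<close> at geometrically
  small cost. The finite intersections of the \<open>C i\<close> are closed and decrease to the
  empty set, and the accumulated loss stays below \<open>e/2\<close>.\<close>

lemma regular_decseq_M_tendsto_0:
  assumes A: "range A \<subseteq> regular_sets" "decseq A" "(\<Inter>i. A i) = {}"
  shows "(\<lambda>i. M (A i)) \<longlonglongrightarrow> 0"
proof (rule LIMSEQ_I)
  fix e :: real assume e: "e > 0"
  have Ab: "A i \<in> sets borel" for i using A(1) regular_sets_borel by auto
  have "\<exists>C. closed C \<and> C \<subseteq> A i \<and> M (A i - C) \<le> e / 2 * (1/2) ^ Suc i" for i
  proof -
    have "e / 2 * (1/2) ^ Suc i > 0" using e by simp
    moreover have "A i \<in> regular_sets" using A(1) by auto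
    ultimately obtain C U where "closed C" "open U" "C \<subseteq> A i" "A i \<subseteq> U" "M (U - C) \<le> e / 2 * (1/2) ^ Suc i"
      unfolding regular_sets_def by blast
    moreover from this have "M (A i - C) \<le> M (U - C)" using Ab by (intro M_mono) auto
    ultimately show ?thesis by (intro exI[of _ C]) auto
  qed
  then obtain C where C: "\<And>i. closed (C i)" "\<And>i. C i \<subseteq> A i" "\<And>i. M (A i - C i) \<le> e / 2 * (1/2) ^ Suc i"
    by metis
  define L where "L n = (\<Inter>i\<in>{..n}. C i)" for n
  have L: "closed (L n)" for n unfolding L_def using C(1) by auto
  have "(\<lambda>n. M (L n)) \<longlonglongrightarrow> 0"
  proof (rule closed_decseq_M_tendsto_0[OF L])
    show "decseq L" by (intro decseq_SucI) (auto simp: L_def)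
    have "L n \<subseteq> A n" for n using C(2)[of n] by (auto simp: L_def)
    then have "(\<Inter>n. L n) \<subseteq> (\<Inter>n. A n)" by (intro INF_mono) auto
    then show "(\<Inter>n. L n) = {}" using A(3) by simp
  qed
  then obtain N where N: "\<And>n. n \<ge> N \<Longrightarrow> M (L n) < e / 2"
    using e LIMSEQ_D[of "\<lambda>n. M (L n)" 0 "e/2"] unfolding real_norm_def
    by (metis abs_less_iff diff_zero half_gt_zero)
  have "M (A n) < e" if "n \<ge> N" for n
  proof -
    have "M (A n) \<le> M (L n \<union> (\<Union>i\<in>{..n}. A i - C i))"
    proof (rule M_mono)
      show "A n \<subseteq> L n \<union> (\<Union>i\<in>{..n}. A i - C i)"
        using decseqD[OF A(2)] by (auto simp: L_def)
    qed (use L C(1) Ab in auto)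
    also have "\<dots> \<le> M (L n) + M (\<Union>i\<in>{..n}. A i - C i)"
      using L C(1) Ab by (intro M_Un_le) auto
    also have "M (\<Union>i\<in>{..n}. A i - C i) \<le> (\<Sum>i\<in>{..n}. M (A i - C i))"
      using C(1) Ab by (intro M_Union_le) auto
    also have "\<dots> \<le> (\<Sum>i\<in>{..n}. e / 2 * (1/2) ^ Suc i)"
      by (intro sum_mono C(3))
    also have "\<dots> = e / 2 * (\<Sum>i\<in>{..n}. (1/2) ^ Suc i)" by (simp add: sum_distrib_left)
    also have "(\<Sum>i\<in>{..n}. (1/2) ^ Suc i) = 1 - (1/2::real) ^ Suc n"
      by (induction n) auto
    also have "e / 2 * (1 - (1/2) ^ Suc n) \<le> e / 2" using e by (simp add: mult_left_le)
    finally show ?thesis using N[OF that] by simp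
  qed
  then show "\<exists>N. \<forall>n\<ge>N. norm (M (A n) - 0) < e"
    using M_nonneg[OF Ab] by (intro exI[of _ N]) auto
qed

text \<open>Exhaust \<open>U\<close> by the sets where the distance to the complement exceeds a
  level. Such a set is regular when the mass, as a monotone function of the level, is continuous
  there, and only countably many levels fail.\<close>

lemma open_eq_UN_regular:
  assumes U: "open U"
  obtains V where "range V \<subseteq> regular_sets" "incseq V" "(\<Union>i. V i) = U"
proof (cases "U = UNIV")
  case True
  then show thesis
    using that[of "\<lambda>_. UNIV"] algebra.top[OF algebra_regular_sets] by (auto simp: incseq_def)
next
  case False
  let ?f = "\<lambda>x. infdist x (- U)"
  define \<phi> where "\<phi> r = M {x. r < ?f x}" for r
  have open_f: "open {x. r < ?f x}" for r by (intro open_Collect_less continuous_intros)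
  have closed_f: "closed {x. r \<le> ?f x}" for r by (intro closed_Collect_le continuous_intros)
  have "mono (\<lambda>r. - \<phi> r)"
    unfolding \<phi>_def using open_f by (intro monoI) (auto intro!: M_mono)
  then have count: "countable {r. \<not> isCont (\<lambda>r. - \<phi> r) r}" by (rule mono_ctble_discont)
  have "\<exists>r. r \<in> {1 / (real n + 2)<..<1 / (real n + 1)} \<and> isCont \<phi> r" for n :: nat
  proof -
    have "uncountable ({1 / (real n + 2)<..<1 / (real n + 1)} - {r. \<not> isCont (\<lambda>r. - \<phi> r) r})"
      by (intro uncountable_minus_countable count) (auto simp: uncountable_open_interval field_simps)
    then obtain r where "r \<in> {1 / (real n + 2)<..<1 / (real n + 1)} - {r. \<not> isCont (\<lambda>r. - \<phi> r) r}"
      by (metis countable_empty ex_in_conv)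
    then show ?thesis using isCont_minus[of r "\<lambda>r. - \<phi> r"] by auto
  qed
  then obtain r where r: "\<And>n. 1 / (real n + 2) < r n" "\<And>n. r n < 1 / (real n + 1)" "\<And>n. isCont \<phi> (r n)"
    by (metis greaterThanLessThan_iff)
  define V where "V n = {x. r n < ?f x}" for n
  have "V n \<in> regular_sets" for n
    unfolding regular_sets_def
  proof safe
    show "V n \<in> sets borel" using open_f by (simp add: V_def)
    fix e :: real assume "e > 0"
    then obtain s where s: "s > 0" "\<And>t. \<bar>t - r n\<bar> < s \<Longrightarrow> \<bar>\<phi> t - \<phi> (r n)\<bar> < e"
      using r(3)[of n] unfolding continuous_at_eps_delta by (auto simp: dist_real_def)
    \<comment> \<open>A slightly higher level \<open>t\<close> gives the closed inner set;
      \<open>V n\<close> is its own open outer set, and the gap is bounded by the small change of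
      \<open>\<phi>\<close> between the two levels.\<close>
    define t where "t = r n + s / 2"
    have t: "r n < t" "\<bar>t - r n\<bar> < s" using s by (auto simp: t_def)
    have "M (V n - {x. t \<le> ?f x}) \<le> M (V n - {x. t < ?f x})"
      unfolding V_def using open_f closed_f by (intro M_mono) auto
    also have "\<dots> = \<phi> (r n) - \<phi> t"
      unfolding V_def \<phi>_def using open_f t by (intro M_Diff) auto
    also have "\<dots> \<le> e" using s(2)[OF t(2)] by auto
    finally show "\<exists>C U. closed C \<and> open U \<and> C \<subseteq> V n \<and> V n \<subseteq> U \<and> M (U - C) \<le> e"
      using open_f closed_f t by (intro exI[of _ "{x. t \<le> ?f x}"] exI[of _ "V n"]) (auto simp: V_def)
  qed
  moreover have "incseq V"
  proof (rule incseq_SucI)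
    fix n
    have "r (Suc n) \<le> r n" using r(2)[of "Suc n"] r(1)[of n] by (simp add: algebra_simps)
    then show "V n \<subseteq> V (Suc n)" by (auto simp: V_def)
  qed
  moreover have "(\<Union>n. V n) = U"
  proof safe
    fix x n assume "x \<in> V n"
    then have "?f x > 0" using r(1)[of n] by (auto simp: V_def intro: less_trans[of 0 "1 / (real n + 2)"] order.strict_trans)
    then show "x \<in> U" by (metis ComplI infdist_zero less_irrefl)
  next
    fix x assume "x \<in> U"
    then have "?f x > 0" using U False by (intro infdist_pos_not_in_closed) auto
    then obtain n where "1 / real (Suc n) < ?f x" using nat_approx_posE by blast
    then have "x \<in> V n" using r(2)[of n] by (auto simp: V_def add.commute)
    then show "x \<in> (\<Union>n. V n)" by blast
  qed
  ultimately show thesis using that[of V] by blast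
qed

lemma sigma_sets_regular_sets: "sigma_sets UNIV regular_sets = sets borel"
proof
  show "sigma_sets UNIV regular_sets \<subseteq> sets borel"
    using sets.sigma_sets_subset[of regular_sets borel] regular_sets_borel by auto
  have "U \<in> sigma_sets UNIV regular_sets" if "open U" for U
  proof -
    obtain V where "range V \<subseteq> regular_sets" "incseq V" "(\<Union>i. V i) = U"
      by (rule open_eq_UN_regular[OF \<open>open U\<close>])
    then show ?thesis using sigma_sets.Union[of V UNIV regular_sets] by (auto intro: sigma_sets.Basic)
  qed
  then show "sets borel \<subseteq> sigma_sets UNIV regular_sets"
    unfolding borel_def by (auto intro!: sigma_sets_mono simp: sets_measure_of)
qed

text \<open>Caratheodory extension from the regular sets. The measure agrees with \<open>M\<close>
  on that algebra and satisfies only \<open>measure \<mu> U \<le> M U\<close> on open sets, because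
  \<open>U\<close> is exhausted by regular sets; \<open>mean_eq_integral\<close> asks for exactly
  this inequality.\<close>

theorem obtain_measure:
  obtains \<mu> where "borel_prob \<mu>" "\<And>f. bcontinuous f \<Longrightarrow> \<Lambda> f = (\<integral>x. f x \<partial>\<mu>)"
proof -
  interpret R: algebra UNIV regular_sets by (rule algebra_regular_sets)
  have "\<exists>\<mu>. (\<forall>s\<in>regular_sets. \<mu> s = ennreal (M s)) \<and> measure_space UNIV (sigma_sets UNIV regular_sets) \<mu>"
  proof (rule R.caratheodory_empty_continuous)
    show "positive regular_sets (\<lambda>s. ennreal (M s))" by (simp add: positive_def M_empty)
    show "additive regular_sets (\<lambda>s. ennreal (M s))"
      by (auto simp: additive_def M_disjoint_Un regular_sets_borel M_nonneg ennreal_plus)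
    show "(\<lambda>i. ennreal (M (A i))) \<longlonglongrightarrow> 0"
      if "range A \<subseteq> regular_sets" "decseq A" "(\<Inter>i. A i) = {}" for A
      using tendsto_ennrealI[OF regular_decseq_M_tendsto_0[OF that]] by simp
  qed auto
  then obtain \<mu>0 where \<mu>0: "\<And>s. s \<in> regular_sets \<Longrightarrow> \<mu>0 s = ennreal (M s)"
      "measure_space UNIV (sets borel) \<mu>0"
    unfolding sigma_sets_regular_sets by blast
  define \<mu> where "\<mu> = measure_of UNIV (sets borel) \<mu>0"
  have "sigma_sets UNIV (sets borel) = sets (borel :: 'a measure)"
    using sets.sigma_sets_eq[of borel] by simp
  then have sets_\<mu>: "sets \<mu> = sets borel" unfolding \<mu>_def by (simp add: sets_measure_of)
  have em: "emeasure \<mu> A = \<mu>0 A" if "A \<in> sets borel" for A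
    using \<mu>0(2) that \<mu>_def unfolding measure_space_def
    by (intro emeasure_measure_of_sigma[of UNIV "sets borel" \<mu>0 A, folded \<mu>_def]) auto
  have em_R: "emeasure \<mu> A = ennreal (M A)" if "A \<in> regular_sets" for A
    using that em \<mu>0(1) regular_sets_borel by simp
  have "emeasure \<mu> UNIV = 1" using em_R[OF R.top] M_UNIV by simp
  then have bp: "borel_prob \<mu>"
    using sets_\<mu> sets_eq_imp_space_eq[OF sets_\<mu>] by (auto simp: borel_prob_def intro!: prob_spaceI)
  interpret prob_space \<mu> using bp by (simp add: borel_prob_def)
  have "measure \<mu> U \<le> M U" if "open U" for U
  proof -
    obtain V where V: "range V \<subseteq> regular_sets" "incseq V" "(\<Union>i. V i) = U"
      by (rule open_eq_UN_regular[OF \<open>open U\<close>])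
    have Vb: "V i \<in> sets borel" for i using V(1) regular_sets_borel by auto
    have "(\<lambda>i. measure \<mu> (V i)) \<longlonglongrightarrow> measure \<mu> U"
      using finite_Lim_measure_incseq[of V] V Vb sets_\<mu> by auto
    moreover have "measure \<mu> (V i) \<le> M U" for i
    proof -
      have "V i \<in> regular_sets" using V(1) by auto
      then have "measure \<mu> (V i) = M (V i)"
        using em_R M_nonneg[OF Vb] by (simp add: measure_def)
      also have "\<dots> \<le> M U" using V(3) Vb that by (intro M_mono) auto
      finally show ?thesis .
    qed
    ultimately show ?thesis by (intro LIMSEQ_le_const2) auto
  qed
  then show thesis using that[OF bp] mean_eq_integral[OF bp] by blast
qed

end

section \<open>The semigroup and its time averages\<close>

locale mfeller =
  fixes K :: "real \<Rightarrow> 'a::polish_space \<Rightarrow> 'a measure"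
  assumes mf: "markov_feller K"
begin

lemma K_borel_prob: "t \<ge> 0 \<Longrightarrow> borel_prob (K t x)"
  using mf by (simp add: markov_feller_def borel_prob_def)

lemma K_kernel: "t \<ge> 0 \<Longrightarrow> K t \<in> borel \<rightarrow>\<^sub>M prob_algebra borel"
  using mf by (intro measurable_prob_algebraI) (auto simp: markov_feller_def)

text \<open>Measurability is assumed on nonnegative times only; \<open>max 0\<close> extends the
  kernel to all real times so that product measurability and Fubini apply without restricted
  spaces.\<close>

lemma K_joint: "(\<lambda>p. K (max 0 (fst p)) (snd p)) \<in> borel \<Otimes>\<^sub>M borel \<rightarrow>\<^sub>M prob_algebra borel"
proof (intro measurable_prob_algebraI measurable_subprob_algebra)
  fix A :: "'a set" assume A: "A \<in> sets borel"
  have 1: "(\<lambda>(s,x). measure (K s x) A) \<in> borel_measurable (restrict_space borel ({0..} \<times> UNIV))"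
    using mf A by (simp add: markov_feller_def)
  have 2: "(\<lambda>p::real \<times> 'a. (max 0 (fst p), snd p)) \<in> borel \<Otimes>\<^sub>M borel \<rightarrow>\<^sub>M restrict_space borel ({0..} \<times> UNIV)"
    by (intro measurable_restrict_space2) (auto simp: borel_prod[symmetric])
  have "(\<lambda>p. measure (K (max 0 (fst p)) (snd p)) A) \<in> borel_measurable (borel \<Otimes>\<^sub>M borel)"
    using measurable_compose[OF 2 1] by simp
  moreover have "emeasure (K (max 0 s) x) A = ennreal (measure (K (max 0 s) x) A)" for s x
    using K_borel_prob[of "max 0 s" x] by (simp add: borel_prob_def finite_measure.emeasure_eq_measure prob_space_def)
  ultimately show "(\<lambda>p. emeasure (K (max 0 (fst p)) (snd p)) A) \<in> borel_measurable (borel \<Otimes>\<^sub>M borel)"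
    by simp
qed (use K_borel_prob in \<open>auto simp: borel_prob_def prob_space_imp_subprob_space\<close>)

lemma K_time: "(\<lambda>s. K (max 0 s) x) \<in> borel \<rightarrow>\<^sub>M prob_algebra borel"
  using measurable_compose[OF measurable_Pair2'[of x borel borel] K_joint] 
    measurable_compose[OF _ K_joint, of "\<lambda>s. (s, x)" borel] by simp

definition P :: "real \<Rightarrow> ('a \<Rightarrow> real) \<Rightarrow> 'a \<Rightarrow> real" where
  "P s f x = (\<integral>y. f y \<partial>K s x)"

lemma P_abs_le: "s \<ge> 0 \<Longrightarrow> f \<in> bdd_borel \<Longrightarrow> (\<And>x. \<bar>f x\<bar> \<le> B) \<Longrightarrow> \<bar>P s f x\<bar> \<le> B"
  unfolding P_def by (intro borel_prob_integral_abs_le K_borel_prob)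

lemma P_joint:
  assumes "f \<in> bdd_borel"
  shows "(\<lambda>p. P (max 0 (fst p)) f (snd p)) \<in> borel_measurable (borel \<Otimes>\<^sub>M borel)"
  unfolding P_def
  using measurable_compose[OF measurable_prob_algebraD[OF K_joint] integral_measurable_subprob_algebra[OF bdd_borel_measurable[OF assms]]]
  by simp

lemma P_measurable_time: "f \<in> bdd_borel \<Longrightarrow> (\<lambda>s. P (max 0 s) f x) \<in> borel_measurable borel"
  using measurable_compose[OF _ P_joint, of "\<lambda>s. (s, x)" borel f] by simp

lemma P_bdd_borel:
  assumes "s \<ge> 0" "f \<in> bdd_borel"
  shows "P s f \<in> bdd_borel"
proof -
  obtain B where "\<And>x. \<bar>f x\<bar> \<le> B" using assms by (meson bdd_borelE)
  moreover have "P s f \<in> borel_measurable borel"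
    using measurable_compose[OF _ P_joint, of "\<lambda>x. (s, x)" borel f] assms by simp
  ultimately show ?thesis using P_abs_le assms by (intro bdd_borelI[of _ B]) auto
qed

lemma integral_kernel_bind:
  assumes "borel_prob \<nu>" "N \<in> borel \<rightarrow>\<^sub>M prob_algebra borel" "f \<in> bdd_borel"
  shows "(\<integral>y. f y \<partial>(\<nu> \<bind> N)) = (\<integral>x. (\<integral>y. f y \<partial>N x) \<partial>\<nu>)"
proof -
  obtain B where B: "\<And>x. \<bar>f x\<bar> \<le> B" using assms by (meson bdd_borelE)
  show ?thesis
  proof (rule integral_bind[where K=borel and B=B and B'=1])
    show "N \<in> \<nu> \<rightarrow>\<^sub>M subprob_algebra borel"
      using measurable_prob_algebraD[OF assms(2)] assms(1) by (simp add: borel_prob_def cong: measurable_cong_sets)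
    show "AE x in \<nu>. emeasure (N x) (space (N x)) \<le> ennreal 1"
      using measurable_space[OF assms(2)] by (auto simp: space_prob_algebra prob_space.emeasure_space_1)
  qed (use assms B bdd_borel_measurable in \<open>auto simp: borel_prob_def prob_space_def\<close>)
qed

lemma P_P:
  assumes "s \<ge> 0" "t \<ge> 0" "f \<in> bdd_borel"
  shows "P s (P t f) x = P (s + t) f x"
proof -
  have "K (s + t) x = K s x \<bind> K t" using mf assms by (simp add: markov_feller_def)
  then show ?thesis
    using integral_kernel_bind[OF K_borel_prob[OF assms(1)] K_kernel[OF assms(2)] assms(3)]
    by (simp add: P_def[abs_def])
qed

lemma P_bcontinuous: "s \<ge> 0 \<Longrightarrow> bcontinuous f \<Longrightarrow> bcontinuous (P s f)"
  using mf P_bdd_borel[OF _ bcontinuous_bdd_borel, of s f]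
  by (auto simp: markov_feller_def bcontinuous_def P_def[abs_def] bdd_borel_def)

lemma P_mono: "s \<ge> 0 \<Longrightarrow> f \<in> bdd_borel \<Longrightarrow> g \<in> bdd_borel \<Longrightarrow> (\<And>x. f x \<le> g x) \<Longrightarrow> P s f x \<le> P s g x"
  unfolding P_def by (intro integral_mono borel_prob_integrable K_borel_prob) auto

lemma P_diff: "s \<ge> 0 \<Longrightarrow> f \<in> bdd_borel \<Longrightarrow> g \<in> bdd_borel \<Longrightarrow> P s (\<lambda>x. f x - g x) x = P s f x - P s g x"
  unfolding P_def by (intro Bochner_Integration.integral_diff borel_prob_integrable K_borel_prob) auto

lemma P_const: "s \<ge> 0 \<Longrightarrow> P s (\<lambda>_. c) x = c"
  using K_borel_prob[of s x] prob_space.prob_space[of "K s x"] borel_prob_space[OF K_borel_prob[of s x]]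
  by (simp add: P_def borel_prob_def)

section \<open>Time averages as sampling at a uniformly distributed time\<close>

abbreviation unif :: "real \<Rightarrow> real measure" where
  "unif t \<equiv> uniform_measure lborel {0..t}"

lemma prob_unif: "t > 0 \<Longrightarrow> prob_space (unif t)"
  by (intro prob_space_uniform_measure) auto

lemma borel_prob_unif: "t > 0 \<Longrightarrow> borel_prob (unif t)"
  by (simp add: borel_prob_def prob_unif)

lemma integral_unif:
  fixes g :: "real \<Rightarrow> real"
  assumes "t > 0" and [measurable]: "g \<in> borel_measurable borel"
  shows "(\<integral>s. g s \<partial>unif t) = (1 / t) * (LINT s:{0..t}|lborel. g s)"
proof -
  have "unif t = density lborel (\<lambda>s. ennreal (indicator {0..t} s / t))"
    unfolding uniform_measure_def using assms(1)
    by (intro density_cong) (auto simp: divide_ennreal indicator_def ennreal_1[symmetric] simp del: ennreal_1)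
  then have "(\<integral>s. g s \<partial>unif t) = (\<integral>s. (indicator {0..t} s / t) *\<^sub>R g s \<partial>lborel)"
    using assms(1) by (simp add: integral_density)
  then show ?thesis by (simp add: set_lebesgue_integral_def)
qed

text \<open>The measure written Q_t(x, .), as a mixture of kernels. The Dirac default for
  \<open>t \<le> 0\<close> makes \<open>Qm t\<close> a probability kernel for every
  \<open>t\<close>, so \<open>Q\<close> is monotone and bounded without side conditions.\<close>

definition Qm :: "real \<Rightarrow> 'a \<Rightarrow> 'a measure" where
  "Qm t x = (if t > 0 then unif t \<bind> (\<lambda>s. K (max 0 s) x) else return borel x)"

definition Q :: "real \<Rightarrow> ('a \<Rightarrow> real) \<Rightarrow> 'a \<Rightarrow> real" where
  "Q t f x = (\<integral>y. f y \<partial>Qm t x)"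

lemma Qm_kernel: "Qm t \<in> borel \<rightarrow>\<^sub>M prob_algebra borel"
proof (cases "t > 0")
  case True
  have "(\<lambda>x. unif t \<bind> (\<lambda>s. K (max 0 s) x)) \<in> borel \<rightarrow>\<^sub>M prob_algebra borel"
  proof (rule measurable_bind_prob_space2)
    show "(\<lambda>x. unif t) \<in> borel \<rightarrow>\<^sub>M prob_algebra borel"
      using prob_unif[OF True] by (intro measurable_const) (simp add: space_prob_algebra)
    show "(\<lambda>(x, s). K (max 0 s) x) \<in> borel \<Otimes>\<^sub>M borel \<rightarrow>\<^sub>M prob_algebra borel"
      using measurable_compose[OF measurable_pair_swap' K_joint] by (simp add: split_beta')
  qed
  with True show ?thesis by (simp add: Qm_def[abs_def])
next
  case False
  then show ?thesis by (simp add: Qm_def[abs_def])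
qed

lemma Qm_borel_prob: "borel_prob (Qm t x)"
  using measurable_space[OF Qm_kernel, of x t] by (simp add: space_prob_algebra borel_prob_def)

lemma Q_eq_unif:
  assumes "t > 0" "f \<in> bdd_borel"
  shows "Q t f x = (\<integral>s. P (max 0 s) f x \<partial>unif t)"
proof -
  obtain B where B: "\<And>x. \<bar>f x\<bar> \<le> B" using assms by (meson bdd_borelE)
  have "(\<integral>y. f y \<partial>(unif t \<bind> (\<lambda>s. K (max 0 s) x))) = (\<integral>s. (\<integral>y. f y \<partial>K (max 0 s) x) \<partial>unif t)"
  proof (rule integral_bind[where K=borel and B=B and B'=1])
    show "(\<lambda>s. K (max 0 s) x) \<in> unif t \<rightarrow>\<^sub>M subprob_algebra borel"
      using measurable_prob_algebraD[OF K_time] by (simp cong: measurable_cong_sets)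
    show "AE s in unif t. emeasure (K (max 0 s) x) (space (K (max 0 s) x)) \<le> ennreal 1"
      using measurable_space[OF K_time] by (auto simp: space_prob_algebra prob_space.emeasure_space_1)
  qed (use assms B bdd_borel_measurable prob_unif in \<open>auto simp: prob_space_def\<close>)
  with assms show ?thesis by (simp add: Q_def Qm_def P_def)
qed

lemma Q_eq_LINT:
  assumes "t > 0" "f \<in> bdd_borel"
  shows "Q t f x = (1 / t) * (LINT s:{0..t}|lborel. P (max 0 s) f x)"
  using assms by (simp add: Q_eq_unif integral_unif P_measurable_time)

lemma Q_eq_Qf:
  assumes "t > 0" "f \<in> bdd_borel"
  shows "Q t f x = Qf K t f x"
  unfolding Q_eq_LINT[OF assms] Qf_def P_def
  by (auto intro!: set_lebesgue_integral_cong arg_cong[where f="\<lambda>x. x / t"])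

lemma Qx_eq_Qm:
  assumes "t > 0" "A \<in> sets borel"
  shows "Qx K t x A = measure (Qm t x) A"
proof -
  have "measure (K s x) A = P s (indicator A) x" if "s \<ge> 0" for s
    using K_borel_prob[OF that, of x] assms(2) by (simp add: P_def borel_prob_def)
  then have "Qx K t x A = Qf K t (indicator A) x"
    unfolding Qx_def Qf_def P_def
    by (auto intro!: set_lebesgue_integral_cong arg_cong[where f="\<lambda>x. x / t"])
  also have "\<dots> = measure (Qm t x) A"
    using Q_eq_Qf[OF assms(1) bdd_borel_indicator[OF assms(2)], of x, symmetric] assms(2)
    by (simp add: Q_def borel_prob_space[OF Qm_borel_prob])
  finally show ?thesis .
qed

lemma Q_abs_le: "f \<in> bdd_borel \<Longrightarrow> (\<And>x. \<bar>f x\<bar> \<le> B) \<Longrightarrow> \<bar>Q t f x\<bar> \<le> B"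
  unfolding Q_def by (intro borel_prob_integral_abs_le Qm_borel_prob)

lemma Q_bdd_borel:
  assumes "f \<in> bdd_borel"
  shows "Q t f \<in> bdd_borel"
proof -
  obtain B where "\<And>x. \<bar>f x\<bar> \<le> B" using assms by (meson bdd_borelE)
  moreover have "Q t f \<in> borel_measurable borel"
    unfolding Q_def[abs_def]
    using measurable_compose[OF measurable_prob_algebraD[OF Qm_kernel] integral_measurable_subprob_algebra[OF bdd_borel_measurable[OF assms]]]
    by simp
  ultimately show ?thesis using Q_abs_le assms by (intro bdd_borelI[of _ B]) auto
qed

lemma Q_mono: "f \<in> bdd_borel \<Longrightarrow> g \<in> bdd_borel \<Longrightarrow> (\<And>x. f x \<le> g x) \<Longrightarrow> Q t f x \<le> Q t g x"
  unfolding Q_def by (intro integral_mono borel_prob_integrable Qm_borel_prob) auto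

lemma Q_diff: "f \<in> bdd_borel \<Longrightarrow> g \<in> bdd_borel \<Longrightarrow> Q t (\<lambda>x. f x - g x) x = Q t f x - Q t g x"
  unfolding Q_def by (intro Bochner_Integration.integral_diff borel_prob_integrable Qm_borel_prob) auto

lemma Q_cmult: "Q t (\<lambda>x. c * f x) x = c * Q t f x"
  by (simp add: Q_def)

lemma borel_prob_tendsto_integral:
  fixes f :: "nat \<Rightarrow> 'b::topological_space \<Rightarrow> real"
  assumes "borel_prob \<mu>" "\<And>n. f n \<in> bdd_borel" "g \<in> borel_measurable borel"
    "\<And>n x. \<bar>f n x\<bar> \<le> B" "\<And>x. (\<lambda>n. f n x) \<longlonglongrightarrow> g x"
  shows "(\<lambda>n. \<integral>x. f n x \<partial>\<mu>) \<longlonglongrightarrow> (\<integral>x. g x \<partial>\<mu>)"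
proof -
  interpret prob_space \<mu> using assms by (simp add: borel_prob_def)
  have sets: "sets \<mu> = sets borel" using assms by (simp add: borel_prob_def)
  show ?thesis
  proof (rule integral_dominated_convergence[where w="\<lambda>_. B"])
    show "g \<in> borel_measurable \<mu>" "f n \<in> borel_measurable \<mu>" for n
      using assms(3) bdd_borel_measurable[OF assms(2)] by (simp_all add: measurable_cong_sets[OF sets refl])
    show "AE x in \<mu>. norm (f n x) \<le> B" for n using assms(4) by simp
    show "AE x in \<mu>. (\<lambda>n. f n x) \<longlonglongrightarrow> g x" using assms(5) by simp
  qed simp
qed

text \<open>The Feller property at each time, with dominated convergence over the sampled
  time.\<close>

lemma Q_bcontinuous:
  assumes "t > 0" "bcontinuous f"
  shows "bcontinuous (Q t f)"
proof -
  have f: "f \<in> bdd_borel" using assms(2) by (rule bcontinuous_bdd_borel)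
  obtain B where B: "\<And>x. \<bar>f x\<bar> \<le> B" using f by (meson bdd_borelE)
  have "continuous_on UNIV (Q t f)"
    unfolding continuous_on_sequentially
  proof safe
    fix x and u :: "nat \<Rightarrow> 'a" assume u: "u \<longlonglongrightarrow> x"
    have "(\<lambda>n. \<integral>s. P (max 0 s) f (u n) \<partial>unif t) \<longlonglongrightarrow> (\<integral>s. P (max 0 s) f x \<partial>unif t)"
    proof (rule borel_prob_tendsto_integral[where B=B])
      show "(\<lambda>n. P (max 0 s) f (u n)) \<longlonglongrightarrow> P (max 0 s) f x" for s
        by (rule continuous_on_tendsto_compose[OF _ u, of UNIV])
           (use P_bcontinuous[OF _ assms(2), of "max 0 s"] in \<open>auto simp: bcontinuous_def\<close>)
      show "(\<lambda>s. P (max 0 s) f (u n)) \<in> bdd_borel" for n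
        using P_measurable_time[OF f] P_abs_le[OF _ f B] by (intro bdd_borelI[of _ B]) auto
    qed (use P_measurable_time[OF f] P_abs_le[OF _ f B] borel_prob_unif assms in auto)
    then show "(Q t f \<circ> u) \<longlonglongrightarrow> Q t f x"
      by (simp add: o_def Q_eq_unif[OF assms(1) f])
  qed
  then show ?thesis using Q_bdd_borel[OF f] by (simp add: bcontinuous_def bdd_borel_def)
qed

lemma Fubini_bounded:
  fixes f :: "'b \<Rightarrow> 'c \<Rightarrow> real"
  assumes "prob_space M1" "prob_space M2" "case_prod f \<in> borel_measurable (M1 \<Otimes>\<^sub>M M2)" "\<And>x y. \<bar>f x y\<bar> \<le> B"
  shows "(\<integral>y. (\<integral>x. f x y \<partial>M1) \<partial>M2) = (\<integral>x. (\<integral>y. f x y \<partial>M2) \<partial>M1)"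
proof -
  interpret M1: prob_space M1 by fact
  interpret M2: prob_space M2 by fact
  interpret pair_prob_space M1 M2 ..
  show ?thesis
    using assms by (intro Fubini_integral integrable_const_bound[where B=B]) auto
qed

lemma integral_Q_swap:
  assumes "t > 0" "f \<in> bdd_borel" "borel_prob \<nu>"
  shows "(\<integral>x. Q t f x \<partial>\<nu>) = (\<integral>a. (\<integral>x. P (max 0 a) f x \<partial>\<nu>) \<partial>unif t)"
proof -
  obtain B where B: "\<And>x. \<bar>f x\<bar> \<le> B" using assms by (meson bdd_borelE)
  have "(\<integral>x. (\<integral>a. P (max 0 a) f x \<partial>unif t) \<partial>\<nu>) = (\<integral>a. (\<integral>x. P (max 0 a) f x \<partial>\<nu>) \<partial>unif t)"
  proof (rule Fubini_bounded[where B=B])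
    show "(\<lambda>(a, x). P (max 0 a) f x) \<in> borel_measurable (unif t \<Otimes>\<^sub>M \<nu>)"
      using P_joint[OF assms(2)] assms(3)
      by (simp add: split_beta' borel_prob_def cong: measurable_cong_sets sets_pair_measure_cong)
  qed (use P_abs_le[OF _ assms(2) B] assms prob_unif in \<open>auto simp: borel_prob_def\<close>)
  then show ?thesis using assms by (simp add: Q_eq_unif)
qed

lemma P_Q_eq:
  assumes "s \<ge> 0" "t > 0" "f \<in> bdd_borel"
  shows "P s (Q t f) x = Q t (P s f) x"
proof -
  have "P s (Q t f) x = (\<integral>a. P s (P (max 0 a) f) x \<partial>unif t)"
    using integral_Q_swap[OF assms(2,3) K_borel_prob[OF assms(1)], of x] by (simp add: P_def[of s])
  also have "\<dots> = (\<integral>a. P (max 0 a) (P s f) x \<partial>unif t)"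
    using assms by (simp add: P_P add.commute)
  also have "\<dots> = Q t (P s f) x" using assms by (simp add: Q_eq_unif P_bdd_borel)
  finally show ?thesis .
qed

section \<open>Comparing averages over different time windows\<close>

lemma bounded_integrable_on:
  fixes g :: "real \<Rightarrow> real"
  assumes "g \<in> borel_measurable borel" "\<And>s. \<bar>g s\<bar> \<le> B"
  shows "g integrable_on {a..b}" "(LINT s:{a..b}|lborel. g s) = integral {a..b} g"
    "\<bar>integral {a..b} g\<bar> \<le> B * \<bar>b - a\<bar>"
proof -
  have int: "set_integrable lborel {a..b} g"
    unfolding set_integrable_def
    by (rule integrableI_bounded_set_indicator[where B=B]) (use assms in \<open>auto simp: emeasure_lborel_Icc_eq\<close>)
  show 1: "g integrable_on {a..b}" "(LINT s:{a..b}|lborel. g s) = integral {a..b} g"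
    using set_borel_integral_eq_integral[OF int] by auto
  have "B \<ge> 0" using assms(2)[of 0] by linarith
  show "\<bar>integral {a..b} g\<bar> \<le> B * \<bar>b - a\<bar>"
  proof (cases "a \<le> b")
    case True
    have "norm (integral (cbox a b) g) \<le> B * measure lborel (cbox a b)"
      using \<open>B \<ge> 0\<close> 1(1) assms(2) by (intro integrable_bound) (auto simp: real_norm_def)
    with True show ?thesis by simp
  qed (use \<open>B \<ge> 0\<close> in auto)
qed

lemma P_time_integral:
  assumes "f \<in> bdd_borel" "\<And>x. \<bar>f x\<bar> \<le> B"
  shows "(\<lambda>s. P (max 0 s) f x) integrable_on {a..b}"
    "\<bar>integral {a..b} (\<lambda>s. P (max 0 s) f x)\<bar> \<le> B * \<bar>b - a\<bar>"
  using bounded_integrable_on[OF P_measurable_time[OF assms(1)], of x B a b] P_abs_le[OF _ assms] by auto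

lemma Q_eq_integral:
  assumes "t > 0" "f \<in> bdd_borel"
  shows "Q t f x = (1 / t) * integral {0..t} (\<lambda>s. P (max 0 s) f x)"
proof -
  obtain B where B: "\<And>x. \<bar>f x\<bar> \<le> B" using assms by (meson bdd_borelE)
  show ?thesis
    using bounded_integrable_on(2)[OF P_measurable_time[OF assms(2)], of x B 0 t] P_abs_le[OF _ assms(2) B]
    by (simp add: Q_eq_LINT[OF assms])
qed

lemma Q_P_eq_integral:
  assumes "t > 0" "s \<ge> 0" "f \<in> bdd_borel"
  shows "Q t (P s f) x = (1 / t) * integral {s..s + t} (\<lambda>a. P (max 0 a) f x)"
proof -
  let ?h = "\<lambda>a. P (max 0 a) f x"
  have "integral {0..t} (\<lambda>a. P (max 0 a) (P s f) x) = integral {0..t} (\<lambda>a. ?h (a + s))"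
    using assms by (intro integral_cong) (auto simp: P_P max_def)
  also have "\<dots> = integral {s..s + t} ?h"
    using integral_shift_real_ivl[of s s "s + t" ?h] by (simp add: o_def)
  finally show ?thesis using Q_eq_integral[OF assms(1) P_bdd_borel[OF assms(2,3)]] by simp
qed

text \<open>Applying \<open>P s\<close> shifts the window \<open>[0,t]\<close> to
  \<open>[s,s+t]\<close>; the two differ by two intervals of length \<open>s\<close>, each
  contributing at most \<open>B * s\<close>.\<close>

lemma Q_P_close:
  assumes "t > 0" "s \<ge> 0" "f \<in> bdd_borel" "\<And>x. \<bar>f x\<bar> \<le> B"
  shows "\<bar>Q t (P s f) x - Q t f x\<bar> \<le> 2 * B * s / t"
proof -
  let ?I = "\<lambda>a b. integral {a..b} (\<lambda>a. P (max 0 a) f x)"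
  have "?I 0 s + ?I s (s + t) = ?I 0 (s + t)" "?I 0 t + ?I t (s + t) = ?I 0 (s + t)"
    using assms P_time_integral[OF assms(3,4)] by (intro Henstock_Kurzweil_Integration.integral_combine; simp)+
  then have "?I s (s + t) - ?I 0 t = ?I t (s + t) - ?I 0 s" by linarith
  moreover have "\<bar>?I t (s + t)\<bar> \<le> B * s" "\<bar>?I 0 s\<bar> \<le> B * s"
    using P_time_integral(2)[OF assms(3,4), where a=t and b="s+t"] P_time_integral(2)[OF assms(3,4), where a=0 and b=s] assms by auto
  ultimately have "\<bar>?I s (s + t) - ?I 0 t\<bar> \<le> 2 * B * s" by linarith
  moreover have "Q t (P s f) x - Q t f x = (?I s (s + t) - ?I 0 t) / t"
    using assms by (simp add: Q_P_eq_integral Q_eq_integral diff_divide_distrib)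
  ultimately show ?thesis using assms(1) by (simp add: abs_divide divide_right_mono)
qed

lemma P_Q_close:
  assumes "t > 0" "s \<ge> 0" "f \<in> bdd_borel" "\<And>x. \<bar>f x\<bar> \<le> B"
  shows "\<bar>P s (Q t f) x - Q t f x\<bar> \<le> 2 * B * s / t"
  using Q_P_close[OF assms] assms by (simp add: P_Q_eq)

text \<open>Average the estimate of \<open>P_Q_close\<close> over times in \<open>[0,s]\<close>,
  bounding each of them by \<open>s\<close>.\<close>

lemma Q_Q_close:
  assumes "t > 0" "s > 0" "f \<in> bdd_borel" "\<And>x. \<bar>f x\<bar> \<le> B"
  shows "\<bar>Q s (Q t f) x - Q t f x\<bar> \<le> 2 * B * s / t"
proof -
  have "B \<ge> 0" using assms(4)[of undefined] by linarith
  let ?g = "\<lambda>a. P (max 0 a) (Q t f) x"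
  interpret U: prob_space "unif s" using assms by (intro prob_unif)
  have g: "?g \<in> bdd_borel"
    using P_measurable_time[OF Q_bdd_borel[OF assms(3)]] P_abs_le[OF _ Q_bdd_borel[OF assms(3)] Q_abs_le[OF assms(3,4)]]
    by (intro bdd_borelI[of _ B]) auto
  have "\<bar>?g a - Q t f x\<bar> \<le> 2 * B * s / t" if "a \<in> {0..s}" for a
  proof -
    have "\<bar>?g a - Q t f x\<bar> \<le> 2 * B * max 0 a / t" using P_Q_close[OF assms(1) _ assms(3,4), of "max 0 a" x] by simp
    also have "\<dots> \<le> 2 * B * s / t" using that assms \<open>B \<ge> 0\<close> by (intro divide_right_mono mult_left_mono) auto
    finally show ?thesis .
  qed
  then have AE: "AE a in unif s. \<bar>?g a - Q t f x\<bar> \<le> 2 * B * s / t"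
    by (intro AE_uniform_measureI) auto
  have int: "integrable (unif s) ?g" using borel_prob_integrable[OF borel_prob_unif g] assms by simp
  have "\<bar>Q s (Q t f) x - Q t f x\<bar> = \<bar>\<integral>a. ?g a - Q t f x \<partial>unif s\<bar>"
    using int U.prob_space assms by (simp add: Q_eq_unif Q_bdd_borel)
  also have "\<dots> \<le> (\<integral>a. \<bar>?g a - Q t f x\<bar> \<partial>unif s)" by (rule integral_abs_bound)
  also have "\<dots> \<le> 2 * B * s / t"
    using AE int by (intro U.integral_le_const) auto
  finally show ?thesis .
qed

lemma Q_Q_eq:
  assumes "t > 0" "s > 0" "f \<in> bdd_borel"
  shows "Q s (Q t f) x = Q t (Q s f) x"
proof -
  have "Q s (Q t f) x = (\<integral>a. P (max 0 a) (Q t f) x \<partial>unif s)"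
    using assms by (simp add: Q_eq_unif Q_bdd_borel)
  also have "\<dots> = (\<integral>a. Q t (P (max 0 a) f) x \<partial>unif s)" using assms by (simp add: P_Q_eq)
  also have "\<dots> = Q t (Q s f) x"
    unfolding Q_def[of t] using integral_Q_swap[OF assms(2,3) Qm_borel_prob[of t x]] by simp
  finally show ?thesis .
qed

lemma Q_Q_close':
  assumes "t > 0" "s > 0" "f \<in> bdd_borel" "\<And>x. \<bar>f x\<bar> \<le> B"
  shows "\<bar>Q t (Q s f) x - Q t f x\<bar> \<le> 2 * B * s / t"
  using Q_Q_close[OF assms] Q_Q_eq[OF assms(1-3)] by simp

text \<open>From the identity that \<open>t * (Q t f x - Q s f x)\<close> is the integral over
  \<open>[s,t]\<close> minus \<open>(t - s) * Q s f x\<close>. It carries convergence from integer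
  to real times.\<close>

lemma Q_time_close:
  assumes "0 < s" "s \<le> t" "f \<in> bdd_borel" "\<And>x. \<bar>f x\<bar> \<le> B"
  shows "\<bar>Q t f x - Q s f x\<bar> \<le> 2 * B * (t - s) / t"
proof -
  let ?I = "\<lambda>a b. integral {a..b} (\<lambda>a. P (max 0 a) f x)"
  have c: "?I 0 s + ?I s t = ?I 0 t"
    using assms P_time_integral[OF assms(3,4)] by (intro Henstock_Kurzweil_Integration.integral_combine) auto
  have b: "\<bar>?I s t\<bar> \<le> B * (t - s)" "\<bar>Q s f x\<bar> \<le> B"
    using P_time_integral(2)[OF assms(3,4), where a=s and b=t] Q_abs_le[OF assms(3,4)] assms by auto
  have "t * (Q t f x - Q s f x) = ?I s t - (t - s) * Q s f x"
    using assms by (simp add: Q_eq_integral c[symmetric] field_simps)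
  then have "\<bar>t * (Q t f x - Q s f x)\<bar> = \<bar>?I s t - (t - s) * Q s f x\<bar>" by simp
  also have "\<dots> \<le> B * (t - s) + (t - s) * B"
    using b assms(2) by (intro order_trans[OF abs_triangle_ineq4] add_mono) (auto simp: abs_mult mult_left_mono)
  finally have "t * \<bar>Q t f x - Q s f x\<bar> \<le> 2 * B * (t - s)"
    using assms by (simp add: abs_mult)
  then show ?thesis using assms by (simp add: field_simps)
qed

text \<open>At integer times the average is an ergodic mean of the chain with kernel
  \<open>K 1\<close> applied to \<open>Q 1 f\<close>, which lets discrete hitting times control
  continuous-time averages.\<close>

lemma Q_nat_eq_sum:
  assumes "n > 0" "f \<in> bdd_borel"
  shows "Q (real n) f x = (1 / real n) * (\<Sum>j<n. P (real j) (Q 1 f) x)"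
proof -
  obtain B where B: "\<And>x. \<bar>f x\<bar> \<le> B" using assms by (meson bdd_borelE)
  let ?I = "\<lambda>a b. integral {a..b} (\<lambda>a. P (max 0 a) f x)"
  have "?I 0 (real m) = (\<Sum>j<m. P (real j) (Q 1 f) x)" for m
  proof (induction m)
    case (Suc m)
    have "?I 0 (real m) + ?I (real m) (real m + 1) = ?I 0 (real m + 1)"
      using P_time_integral[OF assms(2) B] by (intro Henstock_Kurzweil_Integration.integral_combine) auto
    moreover have "P (real m) (Q 1 f) x = ?I (real m) (real m + 1)"
      using assms Q_P_eq_integral[of 1 "real m" f x] by (simp add: P_Q_eq)
    ultimately show ?case using Suc by (simp add: add.commute)
  qed simp
  then show ?thesis using assms by (simp add: Q_eq_integral)
qed

end

section \<open>Merging of averages, and convergence to an invariant measure\<close>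

text \<open>Any \<open>a\<close> strictly below the infimum works. The return times depend on
  \<open>x\<close>, but \<open>a\<close> does not.\<close>

lemma (in mfeller) frequent_return:
  assumes "(INF x. Limsup at_top (\<lambda>t. ereal (Qx K t x (ball z \<epsilon>)))) > 0"
  obtains a where "a > 0" "\<And>x. \<exists>\<^sub>F t in at_top. a \<le> measure (Qm t x) (ball z \<epsilon>)"
proof -
  obtain a where a: "0 < ereal a" "ereal a < (INF x. Limsup at_top (\<lambda>t. ereal (Qx K t x (ball z \<epsilon>))))"
    using ereal_dense2[OF assms] by auto
  have "\<exists>\<^sub>F t in at_top. a \<le> measure (Qm t x) (ball z \<epsilon>)" for x
  proof (rule ccontr)
    assume "\<not> (\<exists>\<^sub>F t in at_top. a \<le> measure (Qm t x) (ball z \<epsilon>))"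
    then have "\<forall>\<^sub>F t in at_top. measure (Qm t x) (ball z \<epsilon>) < a" by (simp add: not_frequently not_le)
    then have "\<forall>\<^sub>F t in at_top. ereal (Qx K t x (ball z \<epsilon>)) \<le> ereal a"
      using eventually_gt_at_top[of 0] by eventually_elim (simp add: Qx_eq_Qm)
    then have "Limsup at_top (\<lambda>t. ereal (Qx K t x (ball z \<epsilon>))) \<le> ereal a" by (rule Limsup_bounded)
    then show False using a(2) INF_lower[of x UNIV "\<lambda>x. Limsup at_top (\<lambda>t. ereal (Qx K t x (ball z \<epsilon>)))"] by simp
  qed
  then show thesis using that a(1) by simp
qed

text \<open>With \<open>g x = limsup \<bar>Q n f x - Q n f z\<bar>\<close>, reverse Fatou and \<open>Q n \<circ> Q s \<approx> Q n\<close> give \<open>g \<le> Q s g\<close>;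
  since \<open>Q s\<close> charges a ball where \<open>g \<le> \<epsilon>\<close> with mass bounded below, \<open>sup g \<le> \<epsilon>\<close>.\<close>
lemma (in mfeller) averages_merge:
  assumes ec: "cesaro_ev_cont K z"
    and lb: "\<And>\<epsilon>. \<epsilon> > 0 \<Longrightarrow> (INF x. Limsup at_top (\<lambda>t. ereal (Qx K t x (ball z \<epsilon>)))) > 0"
    and f: "blipschitz f"
  shows "(\<lambda>n. Q (real n) f x - Q (real n) f z) \<longlonglongrightarrow> 0"
proof -
  have fb: "f \<in> bdd_borel" using f by (intro bcontinuous_bdd_borel blipschitz_bcontinuous)
  obtain B where B: "B \<ge> 0" "\<And>x. \<bar>f x\<bar> \<le> B" using fb by (meson bdd_borelE)
  define D where "D n x = \<bar>Q (real n) f x - Q (real n) f z\<bar>" for n x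
  have D_b: "D n \<in> bdd_borel" for n
    unfolding D_def[abs_def] by (intro bdd_borel_abs bdd_borel_diff Q_bdd_borel fb bdd_borel_const)
  have D: "0 \<le> D n x" "D n x \<le> 2 * B" for n x
    using Q_abs_le[OF fb B(2), of "real n" x] Q_abs_le[OF fb B(2), of "real n" z] unfolding D_def by linarith+
  \<comment> \<open>Tail suprema turn the limsup into a decreasing bounded limit, so reverse Fatou
    becomes dominated convergence for \<open>h N\<close>.\<close>
  define h where "h N x = (SUP n\<in>{N..}. D n x)" for N x
  have bdd: "bdd_above ((\<lambda>n. D n x) ` {N..})" for N x using D(2) by (intro bdd_aboveI2) auto
  have h: "0 \<le> h N x" "h N x \<le> 2 * B" for N x
    unfolding h_def using D bdd by (auto intro!: cSUP_least cSUP_upper2[where x=N])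
  have D_le_h: "n \<ge> N \<Longrightarrow> D n x \<le> h N x" for n N x unfolding h_def by (intro cSUP_upper bdd) auto
  have h_b: "h N \<in> bdd_borel" for N
  proof (rule bdd_borelI[of _ "2 * B"])
    show "h N \<in> borel_measurable borel"
      unfolding h_def[abs_def] using bdd_borel_measurable[OF D_b] bdd
      by (intro borel_measurable_cSUP) auto
  qed (use h in auto)
  have h_dec: "decseq (\<lambda>N. h N x)" for x
    unfolding h_def using bdd by (intro decseq_SucI cSUP_subset_mono) auto
  define g where "g x = (INF N. h N x)" for x
  have h_lim: "(\<lambda>N. h N x) \<longlonglongrightarrow> g x" for x
    unfolding g_def using h h_dec by (intro LIMSEQ_decseq_INF bdd_belowI2[of _ 0]) auto
  have g_le_h: "g x \<le> h N x" for x N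
    by (rule decseq_ge[OF h_dec h_lim])
  have g: "0 \<le> g x" "g x \<le> 2 * B" for x
    using LIMSEQ_le_const[OF h_lim, of 0 x] h g_le_h[of x 0] h(2)[of 0 x] by (auto intro: order_trans)
  have g_meas: "g \<in> borel_measurable borel"
    by (rule borel_measurable_LIMSEQ_real[OF h_lim]) (use bdd_borel_measurable[OF h_b] in auto)
  have g_b: "g \<in> bdd_borel" using g g_meas by (intro bdd_borelI[of _ "2 * B"]) auto
  have sub: "g x \<le> Q s g x" if s: "s > 0" for s x
  proof -
    \<comment> \<open>For \<open>n \<ge> N\<close> the deviation \<open>D n\<close> is dominated by
      \<open>h N\<close>, and replacing \<open>Q n f\<close> by \<open>Q s (Q n f)\<close> costs at
      most \<open>2 * B * s / N\<close>.\<close>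
    have le: "h N x \<le> Q s (h N) x + 2 * B * s * inverse (real N)" if N: "N > 0" for N
    proof (unfold h_def[of N x], rule cSUP_least)
      fix n assume n: "n \<in> {N..}"
      have "\<bar>Q s (Q (real n) f) x - Q (real n) f x\<bar> \<le> 2 * B * s / real n"
        using n N s by (intro Q_Q_close fb B) auto
      moreover have "\<bar>Q s (Q (real n) f) x - Q (real n) f z\<bar> \<le> Q s (D n) x"
      proof -
        have "Q s (Q (real n) f) x - Q (real n) f z = Q s (\<lambda>y. Q (real n) f y - Q (real n) f z) x"
          using Q_diff[OF Q_bdd_borel[OF fb] bdd_borel_const, of s "real n" "Q (real n) f z" x] Qm_borel_prob[of s x]
            prob_space.prob_space[of "Qm s x"] borel_prob_space[OF Qm_borel_prob[of s x]]
          by (simp add: Q_def[of s] borel_prob_def)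
        then show ?thesis unfolding D_def[abs_def] Q_def[of s] by (simp add: integral_abs_bound)
      qed
      moreover have "Q s (D n) x \<le> Q s (h N) x" using n by (intro Q_mono D_b h_b D_le_h) auto
      moreover have "2 * B * s / real n \<le> 2 * B * s * inverse (real N)"
        using n N s B(1) by (auto simp: divide_inverse intro!: mult_left_mono le_imp_inverse_le)
      ultimately show "D n x \<le> Q s (h N) x + 2 * B * s * inverse (real N)"
        unfolding D_def by linarith
    qed auto
    have "(\<lambda>N. Q s (h N) x) \<longlonglongrightarrow> Q s g x"
      unfolding Q_def by (rule borel_prob_tendsto_integral[OF Qm_borel_prob h_b g_meas, where B="2*B"])
        (use h h_lim in auto)
    then have "(\<lambda>N. Q s (h N) x + 2 * B * s * inverse (real N)) \<longlonglongrightarrow> Q s g x + 2 * B * s * 0"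
      by (intro tendsto_intros lim_inverse_n)
    then have "(\<lambda>N. Q s (h N) x + 2 * B * s * inverse (real N)) \<longlonglongrightarrow> Q s g x" by simp
    from LIMSEQ_le[OF h_lim this] show ?thesis using le by (metis gr0_conv_Suc less_le_trans zero_less_one One_nat_def)
  qed
  have g_small: "g x \<le> e" if e: "e > 0" for e x
  proof -
    have "Limsup (nhds z) (\<lambda>x. Limsup at_top (\<lambda>t. ereal \<bar>Qf K t f x - Qf K t f z\<bar>)) < ereal e"
      using ec f e by (simp add: cesaro_ev_cont_def)
    then have "\<forall>\<^sub>F x in nhds z. Limsup at_top (\<lambda>t. ereal \<bar>Qf K t f x - Qf K t f z\<bar>) < ereal e"
      by (rule Limsup_lessD)
    then obtain \<delta> where \<delta>: "\<delta> > 0" "\<And>y. dist y z < \<delta> \<Longrightarrow> Limsup at_top (\<lambda>t. ereal \<bar>Qf K t f y - Qf K t f z\<bar>) < ereal e"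
      unfolding eventually_nhds_metric by blast
    have g_ball: "g y \<le> e" if "y \<in> ball z \<delta>" for y
    proof -
      have "\<forall>\<^sub>F t in at_top. ereal \<bar>Qf K t f y - Qf K t f z\<bar> < ereal e"
        using \<delta>(2)[of y] that by (intro Limsup_lessD) (auto simp: dist_commute)
      then have "\<forall>\<^sub>F n in sequentially. ereal \<bar>Qf K (real n) f y - Qf K (real n) f z\<bar> < ereal e"
        by (rule eventually_compose_filterlim[OF _ filterlim_real_sequentially])
      then have "\<forall>\<^sub>F n in sequentially. D n y \<le> e"
        using eventually_gt_at_top[of 0] by eventually_elim (simp add: D_def Q_eq_Qf fb)
      then obtain N where "\<And>n. n \<ge> N \<Longrightarrow> D n y \<le> e" unfolding eventually_sequentially by blast
      then have "h N y \<le> e" unfolding h_def by (intro cSUP_least) auto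
      then show ?thesis using g_le_h[of y N] by simp
    qed
    obtain a where a: "a > 0" "\<And>x. \<exists>\<^sub>F t in at_top. a \<le> measure (Qm t x) (ball z \<delta>)"
      using frequent_return[OF lb[OF \<delta>(1)]] by blast
    define G where "G = (SUP x. g x)"
    have bddg: "bdd_above (range g)" using g(2) by (intro bdd_aboveI2) auto
    have gG: "g x \<le> G" for x unfolding G_def by (intro cSUP_upper bddg) auto
    have "G \<le> e"
    proof (rule ccontr)
      assume "\<not> G \<le> e"
      \<comment> \<open>A maximum principle: a fraction at least \<open>a\<close> of the average
        sees values at most \<open>e\<close>, so every \<open>g x\<close> lies below the supremum
        \<open>G\<close> by a fixed amount.\<close>
      have "g x \<le> G - (G - e) * a" for x
      proof -
        have "\<exists>\<^sub>F t in at_top. a \<le> measure (Qm t x) (ball z \<delta>) \<and> 0 < t"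
          using frequently_eventually_frequently[OF a(2) eventually_gt_at_top[of 0]] .
        then obtain t where t: "a \<le> measure (Qm t x) (ball z \<delta>)" "0 < t" using frequently_ex by blast
        interpret prob_space "Qm t x" using Qm_borel_prob[of t x] by (simp add: borel_prob_def)
        have "g x \<le> Q t g x" by (rule sub[OF t(2)])
        also have "\<dots> \<le> Q t (\<lambda>y. G - (G - e) * indicator (ball z \<delta>) y) x"
          using gG g_ball by (intro Q_mono g_b bdd_borel_diff bdd_borel_const bdd_borel_cmult bdd_borel_indicator)
            (auto simp: indicator_def)
        also have "\<dots> = G - (G - e) * measure (Qm t x) (ball z \<delta>)"
        proof -
          have "ball z \<delta> \<in> sets (Qm t x)" using Qm_borel_prob[of t x] by (simp add: borel_prob_def)
          then show ?thesis
            unfolding Q_def using prob_space borel_prob_integrable[OF Qm_borel_prob bdd_borel_indicator[of "ball z \<delta>"], of t x]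
            by (simp add: borel_prob_space[OF Qm_borel_prob])
        qed
        also have "\<dots> \<le> G - (G - e) * a" using t \<open>\<not> G \<le> e\<close> by simp
        finally show ?thesis .
      qed
      then have "G \<le> G - (G - e) * a" unfolding G_def by (intro cSUP_least) auto
      then have "(G - e) * a \<le> 0" by simp
      then show False using a(1) \<open>\<not> G \<le> e\<close> by (simp add: mult_le_0_iff)
    qed
    then show ?thesis using gG[of x] by simp
  qed
  then have "g x = 0" using g(1)[of x] by (meson dense_ge order_antisym)
  have "(\<lambda>n. D n x) \<longlonglongrightarrow> 0"
  proof (rule tendsto_sandwich[of "\<lambda>_. 0" _ _ "\<lambda>n. h n x"])
    show "(\<lambda>n. h n x) \<longlonglongrightarrow> 0" using h_lim[of x] \<open>g x = 0\<close> by simp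
  qed (use D D_le_h in auto)
  then show ?thesis unfolding D_def by (rule tendsto_rabs_zero_cancel)
qed

section \<open>From an invariant measure and merging to mean ergodicity\<close>

lemma (in mfeller) invariant_integral_P:
  assumes "invariant K \<mu>" "t \<ge> 0" "f \<in> bdd_borel"
  shows "(\<integral>x. P t f x \<partial>\<mu>) = (\<integral>x. f x \<partial>\<mu>)"
  using integral_kernel_bind[of \<mu> "K t" f] K_kernel[of t] assms by (simp add: invariant_def P_def)

lemma (in mfeller) invariant_integral_Q:
  assumes "invariant K \<mu>" "t > 0" "f \<in> bdd_borel"
  shows "(\<integral>x. Q t f x \<partial>\<mu>) = (\<integral>x. f x \<partial>\<mu>)"
  using assms prob_space.prob_space[OF prob_unif[OF assms(2)]]
  by (simp add: integral_Q_swap invariant_def[of K \<mu>] invariant_integral_P[OF assms(1) _ assms(3)])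

text \<open>Compare \<open>t\<close> with its integer part; by \<open>Q_time_close\<close> the error
  is at most \<open>2 * B / t\<close>.\<close>

lemma (in mfeller) averages_tendsto_real:
  assumes "f \<in> bdd_borel" "(\<lambda>n. Q (real n) f x) \<longlonglongrightarrow> c"
  shows "((\<lambda>t. Q t f x) \<longlongrightarrow> c) at_top"
proof -
  obtain B where B: "B \<ge> 0" "\<And>x. \<bar>f x\<bar> \<le> B" using assms by (meson bdd_borelE)
  have fl: "filterlim (\<lambda>t::real. nat \<lfloor>t\<rfloor>) sequentially at_top"
    by (rule filterlim_compose[OF filterlim_nat_sequentially filterlim_floor_sequentially])
  have "((\<lambda>t. Q t f x - Q (real (nat \<lfloor>t\<rfloor>)) f x) \<longlongrightarrow> 0) at_top"
  proof (rule Lim_null_comparison)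
    show "\<forall>\<^sub>F t in at_top. norm (Q t f x - Q (real (nat \<lfloor>t\<rfloor>)) f x) \<le> 2 * B / t"
      using eventually_ge_at_top[of 1]
    proof eventually_elim
      case (elim t)
      have "\<bar>Q t f x - Q (real (nat \<lfloor>t\<rfloor>)) f x\<bar> \<le> 2 * B * (t - real (nat \<lfloor>t\<rfloor>)) / t"
        using elim by (intro Q_time_close assms(1) B) linarith+
      also have "\<dots> \<le> 2 * B / t"
      proof -
        have "t - real (nat \<lfloor>t\<rfloor>) \<le> 1" using elim by linarith
        from mult_left_mono[OF this, of "2 * B"] show ?thesis using elim B(1) by (intro divide_right_mono) auto
      qed
      finally show ?case by simp
    qed
    show "((\<lambda>t. 2 * B / t) \<longlongrightarrow> 0) at_top"
      by (intro tendsto_divide_0[OF tendsto_const] filterlim_at_top_imp_at_infinity filterlim_ident)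
  qed
  from tendsto_add[OF this filterlim_compose[OF assms(2) fl]] show ?thesis by simp
qed

lemma (in mfeller) Qnu_eq:
  assumes "t > 0" "borel_prob \<nu>" "f \<in> bdd_borel"
  shows "Qnu K t \<nu> f = (\<integral>x. Q t f x \<partial>\<nu>)"
proof -
  interpret prob_space \<nu> using assms by (simp add: borel_prob_def)
  have "(\<lambda>(s, x). P (max 0 s) f x) \<in> borel_measurable (borel \<Otimes>\<^sub>M \<nu>)"
    using P_joint[OF assms(3)] assms(2)
    by (simp add: split_beta' borel_prob_def cong: measurable_cong_sets sets_pair_measure_cong)
  then have meas: "(\<lambda>s. \<integral>x. P (max 0 s) f x \<partial>\<nu>) \<in> borel_measurable borel"
    by (rule borel_measurable_lebesgue_integral)
  have "Qnu K t \<nu> f = (1 / t) * (LINT s:{0..t}|lborel. (\<integral>x. P (max 0 s) f x \<partial>\<nu>))"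
    unfolding Qnu_def
    by (intro arg_cong[where f="\<lambda>x. 1 / t * x"] set_lebesgue_integral_cong)
       (auto simp: integral_kernel_bind[OF assms(2) K_kernel assms(3)] P_def)
  also have "\<dots> = (\<integral>s. (\<integral>x. P (max 0 s) f x \<partial>\<nu>) \<partial>unif t)" by (rule integral_unif[OF assms(1) meas, symmetric])
  also have "\<dots> = (\<integral>x. Q t f x \<partial>\<nu>)" by (rule integral_Q_swap[OF assms(1,3,2), symmetric])
  finally show ?thesis .
qed

text \<open>Integrate \<open>Q n f y - Q n f x\<close> over \<open>y\<close> against the invariant
  measure: the first term becomes the constant integral of \<open>f\<close>, while merging and
  dominated convergence send the whole to \<open>0\<close>.\<close>

lemma (in mfeller) averages_tendsto_invariant:
  assumes merge: "\<And>f x. blipschitz f \<Longrightarrow> (\<lambda>n. Q (real n) f x - Q (real n) f z) \<longlonglongrightarrow> 0"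
    and inv: "invariant K \<mu>" and f: "blipschitz f"
  shows "((\<lambda>t. Q t f x) \<longlongrightarrow> (\<integral>y. f y \<partial>\<mu>)) at_top"
proof (rule averages_tendsto_real)
  show fb: "f \<in> bdd_borel" using f by (intro bcontinuous_bdd_borel blipschitz_bcontinuous)
  obtain B where B: "\<And>x. \<bar>f x\<bar> \<le> B" using fb by (meson bdd_borelE)
  have \<mu>: "borel_prob \<mu>" using inv by (simp add: invariant_def)
  then interpret prob_space \<mu> by (simp add: borel_prob_def)
  have "(\<lambda>n. \<integral>y. Q (real n) f y - Q (real n) f x \<partial>\<mu>) \<longlonglongrightarrow> (\<integral>y. 0 \<partial>\<mu>)"
  proof (rule borel_prob_tendsto_integral[OF \<mu>, where B="2*B"])
    show "(\<lambda>n. Q (real n) f y - Q (real n) f x) \<longlonglongrightarrow> 0" for y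
      using tendsto_diff[OF merge[OF f, of y] merge[OF f, of x]] by simp
    show "\<bar>Q (real n) f y - Q (real n) f x\<bar> \<le> 2 * B" for n y
      using Q_abs_le[OF fb B, of "real n" x] Q_abs_le[OF fb B, of "real n" y] by linarith
  qed (use Q_bdd_borel[OF fb] in auto)
  then have lim0: "(\<lambda>n. \<integral>y. Q (real n) f y - Q (real n) f x \<partial>\<mu>) \<longlonglongrightarrow> 0" by simp
  have eq: "(\<integral>y. Q (real n) f y - Q (real n) f x \<partial>\<mu>) = (\<integral>y. f y \<partial>\<mu>) - Q (real n) f x" if "n > 0" for n
    using that borel_prob_integrable[OF \<mu> Q_bdd_borel[OF fb]] prob_space
    by (simp add: invariant_integral_Q[OF inv _ fb] borel_prob_space[OF \<mu>, symmetric])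
  have "(\<lambda>n. (\<integral>y. f y \<partial>\<mu>) - Q (real n) f x) \<longlonglongrightarrow> 0"
    by (rule Lim_transform_eventually[OF lim0]) (rule eventually_mono[OF eventually_gt_at_top[of 0] eq])
  from tendsto_diff[OF tendsto_const[of "\<integral>y. f y \<partial>\<mu>"] this]
  show "(\<lambda>n. Q (real n) f x) \<longlonglongrightarrow> (\<integral>y. f y \<partial>\<mu>)" by simp
qed

text \<open>A portmanteau argument. A cluster mean along hypothetical bad times agrees with
  \<open>\<mu>\<close> on bumps, hence dominates \<open>\<mu>\<close> on open sets, and therefore
  agrees with it on \<open>f\<close>.\<close>

lemma (in mfeller) averages_tendsto_bcontinuous:
  assumes \<mu>: "borel_prob \<mu>"
    and lim: "\<And>f. blipschitz f \<Longrightarrow> ((\<lambda>t. Q t f x) \<longlongrightarrow> (\<integral>y. f y \<partial>\<mu>)) at_top"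
    and f: "bcontinuous f"
  shows "((\<lambda>t. Q t f x) \<longlongrightarrow> (\<integral>y. f y \<partial>\<mu>)) at_top"
proof (rule ccontr)
  assume "\<not> ((\<lambda>t. Q t f x) \<longlongrightarrow> (\<integral>y. f y \<partial>\<mu>)) at_top"
  then obtain e where e: "e > 0" "\<exists>\<^sub>F t in at_top. e \<le> \<bar>Q t f x - (\<integral>y. f y \<partial>\<mu>)\<bar>"
    unfolding tendsto_iff by (auto simp: not_eventually dist_real_def not_less)
  \<comment> \<open>Restricting to the bad times makes the failure, which is only frequent, hold
    eventually along \<open>F\<close>.\<close>
  define F where "F = inf at_top (principal {t. e \<le> \<bar>Q t f x - (\<integral>y. f y \<partial>\<mu>)\<bar>})"
  have "F \<noteq> bot"
    using e(2) by (auto simp: F_def trivial_limit_def eventually_inf_principal frequently_def)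
  then obtain \<Lambda> G where \<Lambda>: "fa_mean \<Lambda>" "G \<le> F" "G \<noteq> bot"
    and conv: "\<And>f. f \<in> bdd_borel \<Longrightarrow> ((\<lambda>t. \<integral>y. f y \<partial>Qm t x) \<longlongrightarrow> \<Lambda> f) G"
    using fa_mean_cluster[of "\<lambda>t. Qm t x" F] Qm_borel_prob by metis
  interpret fa_mean \<Lambda> by fact
  have "G \<le> at_top" using \<Lambda>(2) by (simp add: F_def)
  have eq: "\<Lambda> h = (\<integral>y. h y \<partial>\<mu>)" if "blipschitz h" for h
    using tendsto_unique[OF \<open>G \<noteq> bot\<close> conv tendsto_mono[OF \<open>G \<le> at_top\<close> lim[OF that, unfolded Q_def]]]
      that by (simp add: bcontinuous_bdd_borel blipschitz_bcontinuous)
  have "measure \<mu> U \<le> M U" if "open U" for U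
  proof (rule LIMSEQ_le_const2[OF integral_bump_tendsto[OF \<mu> that]], intro exI allI impI)
    fix k :: nat
    have "(\<integral>y. bump U k y \<partial>\<mu>) = \<Lambda> (bump U k)" using eq[OF bump_blipschitz] by simp
    also have "\<dots> \<le> M U" using that bump_le_indicator by (intro mono bump_bdd_borel) auto
    finally show "(\<integral>y. bump U k y \<partial>\<mu>) \<le> M U" .
  qed
  then have eq_f: "\<Lambda> f = (\<integral>y. f y \<partial>\<mu>)" by (rule mean_eq_integral[OF \<mu> _ f])
  have lim_abs: "((\<lambda>t. \<bar>Q t f x - (\<integral>y. f y \<partial>\<mu>)\<bar>) \<longlongrightarrow> \<bar>\<Lambda> f - (\<integral>y. f y \<partial>\<mu>)\<bar>) G"
    unfolding Q_def by (intro tendsto_intros conv bcontinuous_bdd_borel f)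
  have "\<forall>\<^sub>F t in G. e \<le> \<bar>Q t f x - (\<integral>y. f y \<partial>\<mu>)\<bar>"
    by (rule filter_leD[OF \<Lambda>(2)]) (simp add: F_def eventually_inf_principal)
  then have "e \<le> \<bar>\<Lambda> f - (\<integral>y. f y \<partial>\<mu>)\<bar>" by (rule tendsto_lowerbound[OF lim_abs _ \<open>G \<noteq> bot\<close>])
  with e(1) eq_f show False by simp
qed

text \<open>Every invariant measure is the limit of the same averages, which gives uniqueness. A
  general start \<open>\<nu>\<close> follows by integrating the pointwise limits against
  \<open>\<nu>\<close>.\<close>

lemma (in mfeller) mean_ergodicI:
  assumes merge: "\<And>f x. blipschitz f \<Longrightarrow> (\<lambda>n. Q (real n) f x - Q (real n) f z) \<longlonglongrightarrow> 0"
    and inv: "invariant K \<mu>"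
  shows "weak_star_mean_ergodic K"
  unfolding weak_star_mean_ergodic_def
proof (intro conjI allI impI ex1I)
  show "invariant K \<mu>" by fact
  fix \<nu> assume \<nu>: "invariant K \<nu>"
  show "\<nu> = \<mu>"
  proof (rule borel_prob_eqI)
    show "(\<integral>x. f x \<partial>\<nu>) = (\<integral>x. f x \<partial>\<mu>)" if "blipschitz f" for f
      using averages_tendsto_invariant[OF merge \<nu> that] averages_tendsto_invariant[OF merge inv that]
      by (rule tendsto_unique[OF trivial_limit_at_top_linorder])
  qed (use inv \<nu> in \<open>auto simp: invariant_def\<close>)
next
  fix \<mu> \<nu> :: "'a measure" and f :: "'a \<Rightarrow> real" assume inv: "invariant K \<mu>" and \<nu>: "borel_prob \<nu>" and f: "bcontinuous f"
  have fb: "f \<in> bdd_borel" using f by (rule bcontinuous_bdd_borel)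
  obtain B where B: "\<And>x. \<bar>f x\<bar> \<le> B" using fb by (meson bdd_borelE)
  have \<mu>: "borel_prob \<mu>" using inv by (simp add: invariant_def)
  have lim: "((\<lambda>t. Q t f x) \<longlongrightarrow> (\<integral>y. f y \<partial>\<mu>)) at_top" for x
    by (rule averages_tendsto_bcontinuous[OF \<mu> averages_tendsto_invariant[OF merge inv] f])
  interpret \<nu>: prob_space \<nu> using \<nu> by (simp add: borel_prob_def)
  have "((\<lambda>t. \<integral>x. Q t f x \<partial>\<nu>) \<longlongrightarrow> (\<integral>x. (\<integral>y. f y \<partial>\<mu>) \<partial>\<nu>)) at_top"
  proof (rule integral_dominated_convergence_at_top[where w="\<lambda>_. B"])
    show "Q t f \<in> borel_measurable \<nu>" for t
      using bdd_borel_measurable[OF Q_bdd_borel[OF fb]] \<nu> by (simp add: borel_prob_def cong: measurable_cong_sets)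
  qed (use lim Q_abs_le[OF fb B] in auto)
  then have "((\<lambda>t. \<integral>x. Q t f x \<partial>\<nu>) \<longlongrightarrow> (\<integral>y. f y \<partial>\<mu>)) at_top" using \<nu>.prob_space by simp
  then show "((\<lambda>t. Qnu K t \<nu> f) \<longlongrightarrow> (\<integral>y. f y \<partial>\<mu>)) at_top"
    by (rule Lim_transform_eventually)
      (rule eventually_mono[OF eventually_gt_at_top[of 0]], simp add: Qnu_eq[OF _ \<nu> fb])
qed

section \<open>Necessity of the two conditions\<close>

lemma borel_prob_support_nonempty:
  fixes \<mu> :: "'a::polish_space measure"
  assumes "borel_prob \<mu>"
  obtains z where "\<And>\<epsilon>. \<epsilon> > 0 \<Longrightarrow> measure \<mu> (ball z \<epsilon>) > 0"
proof (rule ccontr)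
  assume no: "\<not> thesis"
  interpret prob_space \<mu> using assms by (simp add: borel_prob_def)
  have sets: "sets \<mu> = sets borel" using assms by (simp add: borel_prob_def)
  have "\<exists>r>0. measure \<mu> (ball z r) = 0" for z
    using no that[of z] by (metis measure_nonneg order_le_less)
  then obtain r where r: "\<And>z. r z > 0" "\<And>z. measure \<mu> (ball z (r z)) = 0" by metis
  obtain \<F> where \<F>: "\<F> \<subseteq> range (\<lambda>z. ball z (r z))" "countable \<F>" "\<Union>\<F> = (\<Union>z. ball z (r z))"
    using Lindelof[of "range (\<lambda>z. ball z (r z))"] by auto
  have "(\<Union>z. ball z (r z)) = UNIV" using r(1) by auto
  moreover have "\<Union>\<F> \<in> null_sets \<mu>"
    using \<F>(1,2) r(2) sets by (intro null_sets_UN'[of \<F> "\<lambda>x. x", simplified]) (auto simp: null_sets_def emeasure_eq_measure)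
  ultimately have "emeasure \<mu> UNIV = 0" using \<F>(3) by (simp add: null_sets_def)
  then show False using emeasure_space_1 borel_prob_space[OF assms] by simp
qed

text \<open>Under mean ergodicity the limit of \<open>Q t f x\<close> does not depend on
  \<open>x\<close>, so the inner limsup vanishes for every \<open>x\<close>. The point in the second
  claim lies in the support of the invariant measure.\<close>

lemma (in mfeller) mean_ergodicD:
  assumes "weak_star_mean_ergodic K"
  shows "cesaro_ev_cont K z"
    and "\<exists>z. \<forall>\<epsilon>>0. (INF x. Limsup at_top (\<lambda>t. ereal (Qx K t x (ball z \<epsilon>)))) > 0"
proof -
  obtain \<mu> where inv: "invariant K \<mu>" using assms by (auto simp: weak_star_mean_ergodic_def)
  have \<mu>: "borel_prob \<mu>" using inv by (simp add: invariant_def)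
  have lim: "((\<lambda>t. Q t f x) \<longlongrightarrow> (\<integral>y. f y \<partial>\<mu>)) at_top" if f: "blipschitz f" for f x
  proof -
    have fb: "bcontinuous f" "f \<in> bdd_borel" using f by (auto intro: bcontinuous_bdd_borel blipschitz_bcontinuous)
    have bp: "borel_prob (return borel x)" by (simp add: borel_prob_def prob_space_return)
    have "((\<lambda>t. Qnu K t (return borel x) f) \<longlongrightarrow> (\<integral>y. f y \<partial>\<mu>)) at_top"
      using assms inv fb bp by (simp add: weak_star_mean_ergodic_def)
    moreover have "Qnu K t (return borel x) f = Q t f x" if "t > 0" for t
      using Qnu_eq[OF that bp fb(2)] bdd_borel_measurable[OF Q_bdd_borel[OF fb(2)]] by (simp add: integral_return)
    ultimately show ?thesis
      by (rule Lim_transform_eventually[OF _ eventually_mono[OF eventually_gt_at_top[of 0]]])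
  qed
  show "cesaro_ev_cont K z"
    unfolding cesaro_ev_cont_def
  proof (intro allI impI)
    fix f :: "'a \<Rightarrow> real" assume f: "blipschitz f"
    then have fb: "f \<in> bdd_borel" by (auto intro: bcontinuous_bdd_borel blipschitz_bcontinuous)
    have "Limsup at_top (\<lambda>t. ereal \<bar>Qf K t f x - Qf K t f z\<bar>) = 0" for x
    proof (rule lim_imp_Limsup)
      have "((\<lambda>t. \<bar>Q t f x - Q t f z\<bar>) \<longlongrightarrow> 0) at_top"
        using tendsto_rabs_zero[OF tendsto_diff[OF lim[OF f, of x] lim[OF f, of z], simplified]] by simp
      then have "((\<lambda>t. \<bar>Qf K t f x - Qf K t f z\<bar>) \<longlongrightarrow> 0) at_top"
        by (rule Lim_transform_eventually)
          (rule eventually_mono[OF eventually_gt_at_top[of 0]], simp add: Q_eq_Qf[OF _ fb])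
      then show "((\<lambda>t. ereal \<bar>Qf K t f x - Qf K t f z\<bar>) \<longlongrightarrow> 0) at_top"
        unfolding zero_ereal_def by (rule tendsto_ereal)
    qed simp
    then show "Limsup (nhds z) (\<lambda>x. Limsup at_top (\<lambda>t. ereal \<bar>Qf K t f x - Qf K t f z\<bar>)) = 0"
      by (simp add: Limsup_const)
  qed
  obtain z where z: "\<And>\<epsilon>. \<epsilon> > 0 \<Longrightarrow> measure \<mu> (ball z \<epsilon>) > 0" using borel_prob_support_nonempty[OF \<mu>] by blast
  have "(INF x. Limsup at_top (\<lambda>t. ereal (Qx K t x (ball z \<epsilon>)))) > 0" if e: "\<epsilon> > 0" for \<epsilon>
  proof -
    have "\<forall>\<^sub>F k in sequentially. 0 < (\<integral>y. bump (ball z \<epsilon>) k y \<partial>\<mu>)"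
      using order_tendstoD(1)[OF integral_bump_tendsto[OF \<mu>, of "ball z \<epsilon>"] z[OF e]] by simp
    then obtain k where k: "0 < (\<integral>y. bump (ball z \<epsilon>) k y \<partial>\<mu>)" by (metis eventually_happens sequentially_bot)
    \<comment> \<open>Convergence is available for continuous functions only, so a bump under the
      indicator of the ball supplies a lower bound independent of \<open>x\<close>.\<close>
    let ?b = "bump (ball z \<epsilon>) k"
    have "ereal (\<integral>y. ?b y \<partial>\<mu>) \<le> Limsup at_top (\<lambda>t. ereal (Qx K t x (ball z \<epsilon>)))" for x
    proof -
      have "ereal (\<integral>y. ?b y \<partial>\<mu>) = Limsup at_top (\<lambda>t. ereal (Q t ?b x))"
        using lim[OF bump_blipschitz] by (intro lim_imp_Limsup[symmetric]) auto
      also have "\<dots> \<le> Limsup at_top (\<lambda>t. ereal (Qx K t x (ball z \<epsilon>)))"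
      proof (rule Limsup_mono)
        show "\<forall>\<^sub>F t in at_top. ereal (Q t ?b x) \<le> ereal (Qx K t x (ball z \<epsilon>))"
          using eventually_gt_at_top[of 0]
        proof eventually_elim
          case (elim t)
          have "Q t ?b x \<le> Q t (indicator (ball z \<epsilon>)) x"
            by (intro Q_mono bump_bdd_borel bump_le_indicator) auto
          also have "\<dots> = measure (Qm t x) (ball z \<epsilon>)"
            by (simp add: Q_def borel_prob_space[OF Qm_borel_prob])
          finally show ?case using elim by (simp add: Qx_eq_Qm)
        qed
      qed
      finally show ?thesis .
    qed
    then have "ereal (\<integral>y. ?b y \<partial>\<mu>) \<le> (INF x. Limsup at_top (\<lambda>t. ereal (Qx K t x (ball z \<epsilon>))))"
      by (intro INF_greatest) auto
    then show ?thesis using k by (metis ereal_less(2) less_le_trans)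
  qed
  then show "\<exists>z. \<forall>\<epsilon>>0. (INF x. Limsup at_top (\<lambda>t. ereal (Qx K t x (ball z \<epsilon>)))) > 0" by blast
qed

section \<open>Averages seen from a charged set\<close>

lemma (in mfeller) P_0: "f \<in> bdd_borel \<Longrightarrow> P 0 f = f"
  using mf bdd_borel_measurable[of f] by (auto simp: P_def markov_feller_def integral_return)

text \<open>Invariance is recorded at unit time because the weights below are built from the chain
  with kernel \<open>K 1\<close>.\<close>

locale inv_mean = mfeller K + fa_mean \<Lambda>
  for K :: "real \<Rightarrow> 'a::polish_space \<Rightarrow> 'a measure" and \<Lambda> :: "('a \<Rightarrow> real) \<Rightarrow> real" +
  assumes inv: "f \<in> bdd_borel \<Longrightarrow> \<Lambda> (P 1 f) = \<Lambda> f"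
begin

lemma inv_nat: "f \<in> bdd_borel \<Longrightarrow> \<Lambda> (P (real j) f) = \<Lambda> f"
proof (induction j)
  case (Suc j)
  have "P (real (Suc j)) f = P 1 (P (real j) f)"
    using P_P[of 1 "real j" f] Suc.prems by (auto simp: fun_eq_iff)
  with Suc show ?case by (simp add: inv P_bdd_borel)
qed (simp add: P_0)

text \<open>\<open>hit W k x\<close> is the probability that the chain with kernel \<open>K 1\<close> started at \<open>x\<close> is in \<open>W\<close> at one of the times \<open>0, \<dots>, k\<close>.\<close>
primrec hit :: "'a set \<Rightarrow> nat \<Rightarrow> 'a \<Rightarrow> real" where
  "hit W 0 = indicator W"
| "hit W (Suc k) = (\<lambda>x. max (indicator W x) (P 1 (hit W k) x))"

context
  fixes W :: "'a set"
  assumes W: "W \<in> sets borel"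
begin

lemma hit_bdd_borel: "hit W k \<in> bdd_borel"
  by (induction k) (use W in \<open>auto intro!: bdd_borel_max P_bdd_borel\<close>)

lemma hit_bounds: "0 \<le> hit W k x" "hit W k x \<le> 1"
proof -
  have "0 \<le> hit W k x \<and> hit W k x \<le> 1"
  proof (induction k arbitrary: x)
    case (Suc k)
    have "P 1 (hit W k) x \<le> 1"
      using P_mono[of 1 "hit W k" "\<lambda>_. 1" x] P_const[of 1 1 x] Suc hit_bdd_borel by simp
    then show ?case by (auto simp: indicator_def max_def)
  qed (auto simp: indicator_def)
  then show "0 \<le> hit W k x" "hit W k x \<le> 1" by auto
qed

lemma hit_on: "x \<in> W \<Longrightarrow> hit W k x = 1"
  using hit_bounds(2)[of k x] by (cases k) (auto simp: max_def)

lemma hit_off: "x \<notin> W \<Longrightarrow> hit W (Suc k) x = P 1 (hit W k) x"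
proof -
  assume "x \<notin> W"
  moreover have "0 \<le> P 1 (hit W k) x"
    using P_mono[of 1 "\<lambda>_. 0" "hit W k" x] P_const[of 1 0 x] hit_bounds hit_bdd_borel by simp
  ultimately show ?thesis by simp
qed

lemma hit_Suc: "hit W k x \<le> hit W (Suc k) x"
proof (induction k arbitrary: x)
  case (Suc k)
  have "P 1 (hit W k) x \<le> P 1 (hit W (Suc k)) x"
    by (intro P_mono hit_bdd_borel Suc) auto
  then show ?case unfolding hit.simps(2)[of W "Suc k"] hit.simps(2)[of W k, THEN fun_cong] by linarith
qed simp

lemma hit_mono: "k \<le> l \<Longrightarrow> hit W k x \<le> hit W l x"
  by (rule lift_Suc_mono_le[of "\<lambda>k. hit W k x"]) (rule hit_Suc)

text \<open>Hitting \<open>W\<close> during the times \<open>j, ..., j + k\<close> implies hitting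
  it during \<open>0, ..., k + j\<close>.\<close>

lemma P_nat_hit_le: "P (real j) (hit W k) x \<le> hit W (k + j) x"
proof (induction j arbitrary: x)
  case 0
  then show ?case by (simp add: P_0 hit_bdd_borel)
next
  case (Suc j)
  have "P (real (Suc j)) (hit W k) x = P 1 (P (real j) (hit W k)) x"
    using P_P[of 1 "real j" "hit W k" x] hit_bdd_borel by simp
  also have "\<dots> \<le> P 1 (hit W (k + j)) x"
    by (intro P_mono P_bdd_borel hit_bdd_borel Suc) auto
  also have "\<dots> \<le> hit W (k + Suc j) x" by simp
  finally show ?case .
qed

end

text \<open>A weight whose \<open>\<Lambda>\<close>-Dirichlet form under \<open>P j\<close> is small is almost invariant,
  since \<open>\<bar>e x - e y\<bar> \<le> \<rho>/2 + (e x - e y)\<^sup>2 / (2 \<rho>)\<close>.\<close>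
lemma weight_almost_invariant:
  assumes e: "e \<in> bdd_borel" and \<phi>: "\<phi> \<in> bdd_borel" "\<And>x. \<bar>\<phi> x\<bar> \<le> 1"
    and \<rho>: "\<rho> > 0" and form: "\<Lambda> (\<lambda>x. e x * (e x - P (real j) e x)) \<le> \<rho>\<^sup>2 / 2"
  shows "\<bar>\<Lambda> (\<lambda>x. e x * P (real j) \<phi> x) - \<Lambda> (\<lambda>x. e x * \<phi> x)\<bar> \<le> \<rho>"
proof -
  let ?P = "P (real j)"
  let ?e2 = "\<lambda>x. e x * e x"
  \<comment> \<open>The commutator of \<open>P j\<close> with multiplication by \<open>e\<close>.
    Invariance of \<Lambda> turns \<open>\<Lambda> d\<close> into exactly the difference to be
    bounded.\<close>
  define d where "d x = e x * ?P \<phi> x - ?P (\<lambda>y. e y * \<phi> y) x" for x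
  \<comment> \<open>This is \<open>\<rho>/2\<close> plus \<open>1/(2 * \<rho>)\<close> times the
    \<open>K j x\<close>-integral of \<open>(e x - e y)\<^sup>2\<close>, expanded. By invariance its
    mean is \<open>\<rho>/2\<close> plus the form divided by \<open>\<rho>\<close>, whence the bound
    \<open>\<rho>\<^sup>2 / 2\<close> on the form.\<close>
  define q where "q x = \<rho> / 2 + (1 / (2 * \<rho>)) * (?e2 x - (2 * (e x * ?P e x) - ?P ?e2 x))" for x
  have bb: "?P e \<in> bdd_borel" "?P \<phi> \<in> bdd_borel" "(\<lambda>y. e y * \<phi> y) \<in> bdd_borel" "?e2 \<in> bdd_borel" "?P ?e2 \<in> bdd_borel"
    "?P (\<lambda>y. e y * \<phi> y) \<in> bdd_borel" "(\<lambda>x. e x * ?P e x) \<in> bdd_borel" "(\<lambda>x. e x * ?P \<phi> x) \<in> bdd_borel"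
    using e \<phi> by (auto intro!: P_bdd_borel bdd_borel_mult)
  have d_b: "d \<in> bdd_borel" unfolding d_def[abs_def] by (intro bdd_borel_diff bb)
  have q_b: "q \<in> bdd_borel" unfolding q_def[abs_def] by (intro bdd_borel_diff bdd_borel_add bdd_borel_cmult bdd_borel_const bb)
  have "\<bar>d x\<bar> \<le> q x" for x
  proof -
    interpret prob_space "K (real j) x" using K_borel_prob[of "real j" x] by (simp add: borel_prob_def)
    note int = borel_prob_integrable[OF K_borel_prob[of "real j" x, simplified]]
    have "d x = (\<integral>y. e x * \<phi> y - e y * \<phi> y \<partial>K (real j) x)"
      unfolding d_def P_def using int[OF \<phi>(1)] int[OF bb(3)] by simp
    then have "\<bar>d x\<bar> \<le> (\<integral>y. \<bar>e x * \<phi> y - e y * \<phi> y\<bar> \<partial>K (real j) x)" by (simp add: integral_abs_bound)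
    also have "\<dots> \<le> (\<integral>y. \<rho> / 2 + (1 / (2 * \<rho>)) * (e x * e x - (2 * (e x * e y) - e y * e y)) \<partial>K (real j) x)"
    proof (intro integral_mono int bdd_borel_abs bdd_borel_diff bdd_borel_add bdd_borel_cmult bdd_borel_const bb e \<phi>)
      fix y
      have "\<bar>e x * \<phi> y - e y * \<phi> y\<bar> \<le> \<bar>e x - e y\<bar>"
        using \<phi>(2)[of y] mult_left_le[of "\<bar>\<phi> y\<bar>" "\<bar>e x - e y\<bar>"]
        by (simp add: left_diff_distrib[symmetric] abs_mult)
      also have "\<dots> \<le> \<rho> / 2 + (1 / (2 * \<rho>)) * (e x - e y)\<^sup>2"
      proof -
        have "0 \<le> (\<bar>e x - e y\<bar> - \<rho>)\<^sup>2" by simp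
        then have "2 * \<rho> * \<bar>e x - e y\<bar> \<le> \<rho>\<^sup>2 + (e x - e y)\<^sup>2" by (simp add: power2_diff algebra_simps)
        with \<rho> show ?thesis by (simp add: field_simps power2_eq_square)
      qed
      also have "(e x - e y)\<^sup>2 = e x * e x - (2 * (e x * e y) - e y * e y)" by (simp add: power2_eq_square algebra_simps)
      finally show "\<bar>e x * \<phi> y - e y * \<phi> y\<bar> \<le> \<rho> / 2 + (1 / (2 * \<rho>)) * (e x * e x - (2 * (e x * e y) - e y * e y))" .
    qed
    also have "\<dots> = q x"
      unfolding q_def P_def using int[OF e] int[OF bb(4)] prob_space
      by (simp add: borel_prob_space[OF K_borel_prob])
    finally show ?thesis .
  qed
  then have "\<Lambda> (\<lambda>x. \<bar>d x\<bar>) \<le> \<Lambda> q" by (intro mono bdd_borel_abs d_b q_b)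
  then have "\<bar>\<Lambda> d\<bar> \<le> \<Lambda> q" using abs_le[OF d_b] by linarith
  moreover have "\<Lambda> d = \<Lambda> (\<lambda>x. e x * ?P \<phi> x) - \<Lambda> (\<lambda>x. e x * \<phi> x)"
    unfolding d_def[abs_def] using bb inv_nat[OF bb(3)] by (simp add: diff)
  moreover have "\<Lambda> q \<le> \<rho>"
  proof -
    have "\<Lambda> q = \<rho> / 2 + (1 / (2 * \<rho>)) * (\<Lambda> ?e2 - (2 * \<Lambda> (\<lambda>x. e x * ?P e x) - \<Lambda> ?e2))"
      unfolding q_def[abs_def] using bb inv_nat[OF bb(4), of j]
      by (simp only: add diff scale const bdd_borel_const bdd_borel_diff bdd_borel_cmult)
    also have "\<dots> = \<rho> / 2 + (1 / \<rho>) * \<Lambda> (\<lambda>x. e x * (e x - ?P e x))"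
      using bb \<rho> by (simp add: right_diff_distrib diff field_simps)
    also have "\<dots> \<le> \<rho> / 2 + (1 / \<rho>) * (\<rho>\<^sup>2 / 2)"
      using form \<rho> by (intro add_left_mono mult_left_mono) auto
    also have "\<dots> = \<rho>" using \<rho> by (simp add: power2_eq_square)
    finally show ?thesis .
  qed
  ultimately show ?thesis by simp
qed

text \<open>The integrand is at most \<open>hit W (m + j) - P j (hit W m)\<close>, and invariance
  makes its mean the gain in hitting mass from \<open>m\<close> to \<open>m + j\<close>. That gain
  is small once \<open>m\<close> is nearly optimal.\<close>

lemma hit_form_small:
  assumes W: "W \<in> sets borel" and sup: "\<And>k. \<Lambda> (hit W k) \<le> \<Lambda> (hit W m) + c"
  shows "\<Lambda> (\<lambda>x. hit W m x * (hit W m x - P (real j) (hit W m) x)) \<le> c"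
proof -
  have bb: "hit W k \<in> bdd_borel" "P (real j) (hit W k) \<in> bdd_borel" for k
    by (auto intro!: P_bdd_borel hit_bdd_borel[OF W])
  have "\<Lambda> (\<lambda>x. hit W m x * (hit W m x - P (real j) (hit W m) x)) \<le> \<Lambda> (\<lambda>x. hit W (m + j) x - P (real j) (hit W m) x)"
  proof (intro mono bdd_borel_mult bdd_borel_diff bb)
    fix x
    have "hit W m x * (hit W m x - P (real j) (hit W m) x) \<le> hit W m x * (hit W (m + j) x - P (real j) (hit W m) x)"
      using hit_mono[OF W, of m "m + j" x] hit_bounds[OF W] by (intro mult_left_mono) auto
    also have "\<dots> \<le> 1 * (hit W (m + j) x - P (real j) (hit W m) x)"
      using P_nat_hit_le[OF W, of j m x] hit_bounds[OF W] by (intro mult_right_mono) auto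
    finally show "hit W m x * (hit W m x - P (real j) (hit W m) x) \<le> hit W (m + j) x - P (real j) (hit W m) x" by simp
  qed
  also have "\<dots> = \<Lambda> (hit W (m + j)) - \<Lambda> (hit W m)" using bb by (simp add: diff inv_nat)
  finally show ?thesis using sup[of "m + j"] by simp
qed

text \<open>If \<open>Q n f\<close> is almost constant on a set \<open>W\<close> that \<open>\<Lambda>\<close> charges, then along trajectories it stays so until \<open>W\<close> is hit,
  so \<open>\<Lambda> (e * Q n f)\<close> with \<open>e\<close> a hitting probability is close to \<open>Q n f z * \<Lambda> e\<close>, and it hardly depends on \<open>n\<close>.\<close>
lemma averages_almost_constant:
  assumes W: "W \<in> sets borel" and pos: "M W > 0" and \<eta>: "\<eta> > 0"
  obtains N1 where "N1 \<ge> N0" "N1 > 0"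
    "\<And>f N. f \<in> bdd_borel \<Longrightarrow> (\<And>x. 0 \<le> f x) \<Longrightarrow> (\<And>x. f x \<le> 1) \<Longrightarrow>
       (\<And>n x. n \<ge> N0 \<Longrightarrow> x \<in> W \<Longrightarrow> \<bar>Q (real n) f x - Q (real n) f z\<bar> \<le> \<eta>) \<Longrightarrow> N \<ge> N1 \<Longrightarrow>
       \<bar>Q (real N) f z - Q (real N1) f z\<bar> \<le> 4 * \<eta>"
proof -
  \<comment> \<open>The final error is \<open>2 * (\<eta> * \<Lambda> e + 4 * \<kappa>)\<close>; as
    \<open>M W \<le> \<Lambda> e\<close>, this choice makes it at most
    \<open>4 * \<eta> * \<Lambda> e\<close>.\<close>
  define \<kappa> where "\<kappa> = \<eta> * M W / 4"
  have \<kappa>: "\<kappa> > 0" using pos \<eta> by (simp add: \<kappa>_def)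
  note hb = hit_bdd_borel[OF W] and h01 = hit_bounds[OF W]
  define L where "L = (SUP k. \<Lambda> (hit W k))"
  have bdd: "bdd_above (range (\<lambda>k. \<Lambda> (hit W k)))"
    by (intro bdd_aboveI2[of _ _ 1] le_const hb h01)
  have leL: "\<Lambda> (hit W k) \<le> L" for k unfolding L_def by (intro cSUP_upper bdd) auto
  have exL: "\<exists>k. \<forall>m\<ge>k. L - c \<le> \<Lambda> (hit W m)" if "c > 0" for c
  proof -
    have "\<exists>k. L - c < \<Lambda> (hit W k)"
      using less_cSUP_iff[OF _ bdd, of "L - c"] that unfolding L_def by auto
    then obtain k where "L - c < \<Lambda> (hit W k)" by blast
    moreover have "\<Lambda> (hit W k) \<le> \<Lambda> (hit W m)" if "m \<ge> k" for m
      using that by (intro mono hb hit_mono[OF W])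
    ultimately show ?thesis by (intro exI[of _ k]) fastforce
  qed
  obtain n where n: "\<And>m. m \<ge> n \<Longrightarrow> L - \<kappa> \<le> \<Lambda> (hit W m)" using exL[OF \<kappa>] by blast
  \<comment> \<open>The order of choices matters: \<open>n\<close> comes from \<kappa>, \<rho>
    depends on \<open>n\<close> so that \<open>n\<close> steps cost at most \<kappa>, and only
    afterwards is \<open>m\<close> chosen to match \<rho>.\<close>
  define \<rho> where "\<rho> = \<kappa> / real (Suc n)"
  have \<rho>: "\<rho> > 0" "\<rho> \<le> \<kappa>" "real n * \<rho> \<le> \<kappa>"
    using \<kappa> by (auto simp: \<rho>_def field_simps)
  obtain m0 where m0: "\<And>m. m \<ge> m0 \<Longrightarrow> L - \<rho>\<^sup>2 / 2 \<le> \<Lambda> (hit W m)"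
    using exL[of "\<rho>\<^sup>2 / 2"] \<rho> by auto
  define m where "m = max n m0"
  define e where "e = hit W m"
  have e: "e \<in> bdd_borel" "0 \<le> e x" "e x \<le> 1" for x unfolding e_def using hb h01 by auto
  have e_lam: "M W \<le> \<Lambda> e"
    unfolding e_def using hit_mono[OF W, of 0 m] W by (intro mono hb bdd_borel_indicator) auto
  have form: "\<Lambda> (\<lambda>x. e x * (e x - P (real j) e x)) \<le> \<rho>\<^sup>2 / 2" for j
    unfolding e_def
  proof (rule hit_form_small[OF W])
    show "\<Lambda> (hit W k) \<le> \<Lambda> (hit W m) + \<rho>\<^sup>2 / 2" for k using m0[of m] leL[of k] by (simp add: m_def)
  qed
  have inv_e: "\<bar>\<Lambda> (\<lambda>x. e x * P (real j) \<phi> x) - \<Lambda> (\<lambda>x. e x * \<phi> x)\<bar> \<le> \<rho>"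
    if "\<phi> \<in> bdd_borel" "\<And>x. \<bar>\<phi> x\<bar> \<le> 1" for \<phi> j
    by (rule weight_almost_invariant[OF e(1) that \<rho>(1) form])
  \<comment> \<open>On \<open>W\<close> the weight is \<open>1\<close>, and each further step back
    in time costs one use of almost invariance, that is \<rho>.\<close>
  have hit_e: "\<Lambda> (\<lambda>x. hit W k x * (1 - e x)) \<le> real k * \<rho>" for k
  proof (induction k)
    case 0
    have "(\<lambda>x. hit W 0 x * (1 - e x)) = (\<lambda>_. 0)"
      by (auto simp: fun_eq_iff indicator_def e_def hit_on[OF W])
    then show ?case by (simp add: const)
  next
    case (Suc k)
    have Pb: "P 1 (hit W k) \<in> bdd_borel" by (intro P_bdd_borel hb) auto
    have "\<Lambda> (\<lambda>x. hit W (Suc k) x * (1 - e x)) \<le> \<Lambda> (\<lambda>x. P 1 (hit W k) x - e x * P 1 (hit W k) x)"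
    proof (intro mono bdd_borel_mult bdd_borel_diff hb e Pb bdd_borel_const)
      fix x
      show "hit W (Suc k) x * (1 - e x) \<le> P 1 (hit W k) x - e x * P 1 (hit W k) x"
      proof (cases "x \<in> W")
        case True
        then show ?thesis using hit_on[OF W] by (simp add: e_def)
      next
        case False
        then show ?thesis using hit_off[OF W False, of k] by (simp add: algebra_simps)
      qed
    qed
    also have "\<dots> = \<Lambda> (hit W k) - \<Lambda> (\<lambda>x. e x * P 1 (hit W k) x)"
      using Pb e hb by (simp add: diff inv bdd_borel_mult)
    also have "\<dots> \<le> \<Lambda> (hit W k) - \<Lambda> (\<lambda>x. e x * hit W k x) + \<rho>"
      using inv_e[OF hb, of k 1] h01[of k] by (auto simp: abs_le_iff)
    also have "\<dots> = \<Lambda> (\<lambda>x. hit W k x * (1 - e x)) + \<rho>"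
      using diff[OF hb bdd_borel_mult[OF e(1) hb], of k k] by (simp add: algebra_simps)
    finally show ?case using Suc by (simp add: algebra_simps)
  qed
  \<comment> \<open>In mean the weight is almost \<open>0\<close>-\<open>1\<close> valued: points
    that hit \<open>W\<close> within \<open>n\<close> steps mostly have weight near
    \<open>1\<close>, and later hits add at most \<kappa>.\<close>
  have e1e: "\<Lambda> (\<lambda>x. e x * (1 - e x)) \<le> 2 * \<kappa>"
  proof -
    have "\<Lambda> (\<lambda>x. e x * (1 - e x)) \<le> \<Lambda> (\<lambda>x. hit W n x * (1 - e x) + (e x - hit W n x))"
    proof (intro mono bdd_borel_mult bdd_borel_diff bdd_borel_add hb e bdd_borel_const)
      fix x
      have "(e x - hit W n x) * (1 - e x) \<le> (e x - hit W n x) * 1"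
        using e(2)[of x] hit_mono[OF W, of n m x] by (intro mult_left_mono) (auto simp: e_def m_def)
      then show "e x * (1 - e x) \<le> hit W n x * (1 - e x) + (e x - hit W n x)" by (simp add: algebra_simps)
    qed
    also have "\<dots> = \<Lambda> (\<lambda>x. hit W n x * (1 - e x)) + (\<Lambda> e - \<Lambda> (hit W n))"
      using e hb by (simp add: add diff bdd_borel_mult bdd_borel_diff)
    also have "\<dots> \<le> real n * \<rho> + \<kappa>"
      using hit_e[of n] n[of n] leL[of m] by (simp add: e_def)
    finally show ?thesis using \<rho>(3) by simp
  qed
  obtain N2 :: nat where N2: "real N2 > 2 * real m / \<kappa>" using reals_Archimedean2 by blast
  \<comment> \<open>\<open>N1\<close> is fixed before any \<open>f\<close> is considered. The choice
    of \<open>N2\<close> keeps the drift \<open>2 * m / N\<close> accumulated over \<open>m\<close>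
    steps below \<kappa>.\<close>
  define N1 where "N1 = max (max N0 1) N2"
  have N1: "N1 \<ge> N0" "N1 > 0" "N1 \<ge> N2" by (auto simp: N1_def)
  \<comment> \<open>The comparison value \<open>\<Lambda> (\<lambda>x. e x * Q 1 f x)\<close> is
    free of \<open>N\<close>, so two times can be compared through it. The error
    \<open>4 * \<kappa>\<close> is \<open>2 * \<kappa>\<close> from \<open>e1e\<close>, \<kappa>
    from the drift and \<kappa> from almost invariance.\<close>
  have key: "\<bar>Q (real N) f z * \<Lambda> e - \<Lambda> (\<lambda>x. e x * Q 1 f x)\<bar> \<le> \<eta> * \<Lambda> e + 4 * \<kappa>"
    if f: "f \<in> bdd_borel" "\<And>x. 0 \<le> f x" "\<And>x. f x \<le> 1"
      and unif: "\<And>n x. n \<ge> N0 \<Longrightarrow> x \<in> W \<Longrightarrow> \<bar>Q (real n) f x - Q (real n) f z\<bar> \<le> \<eta>"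
      and N: "N \<ge> N1" for f N
  proof -
    have f1: "\<bar>f x\<bar> \<le> 1" for x using f(2,3)[of x] by simp
    have Npos: "N > 0" using N N1 by simp
    have Q01: "0 \<le> Q t f x" "Q t f x \<le> 1" for t x
      unfolding Q_def using borel_prob_integral_ge[OF Qm_borel_prob f(1,2)] borel_prob_integral_le[OF Qm_borel_prob f(1,3)] by auto
    have mN: "2 * real m / real N \<le> \<kappa>"
    proof -
      have "2 * real m / \<kappa> \<le> real N" using N2 N N1 by linarith
      then show ?thesis using \<kappa> Npos by (simp add: field_simps)
    qed
    define \<phi> where "\<phi> x = \<bar>Q (real N) f x - Q (real N) f z\<bar>" for x
    have \<phi>b: "\<phi> \<in> bdd_borel" unfolding \<phi>_def[abs_def] by (intro bdd_borel_abs bdd_borel_diff Q_bdd_borel f bdd_borel_const)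
    have \<phi>1: "\<phi> x \<le> 1" for x using Q01[of "real N" x] Q01[of "real N" z] by (auto simp: \<phi>_def abs_if)
    have \<phi>P: "\<phi> x \<le> P 1 \<phi> x + 2 / real N" for x
    proof -
      have "\<bar>P 1 (Q (real N) f) x - Q (real N) f x\<bar> \<le> 2 / real N"
        using P_Q_close[of "real N" 1 f 1 x] Npos f f1 by simp
      moreover have "\<bar>P 1 (Q (real N) f) x - Q (real N) f z\<bar> \<le> P 1 \<phi> x"
      proof -
        have "P 1 (Q (real N) f) x - Q (real N) f z = P 1 (\<lambda>y. Q (real N) f y - Q (real N) f z) x"
          using P_diff[of 1 "Q (real N) f" "\<lambda>_. Q (real N) f z" x] P_const[of 1 _ x] Q_bdd_borel[OF f(1)] by simp
        then show ?thesis unfolding \<phi>_def[abs_def] P_def by (simp add: integral_abs_bound)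
      qed
      ultimately show ?thesis unfolding \<phi>_def by linarith
    qed
    \<comment> \<open>On \<open>W\<close> the deviation is at most \<eta>; off \<open>W\<close> one
      step of the chain costs \<open>2 / N\<close>; trajectories that miss \<open>W\<close> are
      charged the trivial bound \<open>1\<close>.\<close>
    have \<phi>hit: "\<phi> x \<le> \<eta> + (1 - hit W k x) + 2 * real k / real N" for k x
    proof (induction k arbitrary: x)
      case 0
      show ?case
      proof (cases "x \<in> W")
        case True
        then show ?thesis using unif[of N x] N N1 by (simp add: \<phi>_def)
      qed (use \<phi>1[of x] \<eta> in simp)
    next
      case (Suc k)
      show ?case
      proof (cases "x \<in> W")
        case True
        then have "\<phi> x \<le> \<eta>" using unif[of N x] N N1 by (simp add: \<phi>_def)
        then show ?thesis using hit_on[OF W True, of "Suc k"] by (simp add: add_increasing2)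
      next
        case False
        have "\<phi> x \<le> P 1 \<phi> x + 2 / real N" by (rule \<phi>P)
        also have "P 1 \<phi> x \<le> P 1 (\<lambda>x. (\<eta> + 1 + 2 * real k / real N) - hit W k x) x"
          using Suc by (intro P_mono \<phi>b bdd_borel_diff bdd_borel_const hb) (auto simp: algebra_simps)
        also have "\<dots> = (\<eta> + 1 + 2 * real k / real N) - P 1 (hit W k) x"
          using hb by (simp add: P_diff P_const)
        finally show ?thesis using hit_off[OF W False, of k] by (simp add: add_divide_distrib algebra_simps)
      qed
    qed
    have ephi: "\<Lambda> (\<lambda>x. e x * \<phi> x) \<le> \<eta> * \<Lambda> e + 3 * \<kappa>"
    proof -
      have "\<Lambda> (\<lambda>x. e x * \<phi> x) \<le> \<Lambda> (\<lambda>x. (\<eta> * e x + e x * (1 - e x)) + \<kappa>)"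
      proof (intro mono bdd_borel_mult bdd_borel_diff bdd_borel_add \<phi>b e bdd_borel_const)
        fix x
        have "\<phi> x \<le> \<eta> + (1 - e x) + \<kappa>" using \<phi>hit[of x m] mN by (simp add: e_def)
        then have "e x * \<phi> x \<le> e x * (\<eta> + (1 - e x) + \<kappa>)" using e(2) by (rule mult_left_mono)
        also have "\<dots> \<le> (\<eta> * e x + e x * (1 - e x)) + \<kappa>"
          using mult_left_le[of "e x" \<kappa>] e(3)[of x] \<kappa> by (simp add: algebra_simps)
        finally show "e x * \<phi> x \<le> (\<eta> * e x + e x * (1 - e x)) + \<kappa>" .
      qed
      also have "\<dots> = (\<eta> * \<Lambda> e + \<Lambda> (\<lambda>x. e x * (1 - e x))) + \<kappa>"
        using e(1) by (simp only: add scale const bdd_borel_const bdd_borel_diff bdd_borel_cmult bdd_borel_mult bdd_borel_add)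
      finally show ?thesis using e1e by simp
    qed
    have b: "(\<lambda>x. e x * Q (real N) f x) \<in> bdd_borel" by (intro bdd_borel_mult e Q_bdd_borel f)
    have "\<bar>\<Lambda> (\<lambda>x. e x * Q (real N) f x) - Q (real N) f z * \<Lambda> e\<bar> \<le> \<Lambda> (\<lambda>x. e x * \<phi> x)"
    proof -
      have "\<bar>\<Lambda> (\<lambda>x. e x * Q (real N) f x) - Q (real N) f z * \<Lambda> e\<bar> = \<bar>\<Lambda> (\<lambda>x. e x * Q (real N) f x - Q (real N) f z * e x)\<bar>"
        using b e(1) by (simp add: diff scale bdd_borel_cmult)
      also have "\<dots> \<le> \<Lambda> (\<lambda>x. \<bar>e x * Q (real N) f x - Q (real N) f z * e x\<bar>)"
        by (intro abs_le bdd_borel_diff b bdd_borel_cmult e)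
      also have "(\<lambda>x. \<bar>e x * Q (real N) f x - Q (real N) f z * e x\<bar>) = (\<lambda>x. e x * \<phi> x)"
      proof
        fix x
        have "e x * Q (real N) f x - Q (real N) f z * e x = e x * (Q (real N) f x - Q (real N) f z)" by (simp add: algebra_simps)
        then show "\<bar>e x * Q (real N) f x - Q (real N) f z * e x\<bar> = e x * \<phi> x"
          using e(2)[of x] by (simp add: \<phi>_def abs_mult)
      qed
      finally show ?thesis .
    qed
    \<comment> \<open>By \<open>Q_nat_eq_sum\<close> the left mean is an average over
      \<open>j < N\<close> of weighted means of \<open>P j (Q 1 f)\<close>, each within \<rho> of
      the term \<open>j = 0\<close>.\<close>
    moreover have "\<bar>\<Lambda> (\<lambda>x. e x * Q (real N) f x) - \<Lambda> (\<lambda>x. e x * Q 1 f x)\<bar> \<le> \<rho>"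
    proof -
      have Pb: "(\<lambda>x. e x * P (real j) (Q 1 f) x) \<in> bdd_borel" for j by (intro bdd_borel_mult e P_bdd_borel Q_bdd_borel f) auto
      have "(\<lambda>x. e x * Q (real N) f x) = (\<lambda>x. (1 / real N) * (\<Sum>j<N. e x * P (real j) (Q 1 f) x))"
        using Q_nat_eq_sum[OF Npos f(1)] by (auto simp: fun_eq_iff sum_distrib_left)
      then have avg: "\<Lambda> (\<lambda>x. e x * Q (real N) f x) = (1 / real N) * (\<Sum>j<N. \<Lambda> (\<lambda>x. e x * P (real j) (Q 1 f) x))"
        using Pb by (simp only: scale bdd_borel_sum sum)
      have "\<Lambda> (\<lambda>x. e x * Q (real N) f x) - \<Lambda> (\<lambda>x. e x * Q 1 f x) = (1 / real N) * (\<Sum>j<N. \<Lambda> (\<lambda>x. e x * P (real j) (Q 1 f) x) - \<Lambda> (\<lambda>x. e x * Q 1 f x))"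
        unfolding avg using Npos by (simp add: sum_subtractf field_simps)
      then have "\<bar>\<Lambda> (\<lambda>x. e x * Q (real N) f x) - \<Lambda> (\<lambda>x. e x * Q 1 f x)\<bar>
          = (1 / real N) * \<bar>\<Sum>j<N. \<Lambda> (\<lambda>x. e x * P (real j) (Q 1 f) x) - \<Lambda> (\<lambda>x. e x * Q 1 f x)\<bar>"
        by (simp add: abs_mult)
      also have "\<dots> \<le> (1 / real N) * (\<Sum>j<N. \<rho>)"
        using Q01 by (intro mult_left_mono order_trans[OF sum_abs sum_mono] inv_e Q_bdd_borel f) auto
      also have "\<dots> = \<rho>" using Npos by simp
      finally show ?thesis .
    qed
    ultimately show ?thesis using ephi \<rho>(2) by linarith
  qed
  show thesis
  proof (rule that[OF N1(1,2)])
    fix f N assume f: "f \<in> bdd_borel" "\<And>x. 0 \<le> f x" "\<And>x. f x \<le> 1"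
      and unif: "\<And>n x. n \<ge> N0 \<Longrightarrow> x \<in> W \<Longrightarrow> \<bar>Q (real n) f x - Q (real n) f z\<bar> \<le> \<eta>" and N: "N \<ge> N1"
    have "\<bar>Q (real N) f z * \<Lambda> e - Q (real N1) f z * \<Lambda> e\<bar> \<le> 2 * (\<eta> * \<Lambda> e + 4 * \<kappa>)"
    proof -
      have "\<bar>Q (real n) f z * \<Lambda> e - \<Lambda> (\<lambda>x. e x * Q 1 f x)\<bar> \<le> \<eta> * \<Lambda> e + 4 * \<kappa>" if "n \<ge> N1" for n
        by (rule key[OF f _ that]) (use unif in auto)
      moreover have "\<bar>a - b\<bar> \<le> 2 * c" if "\<bar>a - r\<bar> \<le> c" "\<bar>b - r\<bar> \<le> c" for a b c r :: real
        using that by linarith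
      ultimately show ?thesis using N by blast
    qed
    also have "\<dots> \<le> 4 * \<eta> * \<Lambda> e"
      using mult_left_mono[OF e_lam, of \<eta>] \<eta> by (simp add: \<kappa>_def)
    finally have "\<bar>Q (real N) f z - Q (real N1) f z\<bar> * \<Lambda> e \<le> 4 * \<eta> * \<Lambda> e"
      using e_lam pos by (simp add: left_diff_distrib[symmetric] abs_mult)
    then show "\<bar>Q (real N) f z - Q (real N1) f z\<bar> \<le> 4 * \<eta>" using e_lam pos by simp
  qed
qed

end

section \<open>A Baire category argument\<close>

definition Lip01 :: "real \<Rightarrow> ('a::metric_space \<Rightarrow> real) set" where
  "Lip01 L = {f. (\<forall>x. 0 \<le> f x \<and> f x \<le> 1) \<and> L-lipschitz_on UNIV f}"

lemma Lip01_blipschitz: "f \<in> Lip01 L \<Longrightarrow> blipschitz f"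
  unfolding blipschitz_def Lip01_def by (auto simp: bounded_iff intro: exI[of _ 1])

lemma Lip01_bdd_borel: "f \<in> Lip01 L \<Longrightarrow> f \<in> bdd_borel"
  by (intro bcontinuous_bdd_borel blipschitz_bcontinuous Lip01_blipschitz)

lemma tendsto_fun_iff:
  "((f :: 'i \<Rightarrow> 'a \<Rightarrow> 'b::topological_space) \<longlongrightarrow> l) F \<longleftrightarrow> (\<forall>i. ((\<lambda>c. f c i) \<longlongrightarrow> l i) F)"
  using limitin_componentwise[of "\<lambda>_. euclidean" UNIV f l F]
  by (simp add: euclidean_product_topology limitin_canonical_iff)

text \<open>A common Lipschitz constant spreads convergence from a dense sequence to every point.
  This makes the encoding by values on that sequence closed under limits.\<close>

lemma Lip01_limit:
  fixes d :: "nat \<Rightarrow> 'a::metric_space"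
  assumes dense: "\<And>x e. e > 0 \<Longrightarrow> \<exists>i. dist x (d i) < e"
    and F: "\<And>k. F k \<in> Lip01 L" and lim: "\<And>i. (\<lambda>k. F k (d i)) \<longlonglongrightarrow> a i"
  obtains f where "f \<in> Lip01 L" "\<And>i. f (d i) = a i" "\<And>x. (\<lambda>k. F k x) \<longlonglongrightarrow> f x"
proof -
  have L: "L \<ge> 0" using F[of 0] by (auto simp: Lip01_def dest: lipschitz_on_nonneg)
  have F_lip: "\<bar>F k x - F k y\<bar> \<le> L * dist x y" for k x y
    using F[of k] by (auto simp: Lip01_def dist_real_def dest: lipschitz_onD[of _ _ _ x y])
  have "convergent (\<lambda>k. F k x)" for x
  proof (rule Cauchy_convergent, rule metric_CauchyI)
    fix e :: real assume e: "e > 0"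
    then have "e / (4 * (L + 1)) > 0" using L by simp
    \<comment> \<open>\<open>L + 1\<close> instead of \<open>L\<close> keeps the denominator
      positive when \<open>L = 0\<close>.\<close>
    from dense[OF this, of x] obtain i where i: "dist x (d i) < e / (4 * (L + 1))" by blast
    then have "(L + 1) * dist x (d i) < e / 4" using L by (simp add: field_simps)
    moreover have "L * dist x (d i) \<le> (L + 1) * dist x (d i)" by (intro mult_right_mono) auto
    ultimately have i': "L * dist x (d i) < e / 4" by linarith
    have "Cauchy (\<lambda>k. F k (d i))" using lim by (intro LIMSEQ_imp_Cauchy)
    from metric_CauchyD[OF this, of "e/2"] e obtain K where K: "\<And>k l. k \<ge> K \<Longrightarrow> l \<ge> K \<Longrightarrow> \<bar>F k (d i) - F l (d i)\<bar> < e / 2"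
      by (auto simp: dist_real_def)
    have "\<bar>F k x - F l x\<bar> < e" if "k \<ge> K" "l \<ge> K" for k l
      using K[OF that] F_lip[of k x "d i"] F_lip[of l x "d i"] i' by linarith
    then show "\<exists>M. \<forall>m\<ge>M. \<forall>n\<ge>M. dist (F m x) (F n x) < e" by (auto simp: dist_real_def)
  qed
  then have conv: "(\<lambda>k. F k x) \<longlonglongrightarrow> lim (\<lambda>k. F k x)" for x by (simp add: convergent_LIMSEQ_iff)
  show thesis
  proof (rule that[of "\<lambda>x. lim (\<lambda>k. F k x)"])
    show "lim (\<lambda>k. F k (d i)) = a i" for i using LIMSEQ_unique[OF conv lim] .
    show "(\<lambda>x. lim (\<lambda>k. F k x)) \<in> Lip01 L"
      unfolding Lip01_def
    proof (intro CollectI conjI allI lipschitz_onI)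
      show "0 \<le> lim (\<lambda>k. F k x)" "lim (\<lambda>k. F k x) \<le> 1" for x
        using F by (auto simp: Lip01_def intro!: LIMSEQ_le_const[OF conv] LIMSEQ_le_const2[OF conv])
      show "dist (lim (\<lambda>k. F k x)) (lim (\<lambda>k. F k y)) \<le> L * dist x y" for x y
        by (rule LIMSEQ_le_const2[OF tendsto_dist[OF conv conv]]) (use F_lip in \<open>auto simp: dist_real_def\<close>)
    qed (rule L)
  qed (rule conv)
qed

text \<open>The functions \<open>sup\<^bsub>j \<ge> k\<^esub> \<bar>F j - f\<bar>\<close> are Lipschitz and decrease to \<open>0\<close>, which makes the convergence of \<open>Q t (F j)\<close> locally uniform.\<close>
lemma (in mfeller) Q_jointly_continuous:
  assumes t: "t > 0" and F: "\<And>k. F k \<in> Lip01 L" and f: "f \<in> Lip01 L"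
    and lim: "\<And>x. (\<lambda>k. F k x) \<longlonglongrightarrow> f x" and u: "u \<longlonglongrightarrow> y"
  shows "(\<lambda>k. Q t (F k) (u k)) \<longlonglongrightarrow> Q t f y"
proof -
  note fb = Lip01_bdd_borel[OF f] and Fb = Lip01_bdd_borel[OF F]
  have L: "L \<ge> 0" using f by (auto simp: Lip01_def dest: lipschitz_on_nonneg)
  define D where "D j x = \<bar>F j x - f x\<bar>" for j x
  have D01: "0 \<le> D j x" "D j x \<le> 1" for j x
    using F[of j] f by (auto simp: D_def Lip01_def abs_le_iff) (smt (verit, ccfv_SIG))+
  have D_lip: "\<bar>D j x - D j y\<bar> \<le> (2 * L) * dist x y" for j x y
  proof -
    have "\<bar>F j x - F j y\<bar> \<le> L * dist x y" "\<bar>f x - f y\<bar> \<le> L * dist x y"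
      using F[of j] f by (auto simp: Lip01_def dist_real_def dest: lipschitz_onD[of _ _ _ x y])
    then show ?thesis unfolding D_def by linarith
  qed
  \<comment> \<open>The supremum is again Lipschitz, with constant \<open>2 * L\<close>, hence
    continuous, so the Feller property applies to it.\<close>
  define S where "S k x = (SUP j\<in>{k..}. D j x)" for k x
  have bdd: "bdd_above ((\<lambda>j. D j x) ` {k..})" for k x using D01(2) by (intro bdd_aboveI2) auto
  have D_le: "D j x \<le> S k x" if "j \<ge> k" for j k x
    unfolding S_def using that by (intro cSUP_upper bdd) auto
  have S_le: "S k x \<le> c" if "\<And>j. j \<ge> k \<Longrightarrow> D j x \<le> c" for k x c
    unfolding S_def using that by (intro cSUP_least) auto
  have S01: "0 \<le> S k x" "S k x \<le> 1" for k x
    using S_le[of k x 1] D01 D_le[of k k x] by (auto intro: order_trans)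
  have "(2 * L)-lipschitz_on UNIV (S k)" for k
  proof (rule lipschitz_onI)
    have step: "S k x \<le> S k y + 2 * L * dist x y" for x y
    proof (rule S_le)
      fix j assume "j \<ge> k"
      then show "D j x \<le> S k y + 2 * L * dist x y" using D_lip[of j x y] D_le[of k j y] by linarith
    qed
    show "dist (S k x) (S k y) \<le> 2 * L * dist x y" for x y
      using step[of x y] step[of y x] by (auto simp: dist_real_def dist_commute abs_le_iff)
  qed (use L in simp)
  then have S_bc: "bcontinuous (S k)" for k
    using S01 by (intro blipschitz_bcontinuous) (auto simp: blipschitz_def bounded_iff intro: exI[of _ 1])
  note Sb = bcontinuous_bdd_borel[OF S_bc]
  have S_lim: "(\<lambda>k. S k x) \<longlonglongrightarrow> 0" for x
  proof (rule LIMSEQ_I)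
    fix e :: real assume e: "e > 0"
    have "(\<lambda>j. \<bar>F j x - f x\<bar>) \<longlonglongrightarrow> 0"
      using tendsto_rabs_zero[OF LIM_zero[OF lim[of x]]] by simp
    from LIMSEQ_D[OF this, of "e/2"] e obtain K where K: "\<And>j. j \<ge> K \<Longrightarrow> D j x \<le> e / 2"
      unfolding D_def by (auto intro: less_imp_le)
    have "norm (S k x - 0) < e" if "k \<ge> K" for k
      using S_le[of k x "e/2"] K that S01[of k x] e by simp
    then show "\<exists>no. \<forall>n\<ge>no. norm (S n x - 0) < e" by blast
  qed
  have "(\<lambda>k. Q t (S k) y) \<longlonglongrightarrow> (\<integral>x. 0 \<partial>Qm t y)"
    unfolding Q_def by (rule borel_prob_tendsto_integral[OF Qm_borel_prob Sb, where B=1]) (use S01 S_lim in auto)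
  then have QS: "(\<lambda>k. Q t (S k) y) \<longlonglongrightarrow> 0" by simp
  have cont: "(\<lambda>j. Q t h (u j)) \<longlonglongrightarrow> Q t h y" if "bcontinuous h" for h
    by (rule continuous_on_tendsto_compose[OF _ u, of UNIV]) (use Q_bcontinuous[OF t that] in \<open>auto simp: bcontinuous_def\<close>)
  have "(\<lambda>j. Q t (F j) (u j) - Q t f (u j)) \<longlonglongrightarrow> 0"
  proof (rule LIMSEQ_I)
    fix e :: real assume e: "e > 0"
    \<comment> \<open>A Dini-type step: \<open>k\<close> is chosen at the limit point
      \<open>y\<close>, and continuity of \<open>Q t (S k)\<close> carries the bound to
      \<open>u j\<close> for all large \<open>j\<close>, where \<open>D j \<le> S k\<close>.\<close>
    then obtain k where k: "Q t (S k) y < e"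
      using order_tendstoD(2)[OF QS e] by (auto simp: eventually_sequentially)
    then have "\<forall>\<^sub>F j in sequentially. Q t (S k) (u j) < e" by (rule order_tendstoD(2)[OF cont[OF S_bc]])
    moreover have "\<forall>\<^sub>F j in sequentially. j \<ge> k" by (rule eventually_ge_at_top)
    ultimately have "\<forall>\<^sub>F j in sequentially. norm (Q t (F j) (u j) - Q t f (u j) - 0) < e"
    proof eventually_elim
      case (elim j)
      have "\<bar>Q t (F j) (u j) - Q t f (u j)\<bar> = \<bar>Q t (\<lambda>x. F j x - f x) (u j)\<bar>"
        using Q_diff[OF Fb fb] by simp
      also have "\<dots> \<le> Q t (D j) (u j)" unfolding Q_def D_def[abs_def] by (rule integral_abs_bound)
      also have "\<dots> \<le> Q t (S k) (u j)"
        using elim D_le unfolding D_def[abs_def] by (intro Q_mono bdd_borel_abs bdd_borel_diff Fb fb Sb) auto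
      finally show ?case using elim by simp
    qed
    then show "\<exists>no. \<forall>j\<ge>no. norm (Q t (F j) (u j) - Q t f (u j) - 0) < e" by (simp add: eventually_sequentially)
  qed
  from tendsto_add[OF this cont[of f]] show ?thesis
    using blipschitz_bcontinuous[OF Lip01_blipschitz[OF f]] by simp
qed

text \<open>Lipschitz functions are encoded by their values on a dense sequence, so that pairs of a function and a point form a complete metric space.\<close>
lemma (in mfeller) averages_uniform_somewhere:
  fixes d :: "nat \<Rightarrow> 'a"
  assumes dense: "\<And>x e. e > 0 \<Longrightarrow> \<exists>i. dist x (d i) < e"
    and Y: "closed Y" "Y \<noteq> {}" and L: "L \<ge> 0" and \<eta>: "\<eta> > 0"
    and merge: "\<And>f x. blipschitz f \<Longrightarrow> (\<lambda>n. Q (real n) f x - Q (real n) f z) \<longlonglongrightarrow> 0"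
  obtains f0 y0 N A U where "f0 \<in> Lip01 L" "y0 \<in> Y" "open A" "f0 \<circ> d \<in> A" "open U" "y0 \<in> U"
    "\<And>f y n. f \<in> Lip01 L \<Longrightarrow> f \<circ> d \<in> A \<Longrightarrow> y \<in> U \<inter> Y \<Longrightarrow> n \<ge> N \<Longrightarrow> \<bar>Q (real n) f y - Q (real n) f z\<bar> \<le> \<eta>"
proof -
  \<comment> \<open>\<open>Suc N\<close> excludes \<open>n = 0\<close>: closedness of
    \<open>C N\<close> rests on joint continuity of the averages, which holds for positive
    time.\<close>
  define C where "C N = {(f \<circ> d, y) | f y. f \<in> Lip01 L \<and> y \<in> Y \<and> (\<forall>n\<ge>Suc N. \<bar>Q (real n) f y - Q (real n) f z\<bar> \<le> \<eta>)}" for N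
  define S where "S = {(f \<circ> d, y) | f y. f \<in> Lip01 L \<and> y \<in> Y}"
  have inj: "f = g" if fg: "f \<in> Lip01 L" "g \<in> Lip01 L" "f \<circ> d = g \<circ> d" for f g
  proof -
    have "f x = g x" for x
    proof (rule ccontr)
      assume "f x \<noteq> g x"
      then have "\<bar>f x - g x\<bar> / (2 * L + 1) > 0" using L by simp
      from dense[OF this, of x] obtain i where i: "dist x (d i) < \<bar>f x - g x\<bar> / (2 * L + 1)" by blast
      have "\<bar>f x - f (d i)\<bar> \<le> L * dist x (d i)" "\<bar>g x - g (d i)\<bar> \<le> L * dist x (d i)"
        using fg(1,2) by (auto simp: Lip01_def dist_real_def dest: lipschitz_onD[of _ _ _ x "d i"])
      moreover have "f (d i) = g (d i)" using fun_cong[OF fg(3), of i] by simp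
      moreover have "(2 * L + 1) * dist x (d i) = L * dist x (d i) + L * dist x (d i) + dist x (d i)"
        by (simp add: algebra_simps)
      ultimately have "\<bar>f x - g x\<bar> \<le> (2 * L + 1) * dist x (d i)"
        using zero_le_dist[of x "d i"] by linarith
      with i L show False by (simp add: field_simps)
    qed
    then show ?thesis ..
  qed
  have limit: "\<exists>f. f \<in> Lip01 L \<and> y \<in> Y \<and> a = f \<circ> d \<and> (\<forall>x. (\<lambda>k. F k x) \<longlonglongrightarrow> f x)"
    if FS: "\<And>k. F k \<in> Lip01 L" "\<And>k. u k \<in> Y" "(\<lambda>k. (F k \<circ> d, u k)) \<longlonglongrightarrow> (a, y)" for F u a y
  proof -
    have "(\<lambda>k. F k \<circ> d) \<longlonglongrightarrow> a" "u \<longlonglongrightarrow> y"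
      using tendsto_fst[OF FS(3)] tendsto_snd[OF FS(3)] by auto
    then have lim: "(\<lambda>k. F k (d i)) \<longlonglongrightarrow> a i" for i by (simp add: tendsto_fun_iff)
    obtain f where "f \<in> Lip01 L" "\<And>i. f (d i) = a i" "\<And>x. (\<lambda>k. F k x) \<longlonglongrightarrow> f x"
      using Lip01_limit[of d F L a, OF dense FS(1) lim] by blast
    moreover have "y \<in> Y" using closed_sequentially[OF Y(1) FS(2) \<open>u \<longlonglongrightarrow> y\<close>] .
    ultimately show ?thesis by (intro exI[of _ f]) auto
  qed
  have closed_S: "closed S"
    unfolding closed_sequential_limits
  proof (intro allI impI, elim conjE)
    fix v and l assume v: "\<forall>k. v k \<in> S" "v \<longlonglongrightarrow> l"
    have "\<forall>k. \<exists>f. f \<in> Lip01 L \<and> snd (v k) \<in> Y \<and> v k = (f \<circ> d, snd (v k))"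
    proof
      fix k
      obtain f y where "v k = (f \<circ> d, y)" "f \<in> Lip01 L" "y \<in> Y"
        using v(1)[rule_format, of k] unfolding S_def by blast
      then show "\<exists>f. f \<in> Lip01 L \<and> snd (v k) \<in> Y \<and> v k = (f \<circ> d, snd (v k))" by (intro exI[of _ f]) simp
    qed
    then obtain F where F: "\<And>k. F k \<in> Lip01 L" "\<And>k. snd (v k) \<in> Y" "\<And>k. v k = (F k \<circ> d, snd (v k))" by metis
    have "(\<lambda>k. (F k \<circ> d, snd (v k))) \<longlonglongrightarrow> (fst l, snd l)" using v(2) F(3) by simp
    from limit[OF F(1,2) this] show "l \<in> S" unfolding S_def by (metis (mono_tags, lifting) mem_Collect_eq prod.collapse)
  qed
  have closed_C: "closed (C N)" for N
    unfolding closed_sequential_limits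
  proof (intro allI impI, elim conjE)
    fix v and l assume v: "\<forall>k. v k \<in> C N" "v \<longlonglongrightarrow> l"
    have "\<forall>k. \<exists>f. f \<in> Lip01 L \<and> snd (v k) \<in> Y \<and> v k = (f \<circ> d, snd (v k)) \<and>
        (\<forall>n\<ge>Suc N. \<bar>Q (real n) f (snd (v k)) - Q (real n) f z\<bar> \<le> \<eta>)"
    proof
      fix k
      obtain f y where "v k = (f \<circ> d, y)" "f \<in> Lip01 L" "y \<in> Y"
          "\<forall>n\<ge>Suc N. \<bar>Q (real n) f y - Q (real n) f z\<bar> \<le> \<eta>"
        using v(1)[rule_format, of k] unfolding C_def by blast
      then show "\<exists>f. f \<in> Lip01 L \<and> snd (v k) \<in> Y \<and> v k = (f \<circ> d, snd (v k)) \<and>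
        (\<forall>n\<ge>Suc N. \<bar>Q (real n) f (snd (v k)) - Q (real n) f z\<bar> \<le> \<eta>)" by (intro exI[of _ f]) simp
    qed
    then obtain F where F: "\<And>k. F k \<in> Lip01 L" "\<And>k. snd (v k) \<in> Y" "\<And>k. v k = (F k \<circ> d, snd (v k))"
      "\<And>k n. n \<ge> Suc N \<Longrightarrow> \<bar>Q (real n) (F k) (snd (v k)) - Q (real n) (F k) z\<bar> \<le> \<eta>" by metis
    have "(\<lambda>k. (F k \<circ> d, snd (v k))) \<longlonglongrightarrow> (fst l, snd l)" using v(2) F(3) by simp
    from limit[OF F(1,2) this] obtain f where f: "f \<in> Lip01 L" "snd l \<in> Y" "fst l = f \<circ> d" "\<And>x. (\<lambda>k. F k x) \<longlonglongrightarrow> f x"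
      by blast
    have "\<bar>Q (real n) f (snd l) - Q (real n) f z\<bar> \<le> \<eta>" if n: "n \<ge> Suc N" for n
    proof (rule LIMSEQ_le_const2)
      have "real n > 0" using n by simp
      then show "(\<lambda>k. \<bar>Q (real n) (F k) (snd (v k)) - Q (real n) (F k) z\<bar>) \<longlonglongrightarrow> \<bar>Q (real n) f (snd l) - Q (real n) f z\<bar>"
        by (intro tendsto_intros Q_jointly_continuous[OF _ F(1) f(1) f(4)] tendsto_snd v(2))
    qed (use F(4)[OF n] in auto)
    moreover have "l = (f \<circ> d, snd l)" using f(3) by (metis prod.collapse)
    ultimately show "l \<in> C N" unfolding C_def using f(1,2) by blast
  qed
  have "S \<subseteq> (\<Union>N. C N)"
  proof
    fix p assume "p \<in> S"
    then obtain f y where fy: "p = (f \<circ> d, y)" "f \<in> Lip01 L" "y \<in> Y" by (auto simp: S_def)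
    from LIMSEQ_D[OF merge[OF Lip01_blipschitz[OF fy(2)], of y] \<eta>]
    obtain N where "\<And>n. n \<ge> N \<Longrightarrow> \<bar>Q (real n) f y - Q (real n) f z\<bar> < \<eta>" by auto
    then have "\<forall>n\<ge>Suc N. \<bar>Q (real n) f y - Q (real n) f z\<bar> \<le> \<eta>" by (meson Suc_leD less_imp_le)
    then have "p \<in> C N" unfolding C_def fy(1) using fy(2,3) by blast
    then show "p \<in> (\<Union>N. C N)" by blast
  qed
  moreover have CS: "C N \<subseteq> S" for N by (auto simp: C_def S_def)
  ultimately have UC: "(\<Union>N. C N) = S" by blast
  have "(\<lambda>_. 0) \<in> (Lip01 L :: ('a \<Rightarrow> real) set)" unfolding Lip01_def using const_lipschitz[OF L] by auto
  then have "S \<noteq> {}" using Y(2) by (auto simp: S_def)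
  \<comment> \<open>\<open>S\<close> is closed in the completely metrizable product of real
    sequences and points, hence Baire, and is covered by the countably many closed sets
    \<open>C N\<close>.\<close>
  have "\<exists>N. top_of_set S interior_of (C N) \<noteq> {}"
  proof (rule ccontr)
    assume no: "\<nexists>N. top_of_set S interior_of (C N) \<noteq> {}"
    have "top_of_set S interior_of \<Union>(range C) = {}"
    proof (rule Baire_category_alt)
      show "completely_metrizable_space (top_of_set S) \<or> locally_compact_space (top_of_set S) \<and> regular_space (top_of_set S)"
        using closed_S completely_metrizable_space_closedin[OF completely_metrizable_space_euclidean] by auto
      show "closedin (top_of_set S) T \<and> top_of_set S interior_of T = {}" if "T \<in> range C" for T
        using that no closed_subset[OF CS closed_C] by blast
    qed auto
    then show False using UC \<open>S \<noteq> {}\<close> interior_of_topspace[of "top_of_set S"] by simp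
  qed
  then obtain N p where p: "p \<in> top_of_set S interior_of (C N)" by blast
  then obtain V where V: "open V" "p \<in> V" "S \<inter> V \<subseteq> C N" "p \<in> S"
    unfolding interior_of_def openin_open by auto
  obtain f0 y0 where p0: "p = (f0 \<circ> d, y0)" "f0 \<in> Lip01 L" "y0 \<in> Y" using V(4) by (auto simp: S_def)
  obtain A U where AU: "open A" "open U" "p \<in> A \<times> U" "A \<times> U \<subseteq> V" by (rule open_prod_elim[OF V(1,2)])
  show thesis
  proof (rule that[of f0 y0 A U "Suc N"])
    fix f y n assume f: "f \<in> Lip01 L" "f \<circ> d \<in> A" "y \<in> U \<inter> Y" "n \<ge> Suc N"
    then have "(f \<circ> d, y) \<in> C N" using AU(4) V(3) by (fastforce simp: S_def)
    \<comment> \<open>Membership of the encoded pair in \<open>C N\<close> speaks of some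
      \<open>g\<close> with the same values on the dense sequence; by \<open>inj\<close> it is
      \<open>f\<close>.\<close>
    then obtain g where "g \<in> Lip01 L" "f \<circ> d = g \<circ> d" "\<bar>Q (real n) g y - Q (real n) g z\<bar> \<le> \<eta>"
      using f(4) by (auto simp: C_def)
    then show "\<bar>Q (real n) f y - Q (real n) f z\<bar> \<le> \<eta>" using inj[OF f(1)] by blast
  qed (use p0 AU in auto)
qed

text \<open>Averaging after \<open>P s\<close> or \<open>Q s\<close> changes \<open>Q t f z\<close>
  by order \<open>s / t\<close>, which vanishes along every filter finer than
  \<open>at_top\<close>.\<close>

lemma (in mfeller) cluster_invariant:
  assumes G: "G \<le> at_top" "G \<noteq> bot"
    and conv: "\<And>f. f \<in> bdd_borel \<Longrightarrow> ((\<lambda>t. Q t f z) \<longlongrightarrow> \<Lambda> f) G"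
    and f: "f \<in> bdd_borel"
  shows "s \<ge> 0 \<Longrightarrow> \<Lambda> (P s f) = \<Lambda> f" and "s > 0 \<Longrightarrow> \<Lambda> (Q s f) = \<Lambda> f"
proof -
  obtain B where B: "\<And>x. \<bar>f x\<bar> \<le> B" using f by (meson bdd_borelE)
  have *: "\<Lambda> g = \<Lambda> f" if g: "g \<in> bdd_borel" and close: "\<And>t. t > 0 \<Longrightarrow> \<bar>Q t g z - Q t f z\<bar> \<le> 2 * B * s / t" for g s
  proof -
    have "((\<lambda>t. 2 * B * s / t) \<longlongrightarrow> 0) G"
      by (rule tendsto_mono[OF G(1)]) (intro tendsto_divide_0[OF tendsto_const] filterlim_at_top_imp_at_infinity filterlim_ident)
    moreover have "\<forall>\<^sub>F t in G. norm (Q t g z - Q t f z) \<le> 2 * B * s / t"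
      by (rule filter_leD[OF G(1)]) (rule eventually_mono[OF eventually_gt_at_top[of 0]], use close in simp)
    ultimately have "((\<lambda>t. Q t g z - Q t f z) \<longlongrightarrow> 0) G" by (rule Lim_null_comparison[rotated])
    moreover have "((\<lambda>t. Q t g z - Q t f z) \<longlongrightarrow> \<Lambda> g - \<Lambda> f) G" by (intro tendsto_diff conv f g)
    ultimately show ?thesis using tendsto_unique[OF G(2)] by fastforce
  qed
  show "\<Lambda> (P s f) = \<Lambda> f" if "s \<ge> 0" for s
    by (rule *[of _ s]) (use that in \<open>auto intro: P_bdd_borel Q_P_close f B\<close>)
  show "\<Lambda> (Q s f) = \<Lambda> f" if "s > 0" for s
    by (rule *[of _ s]) (use that in \<open>auto intro: Q_bdd_borel Q_Q_close' f B\<close>)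
qed

section \<open>Tightness and conclusion\<close>

lemma dense_sequence_exists:
  obtains d :: "nat \<Rightarrow> 'a::polish_space" where "\<And>x e. e > 0 \<Longrightarrow> \<exists>i. dist x (d i) < e"
proof -
  obtain D :: "'a set" where D: "countable D" "\<And>X. open X \<Longrightarrow> X \<noteq> {} \<Longrightarrow> \<exists>d\<in>D. d \<in> X"
    using countable_dense_setE by blast
  have "D \<noteq> {}" using D(2)[of UNIV] by auto
  have "\<exists>i. dist x (from_nat_into D i) < e" if e: "e > 0" for x e
  proof -
    have "ball x e \<noteq> {}" using e by simp
    then obtain y where "y \<in> D" "y \<in> ball x e" using D(2)[OF open_ball] by blast
    then show ?thesis using from_nat_into_surj[OF D(1)] by (metis mem_ball)
  qed
  then show thesis by (rule that)
qed

text \<open>The common closed support of the averages started at \<open>z\<close>: the closure of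
  the union of the supports of \<open>Qm t z\<close> over \<open>t > 0\<close>.\<close>

definition (in mfeller) reachable :: "'a \<Rightarrow> 'a set" where
  "reachable z = {y. \<forall>r>0. \<exists>t>0. measure (Qm t z) (ball y r) > 0}"

lemma (in mfeller) closed_reachable: "closed (reachable z)"
  unfolding closed_sequential_limits
proof (intro allI impI, elim conjE)
  fix u y assume u: "\<forall>n. u n \<in> reachable z" "u \<longlonglongrightarrow> y"
  have "\<exists>t>0. measure (Qm t z) (ball y r) > 0" if r: "r > 0" for r
  proof -
    obtain n where n: "dist (u n) y < r / 2" using u(2) r by (metis LIMSEQ_iff_nz half_gt_zero metric_LIMSEQ_D order_refl)
    have "u n \<in> reachable z" "r / 2 > 0" using u(1) r by auto
    then obtain t where t: "t > 0" "measure (Qm t z) (ball (u n) (r / 2)) > 0" unfolding reachable_def by blast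
    interpret prob_space "Qm t z" using Qm_borel_prob[of t z] by (simp add: borel_prob_def)
    have "ball (u n) (r / 2) \<subseteq> ball y r"
    proof
      fix x assume "x \<in> ball (u n) (r / 2)"
      then show "x \<in> ball y r" using n dist_triangle[of y x "u n"] by (simp add: dist_commute)
    qed
    then have "measure (Qm t z) (ball (u n) (r / 2)) \<le> measure (Qm t z) (ball y r)"
      using Qm_borel_prob[of t z] by (intro finite_measure_mono) (auto simp: borel_prob_def)
    with t show ?thesis by (intro exI[of _ t]) auto
  qed
  then show "y \<in> reachable z" by (simp add: reachable_def)
qed

text \<open>The complement is covered by balls that are null for \<open>Qm t z\<close>; by Lindelof
  countably many suffice.\<close>

lemma (in mfeller) measure_reachable:
  assumes "t > 0"
  shows "measure (Qm t z) (reachable z) = 1"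
proof -
  interpret prob_space "Qm t z" using Qm_borel_prob[of t z] by (simp add: borel_prob_def)
  have sets: "sets (Qm t z) = sets borel" using Qm_borel_prob[of t z] by (simp add: borel_prob_def)
  have "\<exists>r>0. measure (Qm t z) (ball y r) = 0" if "y \<in> - reachable z" for y
  proof -
    have "\<not> (\<forall>r>0. \<exists>t>0. measure (Qm t z) (ball y r) > 0)" using that by (simp add: reachable_def)
    then obtain r where r: "r > 0" "\<And>t. t > 0 \<Longrightarrow> \<not> measure (Qm t z) (ball y r) > 0" by auto
    from r(2)[OF assms] have "measure (Qm t z) (ball y r) = 0" by (simp only: zero_less_measure_iff not_not)
    with r(1) show ?thesis by (intro exI[of _ r]) simp
  qed
  then obtain r where r: "\<And>y. y \<in> - reachable z \<Longrightarrow> r y > 0 \<and> measure (Qm t z) (ball y (r y)) = 0" by metis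
  let ?B = "(\<lambda>y. ball y (r y)) ` (- reachable z)"
  obtain \<F> where \<F>: "\<F> \<subseteq> ?B" "countable \<F>" "\<Union>\<F> = \<Union>?B"
    using Lindelof[of ?B] by auto
  have "\<Union>\<F> \<in> null_sets (Qm t z)"
    using \<F>(1,2) r sets by (intro null_sets_UN'[of \<F> "\<lambda>x. x", simplified]) (auto simp: null_sets_def emeasure_eq_measure)
  moreover have "- reachable z \<subseteq> \<Union>\<F>" unfolding \<F>(3) using r by force
  moreover have "- reachable z \<in> sets (Qm t z)" using sets closed_reachable by auto
  ultimately have "measure (Qm t z) (- reachable z) = 0"
    by (meson null_sets_subset measure_eq_0_null_sets)
  then show ?thesis
    using prob_compl[of "reachable z"] sets closed_reachable
    by (simp add: borel_prob_space[OF Qm_borel_prob] Compl_eq_Diff_UNIV)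
qed

text \<open>Some average from \<open>z\<close> charges \<open>U\<close>; by Feller continuity so do
  averages started near \<open>z\<close>, uniformly. A mean that charges a ball around
  \<open>z\<close> therefore charges \<open>U\<close> by invariance, and it gives no mass to the
  complement of the reachable set.\<close>

lemma (in mfeller) charging_mean_exists:
  assumes lb: "\<And>\<epsilon>. \<epsilon> > 0 \<Longrightarrow> (INF x. Limsup at_top (\<lambda>t. ereal (Qx K t x (ball z \<epsilon>)))) > 0"
    and U: "open U" "y \<in> U" "y \<in> reachable z"
  obtains \<Lambda> where "inv_mean K \<Lambda>" "\<Lambda> (indicator (U \<inter> reachable z)) > 0"
proof -
  obtain r where r: "r > 0" "ball y r \<subseteq> U" using U(1,2) by (auto simp: open_contains_ball)
  obtain t where t: "t > 0" "measure (Qm t z) (ball y r) > 0" using U(3) r(1) by (auto simp: reachable_def)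
  have "\<forall>\<^sub>F k in sequentially. 0 < (\<integral>x. bump (ball y r) k x \<partial>Qm t z)"
    using order_tendstoD(1)[OF integral_bump_tendsto[OF Qm_borel_prob, of "ball y r" t z] t(2)] by simp
  then obtain k where k: "0 < Q t (bump (ball y r) k) z"
    unfolding Q_def by (metis eventually_happens sequentially_bot)
  define b where "b = bump (ball y r) k"
  define c where "c = Q t b z"
  have c: "c > 0" using k by (simp add: c_def b_def)
  have bb: "b \<in> bdd_borel" unfolding b_def by (rule bump_bdd_borel)
  have "continuous_on UNIV (Q t b)"
    using Q_bcontinuous[OF t(1) blipschitz_bcontinuous[OF bump_blipschitz]] by (simp add: b_def bcontinuous_def)
  then have "isCont (Q t b) z" by (simp add: continuous_on_eq_continuous_at)
  then obtain \<delta> where \<delta>: "\<delta> > 0" "\<And>x. dist x z < \<delta> \<Longrightarrow> dist (Q t b x) c < c / 2"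
    unfolding continuous_at_eps_delta c_def[symmetric] using c by (metis half_gt_zero)
  obtain a where a: "a > 0" "\<And>x. \<exists>\<^sub>F t in at_top. a \<le> measure (Qm t x) (ball z \<delta>)"
    using frequent_return[OF lb[OF \<delta>(1)]] by blast
  \<comment> \<open>Return to the ball happens only frequently; clustering along the return times
    passes the lower bound \<open>a\<close> to the limit.\<close>
  define F where "F = inf at_top (principal {t. a \<le> measure (Qm t z) (ball z \<delta>)})"
  have "F \<noteq> bot"
    using a(2)[of z] by (auto simp: F_def trivial_limit_def eventually_inf_principal frequently_def)
  then obtain \<Lambda> G where \<Lambda>: "fa_mean \<Lambda>" "G \<le> F" "G \<noteq> bot"
    and conv: "\<And>f. f \<in> bdd_borel \<Longrightarrow> ((\<lambda>t. \<integral>y. f y \<partial>Qm t z) \<longlongrightarrow> \<Lambda> f) G"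
    using fa_mean_cluster[of "\<lambda>t. Qm t z" F] Qm_borel_prob by metis
  interpret fa_mean \<Lambda> by fact
  have G: "G \<le> at_top" using \<Lambda>(2) by (simp add: F_def)
  note inv = cluster_invariant[OF G \<Lambda>(3) conv[folded Q_def]]
  have pos_t: "\<forall>\<^sub>F t in G. t > 0" by (rule filter_leD[OF G eventually_gt_at_top])
  have Rb: "reachable z \<in> sets borel" using closed_reachable by simp
  have Ub: "U \<in> sets borel" using U(1) by simp
  have int_ind: "(\<integral>y. indicator A y \<partial>Qm t z) = measure (Qm t z) A" for t A
    by (simp add: borel_prob_space[OF Qm_borel_prob])
  have "((\<lambda>t. measure (Qm t z) (reachable z)) \<longlongrightarrow> M (reachable z)) G"
    using conv[OF bdd_borel_indicator[OF Rb]] by (simp only: int_ind)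
  moreover have "((\<lambda>t. measure (Qm t z) (reachable z)) \<longlongrightarrow> 1) G"
    by (rule tendsto_eventually) (rule eventually_mono[OF pos_t], rule measure_reachable)
  ultimately have M1: "M (reachable z) = 1" using tendsto_unique[OF \<Lambda>(3)] by blast
  have Ma: "a \<le> M (ball z \<delta>)"
  proof (rule tendsto_lowerbound[OF _ _ \<Lambda>(3)])
    show "((\<lambda>t. measure (Qm t z) (ball z \<delta>)) \<longlongrightarrow> M (ball z \<delta>)) G"
      using conv[OF bdd_borel_indicator[of "ball z \<delta>"]] unfolding int_ind by simp
    show "\<forall>\<^sub>F t in G. a \<le> measure (Qm t z) (ball z \<delta>)"
      by (rule filter_leD[OF \<Lambda>(2)]) (simp add: F_def eventually_inf_principal)
  qed
  have "(c / 2) * a \<le> (c / 2) * M (ball z \<delta>)" using Ma c by simp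
  also have "\<dots> = \<Lambda> (\<lambda>x. (c / 2) * indicator (ball z \<delta>) x)" by (rule scale[symmetric]) simp
  also have "\<dots> \<le> \<Lambda> (Q t b)"
  proof (intro mono bdd_borel_cmult bdd_borel_indicator Q_bdd_borel bb)
    fix x
    have "0 \<le> Q t b x" using Q_mono[of "\<lambda>_. 0" b t x] bb by (simp add: b_def bump_nonneg Q_def)
    moreover have "c / 2 \<le> Q t b x" if "x \<in> ball z \<delta>"
    proof -
      have "dist x z < \<delta>" using that by (simp add: dist_commute)
      from \<delta>(2)[OF this] have "\<bar>Q t b x - c\<bar> < c / 2" by (simp only: dist_real_def)
      then have "c - Q t b x < c / 2" using abs_ge_minus_self[of "Q t b x - c"] by (simp only: minus_diff_eq)
      then show ?thesis by simp
    qed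
    ultimately show "c / 2 * indicator (ball z \<delta>) x \<le> Q t b x"
      by (simp add: indicator_def)
  qed auto
  also have "\<dots> = \<Lambda> b" by (rule inv(2)[OF _ bb t(1)])
  also have "\<dots> \<le> M U"
  proof (intro mono bb bdd_borel_indicator Ub)
    fix x show "b x \<le> indicator U x"
    proof -
      have "b x \<le> indicator (ball y r) x" unfolding b_def by (rule bump_le_indicator)
      also have "\<dots> \<le> indicator U x" using r(2) by (auto simp: indicator_def)
      finally show ?thesis .
    qed
  qed
  finally have MU: "(c / 2) * a \<le> M U" .
  have "M U \<le> M ((U \<inter> reachable z) \<union> (- reachable z))"
    using Ub Rb by (intro M_mono) auto
  also have "\<dots> \<le> M (U \<inter> reachable z) + M (- reachable z)" using Ub Rb by (intro M_Un_le) auto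
  also have "M (- reachable z) = 0" using M_Compl[OF Rb] M1 by simp
  finally have "M (U \<inter> reachable z) > 0" using MU c a(1) by (smt (verit) mult_pos_pos half_gt_zero)
  moreover have "inv_mean K \<Lambda>" by unfold_locales (rule inv(1), auto)
  ultimately show thesis using that by blast
qed

text \<open>Adding \<open>g\<close> to and subtracting it from a Lipschitz function by lattice operations keeps the Lipschitz constant.\<close>
lemma max_min_perturbation:
  fixes f g :: real
  assumes "0 \<le> f" "f \<le> 1" "0 \<le> g" "g \<le> 1"
  shows "0 \<le> max f g - min f (1 - g)" "max f g - min f (1 - g) \<le> 2 * g" "g = 1 \<Longrightarrow> 1 / 2 \<le> max f g - min f (1 - g)"
  using assms by auto

text \<open>Two perturbations of \<open>f0\<close>, upward and downward, both stay in
  \<open>A\<close>, and their difference dominates half the indicator of the far set. Stability of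
  both after \<open>N1\<close> reduces the bound at all later times to the single time
  \<open>N1\<close>.\<close>

lemma (in mfeller) averages_tight:
  assumes lb: "\<And>\<epsilon>. \<epsilon> > 0 \<Longrightarrow> (INF x. Limsup at_top (\<lambda>t. ereal (Qx K t x (ball z \<epsilon>)))) > 0"
    and merge: "\<And>f x. blipschitz f \<Longrightarrow> (\<lambda>n. Q (real n) f x - Q (real n) f z) \<longlonglongrightarrow> 0"
    and r: "r > 0" and \<eta>: "\<eta> > 0"
  obtains D where "finite D" "\<forall>\<^sub>F n in sequentially. Q (real n) (indicator {x. \<forall>d\<in>D. r \<le> dist x d}) z \<le> \<eta>"
proof -
  obtain d :: "nat \<Rightarrow> 'a" where dense: "\<And>x e. e > 0 \<Longrightarrow> \<exists>i. dist x (d i) < e" using dense_sequence_exists by blast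
  \<comment> \<open>The total is \<open>2 * (2 * \<eta>' + 8 * \<eta>')\<close>: the term at
    \<open>N1\<close>, plus a stability error of \<open>4 * \<eta>'\<close> for each of the two
    perturbations, doubled.\<close>
  define \<eta>' where "\<eta>' = \<eta> / 20"
  have \<eta>': "\<eta>' > 0" using \<eta> by (simp add: \<eta>'_def)
  \<comment> \<open>With this slope \<open>g\<close> reaches \<open>1\<close> at distance
    \<open>r\<close> from the chosen points.\<close>
  define L where "L = 1 / r"
  have L: "L > 0" "L \<ge> 0" using r by (simp_all add: L_def)
  have "reachable z \<noteq> {}" using measure_reachable[of 1 z] by auto
  obtain f0 y0 N0 A U where f0: "f0 \<in> Lip01 L" "y0 \<in> reachable z" "open A" "f0 \<circ> d \<in> A" "open U" "y0 \<in> U"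
    and unif: "\<And>f y n. f \<in> Lip01 L \<Longrightarrow> f \<circ> d \<in> A \<Longrightarrow> y \<in> U \<inter> reachable z \<Longrightarrow> n \<ge> N0 \<Longrightarrow> \<bar>Q (real n) f y - Q (real n) f z\<bar> \<le> \<eta>'"
  proof (rule averages_uniform_somewhere[of d "reachable z" L \<eta>' z])
    fix f0 y0 N A U
    assume *: "f0 \<in> Lip01 L" "y0 \<in> reachable z" "open A" "f0 \<circ> d \<in> A" "open U" "y0 \<in> U"
      "\<And>f y n. f \<in> Lip01 L \<Longrightarrow> f \<circ> d \<in> A \<Longrightarrow> y \<in> U \<inter> reachable z \<Longrightarrow> n \<ge> N \<Longrightarrow> \<bar>Q (real n) f y - Q (real n) f z\<bar> \<le> \<eta>'"
    show thesis by (rule that[OF *])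
  qed (use dense closed_reachable \<open>reachable z \<noteq> {}\<close> L(2) \<eta>' merge in auto)
  obtain \<Lambda> where \<Lambda>: "inv_mean K \<Lambda>" "\<Lambda> (indicator (U \<inter> reachable z)) > 0"
    using charging_mean_exists[OF lb f0(5,6,2)] by blast
  interpret inv_mean K \<Lambda> by fact
  have Wb: "U \<inter> reachable z \<in> sets borel" using f0(5) closed_reachable by simp
  obtain N1 where N1: "N1 \<ge> N0" "N1 > 0"
    and stab: "\<And>f N. f \<in> bdd_borel \<Longrightarrow> (\<And>x. 0 \<le> f x) \<Longrightarrow> (\<And>x. f x \<le> 1) \<Longrightarrow>
       (\<And>n x. n \<ge> N0 \<Longrightarrow> x \<in> U \<inter> reachable z \<Longrightarrow> \<bar>Q (real n) f x - Q (real n) f z\<bar> \<le> \<eta>') \<Longrightarrow> N \<ge> N1 \<Longrightarrow>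
       \<bar>Q (real N) f z - Q (real N1) f z\<bar> \<le> 4 * \<eta>'"
  proof (rule averages_almost_constant[OF Wb \<Lambda>(2) \<eta>'])
    fix N1
    assume *: "N1 \<ge> N0" "N1 > 0" "\<And>f N. f \<in> bdd_borel \<Longrightarrow> (\<And>x. 0 \<le> f x) \<Longrightarrow> (\<And>x. f x \<le> 1) \<Longrightarrow>
       (\<And>n x. n \<ge> N0 \<Longrightarrow> x \<in> U \<inter> reachable z \<Longrightarrow> \<bar>Q (real n) f x - Q (real n) f z\<bar> \<le> \<eta>') \<Longrightarrow> N \<ge> N1 \<Longrightarrow>
       \<bar>Q (real N) f z - Q (real N1) f z\<bar> \<le> 4 * \<eta>'"
    show thesis by (rule that[OF *])
  qed
  have stab_A: "\<bar>Q (real N) f z - Q (real N1) f z\<bar> \<le> 4 * \<eta>'" if "f \<in> Lip01 L" "f \<circ> d \<in> A" "N \<ge> N1" for f N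
    by (rule stab) (use that Lip01_bdd_borel unif in \<open>auto simp: Lip01_def\<close>)
  \<comment> \<open>It vanishes at the first points of the dense sequence, so the perturbed codes
    converge to that of \<open>f0\<close>, yet it equals \<open>1\<close> on the far set.\<close>
  define g where "g n x = min 1 (L * infdist x (d ` {..n}))" for n x
  have g01: "0 \<le> g n x" "g n x \<le> 1" for n x using L by (auto simp: g_def infdist_nonneg)
  have g_lip: "L-lipschitz_on UNIV (g n)" for n
    unfolding g_def[abs_def] by (intro min_lipschitz_real const_lipschitz scaled_infdist_lipschitz L)
  have g_d: "g n (d i) = 0" if "i \<le> n" for n i using that by (simp add: g_def)
  have g_lim: "(\<lambda>n. g n x) \<longlonglongrightarrow> 0" for x
  proof (rule LIMSEQ_I)
    fix e :: real assume e: "e > 0"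
    then obtain i where i: "dist x (d i) < e / L" using dense[of "e / L" x] L by auto
    have "norm (g n x - 0) < e" if "n \<ge> i" for n
    proof -
      have "infdist x (d ` {..n}) \<le> dist x (d i)" using that by (intro infdist_le) auto
      then have "L * infdist x (d ` {..n}) < e" using i L by (simp add: field_simps) (metis le_less_trans mult.commute pos_less_divide_eq)
      then show ?thesis using g01[of n x] by (simp add: g_def)
    qed
    then show "\<exists>no. \<forall>n\<ge>no. norm (g n x - 0) < e" by blast
  qed
  define fu where "fu n x = max (f0 x) (g n x)" for n x
  define fl where "fl n x = min (f0 x) (1 - g n x)" for n x
  have f01: "0 \<le> f0 x" "f0 x \<le> 1" for x using f0(1) by (auto simp: Lip01_def)
  have fu: "fu n \<in> Lip01 L" for n
    unfolding Lip01_def fu_def[abs_def] using f0(1) g01 g_lip f01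
    by (auto simp: Lip01_def intro!: max_lipschitz_real) (simp add: max_def)
  have fl: "fl n \<in> Lip01 L" for n
  proof -
    have "L-lipschitz_on UNIV (\<lambda>x. 1 - g n x)"
      using g_lip[of n] by (auto simp: lipschitz_on_def dist_real_def abs_minus_commute)
    then show ?thesis
      unfolding Lip01_def fl_def[abs_def] using f0(1) g01 f01
      by (auto simp: Lip01_def intro!: min_lipschitz_real) (simp add: min_def)
  qed
  have "(\<lambda>n. fu n \<circ> d) \<longlonglongrightarrow> (f0 \<circ> d)" "(\<lambda>n. fl n \<circ> d) \<longlonglongrightarrow> (f0 \<circ> d)"
  proof -
    have "fu n (d i) = f0 (d i)" "fl n (d i) = f0 (d i)" if "n \<ge> i" for n i
      using g_d[OF that] f01[of "d i"] by (simp_all add: fu_def fl_def)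
    then show "(\<lambda>n. fu n \<circ> d) \<longlonglongrightarrow> (f0 \<circ> d)" "(\<lambda>n. fl n \<circ> d) \<longlonglongrightarrow> (f0 \<circ> d)"
      unfolding tendsto_fun_iff eventually_sequentially
      by (auto simp: eventually_sequentially intro!: tendsto_eventually exI)
  qed
  then have "\<forall>\<^sub>F n in sequentially. fu n \<circ> d \<in> A" "\<forall>\<^sub>F n in sequentially. fl n \<circ> d \<in> A"
    using f0(3,4) by (auto simp: topological_tendstoD)
  \<comment> \<open>The time \<open>N1\<close> is fixed before \<open>n\<close>, so dominated
    convergence under one probability measure is enough.\<close>
  moreover have "\<forall>\<^sub>F n in sequentially. Q (real N1) (g n) z < \<eta>'"
  proof -
    have gb: "g n \<in> bdd_borel" for n
      using g01 g_lip[of n] by (intro Lip01_bdd_borel[of _ L]) (auto simp: Lip01_def)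
    have "(\<lambda>n. Q (real N1) (g n) z) \<longlonglongrightarrow> (\<integral>x. 0 \<partial>Qm (real N1) z)"
      unfolding Q_def by (rule borel_prob_tendsto_integral[OF Qm_borel_prob gb, where B=1]) (use g01 g_lim in auto)
    then show ?thesis using \<eta>' by (intro order_tendstoD(2)) auto
  qed
  ultimately have "\<forall>\<^sub>F n in sequentially. fu n \<circ> d \<in> A \<and> fl n \<circ> d \<in> A \<and> Q (real N1) (g n) z < \<eta>'"
    by eventually_elim auto
  then obtain n where n: "fu n \<circ> d \<in> A" "fl n \<circ> d \<in> A" "Q (real N1) (g n) z < \<eta>'"
    by (metis (mono_tags, lifting) eventually_happens sequentially_bot)
  have gb: "g n \<in> bdd_borel"
    using g01 g_lip[of n] by (intro Lip01_bdd_borel[of _ L]) (auto simp: Lip01_def)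
  note fub = Lip01_bdd_borel[OF fu] and flb = Lip01_bdd_borel[OF fl]
  let ?R = "{x. \<forall>e\<in>d ` {..n}. r \<le> dist x e}"
  have "closed ?R"
    unfolding Collect_ball_eq by (intro closed_INT ballI closed_Collect_le continuous_intros)
  then have Rb: "?R \<in> sets borel" by simp
  have "Q (real N) (indicator ?R) z \<le> \<eta>" if N: "N \<ge> N1" for N
  proof -
    have "Q (real N) (indicator ?R) z \<le> Q (real N) (\<lambda>x. 2 * (fu n x - fl n x)) z"
    proof (intro Q_mono bdd_borel_indicator Rb bdd_borel_cmult bdd_borel_diff fub flb)
      fix x
      show "indicator ?R x \<le> 2 * (fu n x - fl n x)"
      proof (cases "x \<in> ?R")
        case True
        have "r \<le> infdist x (d ` {..n})"
          using True by (auto simp: infdist_notempty intro!: cINF_greatest)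
        then have "1 \<le> L * infdist x (d ` {..n})" using r by (simp add: L_def field_simps)
        then have "g n x = 1" by (simp add: g_def)
        then show ?thesis using max_min_perturbation(3)[of "f0 x" "g n x"] f01[of x] g01[of n x] True by (simp add: fu_def fl_def)
      next
        case False
        then show ?thesis using max_min_perturbation(1)[of "f0 x" "g n x"] f01[of x] g01[of n x] by (simp add: fu_def fl_def)
      qed
    qed
    also have "\<dots> = 2 * (Q (real N) (fu n) z - Q (real N) (fl n) z)" by (simp only: Q_cmult Q_diff[OF fub flb])
    also have "\<dots> \<le> 2 * (Q (real N1) (fu n) z - Q (real N1) (fl n) z + 8 * \<eta>')"
      using stab_A[OF fu n(1) N] stab_A[OF fl n(2) N] by (simp add: abs_le_iff)
    also have "Q (real N1) (fu n) z - Q (real N1) (fl n) z = Q (real N1) (\<lambda>x. fu n x - fl n x) z" by (simp only: Q_diff[OF fub flb])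
    also have "\<dots> \<le> Q (real N1) (\<lambda>x. 2 * g n x) z"
      using max_min_perturbation(2) f01 g01 by (intro Q_mono bdd_borel_diff fub flb bdd_borel_cmult gb) (simp add: fu_def fl_def)
    also have "\<dots> = 2 * Q (real N1) (g n) z" by (rule Q_cmult)
    finally show ?thesis using n(3) by (simp add: \<eta>'_def)
  qed
  then show thesis by (intro that[of "d ` {..n}"]) (auto simp: eventually_sequentially)
qed

text \<open>A cluster mean along integer times is tight, hence is integration against a measure on
  bounded continuous functions.\<close>

lemma (in mfeller) invariant_exists:
  assumes tight: "\<And>r \<eta>. r > 0 \<Longrightarrow> \<eta> > 0 \<Longrightarrow>
      \<exists>D. finite D \<and> (\<forall>\<^sub>F n in sequentially. Q (real n) (indicator {x. \<forall>d\<in>D. r \<le> dist x d}) z \<le> \<eta>)"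
  obtains \<mu> where "invariant K \<mu>"
proof -
  define F where "F = filtermap real sequentially"
  have F: "F \<noteq> bot" "F \<le> at_top"
    using filterlim_real_sequentially by (auto simp: F_def filtermap_bot_iff filterlim_def)
  obtain \<Lambda> G where \<Lambda>: "fa_mean \<Lambda>" "G \<le> F" "G \<noteq> bot"
    and conv: "\<And>f. f \<in> bdd_borel \<Longrightarrow> ((\<lambda>t. \<integral>y. f y \<partial>Qm t z) \<longlongrightarrow> \<Lambda> f) G"
    using fa_mean_cluster[of "\<lambda>t. Qm t z" F] Qm_borel_prob F(1) by metis
  interpret fa_mean \<Lambda> by fact
  have G: "G \<le> at_top" using \<Lambda>(2) F(2) by simp
  interpret tight_mean \<Lambda>
  proof
    fix r \<eta> :: real assume "r > 0" "\<eta> > 0"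
    then obtain D where D: "finite D" "\<forall>\<^sub>F n in sequentially. Q (real n) (indicator {x. \<forall>d\<in>D. r \<le> dist x d}) z \<le> \<eta>"
      using tight by blast
    let ?R = "{x. \<forall>d\<in>D. r \<le> dist x d}"
    have "closed ?R"
      unfolding Collect_ball_eq by (intro closed_INT ballI closed_Collect_le continuous_intros)
    then have Rb: "?R \<in> sets borel" by simp
    have "M ?R \<le> \<eta>"
    proof (rule tendsto_upperbound[OF conv[OF bdd_borel_indicator[OF Rb]] _ \<Lambda>(3)])
      show "\<forall>\<^sub>F t in G. (\<integral>y. indicator ?R y \<partial>Qm t z) \<le> \<eta>"
        by (rule filter_leD[OF \<Lambda>(2)]) (use D(2) in \<open>simp add: F_def eventually_filtermap Q_def\<close>)
    qed
    with D(1) show "\<exists>D. finite D \<and> M {x. \<forall>d\<in>D. r \<le> dist x d} \<le> \<eta>" by blast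
  qed
  obtain \<mu> where \<mu>: "borel_prob \<mu>" "\<And>f. bcontinuous f \<Longrightarrow> \<Lambda> f = (\<integral>x. f x \<partial>\<mu>)" using obtain_measure by blast
  have sp: "\<mu> \<in> space (prob_algebra borel)" using \<mu>(1) by (simp add: space_prob_algebra borel_prob_def)
  have "\<mu> \<bind> K t = \<mu>" if t: "t \<ge> 0" for t
  proof (rule borel_prob_eqI)
    show "borel_prob (\<mu> \<bind> K t)"
      using prob_space_bind'[OF sp K_kernel[OF t]] sets_bind'[OF sp K_kernel[OF t]] by (simp add: borel_prob_def)
    fix f :: "'a \<Rightarrow> real" assume "blipschitz f"
    then have f: "bcontinuous f" "f \<in> bdd_borel" by (auto intro: blipschitz_bcontinuous bcontinuous_bdd_borel)
    have "(\<integral>x. f x \<partial>(\<mu> \<bind> K t)) = (\<integral>x. P t f x \<partial>\<mu>)"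
      unfolding P_def by (rule integral_kernel_bind[OF \<mu>(1) K_kernel[OF t] f(2)])
    \<comment> \<open>Here the Feller property enters: \<open>P t f\<close> is again bounded
      continuous, so mean and integral agree on it and invariance passes from
      \<open>\<Lambda>\<close> to \<open>\<mu>\<close>.\<close>
    also have "\<dots> = \<Lambda> (P t f)" using \<mu>(2)[OF P_bcontinuous[OF t f(1)]] by simp
    also have "\<dots> = \<Lambda> f" by (rule cluster_invariant(1)[OF G \<Lambda>(3) conv[folded Q_def] f(2) t])
    also have "\<dots> = (\<integral>x. f x \<partial>\<mu>)" by (rule \<mu>(2)[OF f(1)])
    finally show "(\<integral>x. f x \<partial>(\<mu> \<bind> K t)) = (\<integral>x. f x \<partial>\<mu>)" .
  qed (rule \<mu>(1))
  then show thesis using that \<mu>(1) by (auto simp: invariant_def)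
qed

theorem theorem3p12:
  fixes K :: "real \<Rightarrow> 'a::polish_space \<Rightarrow> 'a measure"
  assumes "markov_feller K"
  shows "weak_star_mean_ergodic K \<longleftrightarrow>
    ((\<forall>z. cesaro_ev_cont K z) \<and>
     (\<exists>z. \<forall>\<epsilon>>0. (INF x. Limsup at_top (\<lambda>t. ereal (Qx K t x (ball z \<epsilon>)))) > 0))"
proof -
  interpret mfeller K using assms by unfold_locales
  show ?thesis
  proof (intro iffI)
    assume "weak_star_mean_ergodic K"
    then show "(\<forall>z. cesaro_ev_cont K z) \<and> (\<exists>z. \<forall>\<epsilon>>0. (INF x. Limsup at_top (\<lambda>t. ereal (Qx K t x (ball z \<epsilon>)))) > 0)"
      using mean_ergodicD by blast
  next
    assume hyp: "(\<forall>z. cesaro_ev_cont K z) \<and> (\<exists>z. \<forall>\<epsilon>>0. (INF x. Limsup at_top (\<lambda>t. ereal (Qx K t x (ball z \<epsilon>)))) > 0)"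
    then obtain z where lb: "\<And>\<epsilon>. \<epsilon> > 0 \<Longrightarrow> (INF x. Limsup at_top (\<lambda>t. ereal (Qx K t x (ball z \<epsilon>)))) > 0" by blast
    have merge: "(\<lambda>n. Q (real n) f x - Q (real n) f z) \<longlonglongrightarrow> 0" if "blipschitz f" for f x
      using averages_merge[OF _ lb that] hyp by blast
    obtain \<mu> where \<mu>: "invariant K \<mu>"
    proof (rule invariant_exists[of z])
      fix r \<eta> :: real assume "r > 0" "\<eta> > 0"
      then show "\<exists>D. finite D \<and> (\<forall>\<^sub>F n in sequentially. Q (real n) (indicator {x. \<forall>d\<in>D. r \<le> dist x d}) z \<le> \<eta>)"
        using averages_tight[of z r \<eta>, OF lb merge] by blast
    qed
    show "weak_star_mean_ergodic K" by (rule mean_ergodicI[OF merge \<mu>])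
  qed
qed

end
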